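(* Let $p$ be an odd prime and let $\chi$ be a primitive odd Dirichlet character modulo $N$, with $p\nmid N$. In the localized Iwasawa algebra $\Sigma^{-1}\Lambda_K(G)$, $$\mathcal I_{\chi,N,p}=\mathcal Z_{1/2}\star\nu^\times_{\chi,N}.$$ On Mellin branches, for $j\in\mathbb Z/(p-1)\mathbb Z$, $$\mathcal M_{\mathcal I_{\chi,N,p},j}(s)=G(\chi)\,Z_{1/2,j}(s)\,L^{(p)}_{\chi^{-1},j}(s).$$
   Context: $K/\mathbb Q_p$ is a finite extension, with valuation ring $\mathcal O$, containing the values of $\chi$ and a primitive $N$-th root of unity $\zeta_N$. $G=\mathbb Z_p^\times$; $\Lambda_K(G)=\mathcal O[[G]][1/p]$ is the algebra of bounded $K$-valued measures on $G$ under multiplicative convolution $\star$ (push-forward of the product under $(x,y)\mapsto xy$). $r_c=\delta_1-c\,\delta_c$ for odd integers $c>1$ prime to $p$; $\Sigma$ is the multiplicative set generated by the $r_c$. $G(\chi)=\sum_{a\in(\mathbb Z/N)^\times}\chi(a)\zeta_N^a$. $\lambda_{1/2,c}$ is the bounded measure on $\mathbb Z_p$ with $\int_{\mathbb Z_p}(1+T)^xd\lambda_{1/2,c}(x)=\frac{(1+T)^{1/2}}T-c\frac{(1+T)^{c/2}}{(1+T)^c-1}$; $\lambda_{1/2,c}^\times$ is its restriction to $G$. $\mathcal Z_{1/2}=r_c^{-1}\star\lambda^\times_{1/2,c}$, independent of $c$. For a root of unity $z\ne1$ of order prime to $p$, $\mu_z$ is the measure on $\mathbb Z_p$ with $\mu_z(a+p^m\mathbb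 Z_p)=z^a/(1-z^{p^m})$, $0\le a<p^m$; $\nu_z^\times=x^{-1}\mathbf 1_G\mu_z$; $\nu^\times_{\chi,N}=\sum_{a\in(\mathbb Z/N)^\times}\chi(a)\nu^\times_{\zeta_N^a}$. $\mathcal I_{\chi,N,p}=r_c^{-1}\star(\lambda^\times_{1/2,c}\star\nu^\times_{\chi,N})$, independent of $c$; it is the pseudomeasure of the packet $\sum_a\chi(a)[\zeta_N^a]_{\mathrm{cyc}}$. Write $x=\omega(x)\langle x\rangle$ with $\omega(x)\in\mu_{p-1}$, $\langle x\rangle\in1+p\mathbb Z_p$. $\mathcal M_{\rho,j}(s)=\int_G\omega(x)^j\langle x\rangle^sd\rho(x)$ for $\rho\in\Lambda_K(G)$ and $\mathcal M_{A/r,j}=\mathcal M_{A,j}/\mathcal M_{r,j}$ on the localization. $Z_{1/2,j}(s)=\mathcal M_{\mathcal Z_{1/2},j}(s)$ and $L^{(p)}_{\chi^{-1},j}(s)=G(\chi)^{-1}\mathcal M_{\nu^\times_{\chi,N},j}(s)$. *)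

theory Defs
  imports
    "HOL-Analysis.Analysis"
    "HOL-Computational_Algebra.Formal_Laurent_Series"
    "HOL-Number_Theory.Totient"
    "HOL-Algebra.Ring"
begin

section \<open>Finite extensions of the p-adic numbers\<close>

text \<open>
  A finite extension \<open>K\<close> of the \<open>p\<close>-adic field is a type \<open>'k\<close> carrying a complete metric that comes
  from a multiplicative ultrametric absolute value \<open>dist x 0\<close>, normalised by \<open>|p| = 1/p\<close>. By
  completeness the closure of \<open>\<rat>\<close> in \<open>K\<close> is a completion of \<open>\<rat>\<close> for the \<open>p\<close>-adic absolute value,
  i.e. the \<open>p\<close>-adic field, and the closure of \<open>\<int>\<close> is the ring of \<open>p\<close>-adic integers. The
  class \<open>real_normed_field\<close> is not usable here: such a \<open>K\<close> is not a real vector space.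
\<close>

definition padic_rats :: "'k::{field_char_0,metric_space} set" where
  "padic_rats = closure \<rat>"

definition padic_ints :: "'k::{field_char_0,metric_space} set" where
  "padic_ints = closure \<int>"

definition padic_units :: "'k::{field_char_0,metric_space} set" where
  "padic_units = {x \<in> padic_ints. x \<noteq> 0 \<and> inverse x \<in> padic_ints}"

definition padic_finite_extension :: "nat \<Rightarrow> 'k::{field_char_0,complete_space} itself \<Rightarrow> bool" where
  "padic_finite_extension p K \<longleftrightarrow>
     prime p \<and>
     (\<forall>x y::'k. dist x y = dist (x - y) 0) \<and>
     (\<forall>x y::'k. dist (x * y) 0 = dist x 0 * dist y 0) \<and>
     (\<forall>x y::'k. dist (x + y) 0 \<le> max (dist x 0) (dist y 0)) \<and>
     dist (of_nat p :: 'k) 0 = 1 / real p \<and>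
     (\<exists>B::'k set. finite B \<and>
        (\<forall>x. \<exists>u. (\<forall>b\<in>B. u b \<in> padic_rats) \<and> x = (\<Sum>b\<in>B. u b * b)))"

definition padic_ball :: "nat \<Rightarrow> nat \<Rightarrow> nat \<Rightarrow> 'k::{field_char_0,metric_space} set" where
  "padic_ball p a m = (\<lambda>y. of_nat a + of_nat p ^ m * y) ` padic_ints"

section \<open>Bounded measures\<close>

text \<open>
  A bounded \<open>K\<close>-valued measure on a compact open \<open>X\<close> in the \<open>p\<close>-adic integers is a bounded finitely
  additive function on the clopen subsets of \<open>X\<close>. It is made extensional by giving all other sets
  the value \<open>0\<close>, so that equality of measures is equality of functions.
\<close>

definition clopen_in :: "'k::topological_space set \<Rightarrow> 'k set \<Rightarrow> bool" where
  "clopen_in X U \<longleftrightarrow> openin (top_of_set X) U \<and> closedin (top_of_set X) U"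

definition bounded_measure :: "'k::{field_char_0,metric_space} set \<Rightarrow> ('k set \<Rightarrow> 'k) \<Rightarrow> bool" where
  "bounded_measure X \<mu> \<longleftrightarrow>
     (\<forall>U. \<not> clopen_in X U \<longrightarrow> \<mu> U = 0) \<and>
     (\<forall>U V. clopen_in X U \<and> clopen_in X V \<and> U \<inter> V = {} \<longrightarrow> \<mu> (U \<union> V) = \<mu> U + \<mu> V) \<and>
     (\<exists>B. \<forall>U. dist (\<mu> U) 0 \<le> B)"

text \<open>
  The integral over \<open>X\<close> of a continuous function, as the limit of Riemann sums over the balls
  \<open>a + p\<^sup>n\<int>\<^sub>p\<close>. For \<open>X\<close> compact open and \<open>n\<close> large, \<open>X\<close> is the disjoint union of those with \<open>a \<in> X\<close>.
\<close>

definition padic_integral ::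
    "nat \<Rightarrow> 'k::{field_char_0,metric_space} set \<Rightarrow> ('k set \<Rightarrow> 'k) \<Rightarrow> ('k \<Rightarrow> 'k) \<Rightarrow> 'k" where
  "padic_integral p X \<mu> f =
     lim (\<lambda>n. \<Sum>a | a < p ^ n \<and> of_nat a \<in> X. f (of_nat a) * \<mu> (X \<inter> padic_ball p a n))"

definition restrict_measure ::
    "'k::{field_char_0,metric_space} set \<Rightarrow> ('k set \<Rightarrow> 'k) \<Rightarrow> ('k set \<Rightarrow> 'k)" where
  "restrict_measure X \<mu> = (\<lambda>U. if clopen_in X U then \<mu> U else 0)"

definition density_measure ::
    "nat \<Rightarrow> 'k::{field_char_0,metric_space} set \<Rightarrow> ('k \<Rightarrow> 'k) \<Rightarrow> ('k set \<Rightarrow> 'k) \<Rightarrow> ('k set \<Rightarrow> 'k)" where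
  "density_measure p X f \<mu> =
     (\<lambda>U. if clopen_in X U then padic_integral p X \<mu> (\<lambda>x. indicator U x * f x) else 0)"

definition dirac_measure ::
    "'k::{field_char_0,metric_space} set \<Rightarrow> 'k \<Rightarrow> ('k set \<Rightarrow> 'k)" where
  "dirac_measure X x = (\<lambda>U. if clopen_in X U \<and> x \<in> U then 1 else 0)"

definition mult_convolution ::
    "nat \<Rightarrow> ('k::{field_char_0,metric_space} set \<Rightarrow> 'k) \<Rightarrow> ('k set \<Rightarrow> 'k) \<Rightarrow> ('k set \<Rightarrow> 'k)" where
  "mult_convolution p \<mu> \<nu> =
     (\<lambda>U. if clopen_in padic_units U
          then padic_integral p padic_units \<mu>
                 (\<lambda>x. padic_integral p padic_units \<nu> (\<lambda>y. indicator U (x * y)))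
          else 0)"

definition iwasawa_algebra :: "nat \<Rightarrow> ('k::{field_char_0,metric_space} set \<Rightarrow> 'k) ring" where
  "iwasawa_algebra p =
     \<lparr>carrier = {\<mu>. bounded_measure padic_units \<mu>},
      mult = mult_convolution p,
      one = dirac_measure padic_units 1,
      zero = (\<lambda>_. 0),
      add = (\<lambda>\<mu> \<nu> U. \<mu> U + \<nu> U)\<rparr>"

section \<open>Localization\<close>

inductive_set mult_generated :: "('a, 'm) ring_scheme \<Rightarrow> 'a set \<Rightarrow> 'a set"
  for R (structure) and A where
    one: "\<one> \<in> mult_generated R A"
  | step: "a \<in> A \<Longrightarrow> s \<in> mult_generated R A \<Longrightarrow> a \<otimes> s \<in> mult_generated R A"

definition loc_rel :: "('a, 'm) ring_scheme \<Rightarrow> 'a set \<Rightarrow> (('a \<times> 'a) \<times> ('a \<times> 'a)) set" where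
  "loc_rel R S = {((a, s), (b, t)).
     a \<in> carrier R \<and> s \<in> S \<and> b \<in> carrier R \<and> t \<in> S \<and>
     (\<exists>u\<in>S. u \<otimes>\<^bsub>R\<^esub> (a \<otimes>\<^bsub>R\<^esub> t) = u \<otimes>\<^bsub>R\<^esub> (b \<otimes>\<^bsub>R\<^esub> s))}"

definition loc_frac :: "('a, 'm) ring_scheme \<Rightarrow> 'a set \<Rightarrow> 'a \<Rightarrow> 'a \<Rightarrow> ('a \<times> 'a) set" where
  "loc_frac R S a s = loc_rel R S `` {(a, s)}"

definition localization :: "('a, 'm) ring_scheme \<Rightarrow> 'a set \<Rightarrow> ('a \<times> 'a) set ring" where
  "localization R S =
     \<lparr>carrier = (carrier R \<times> S) // loc_rel R S,
      mult = (\<lambda>X Y. \<Union>(a, s)\<in>X. \<Union>(b, t)\<in>Y. loc_frac R S (a \<otimes>\<^bsub>R\<^esub> b) (s \<otimes>\<^bsub>R\<^esub> t)),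
      one = loc_frac R S \<one>\<^bsub>R\<^esub> \<one>\<^bsub>R\<^esub>,
      zero = loc_frac R S \<zero>\<^bsub>R\<^esub> \<one>\<^bsub>R\<^esub>,
      add = (\<lambda>X Y. \<Union>(a, s)\<in>X. \<Union>(b, t)\<in>Y.
               loc_frac R S ((a \<otimes>\<^bsub>R\<^esub> t) \<oplus>\<^bsub>R\<^esub> (b \<otimes>\<^bsub>R\<^esub> s)) (s \<otimes>\<^bsub>R\<^esub> t))\<rparr>"

section \<open>The regularised half-shift measure\<close>

definition admissible :: "nat \<Rightarrow> nat \<Rightarrow> bool" where
  "admissible p c \<longleftrightarrow> odd c \<and> 1 < c \<and> coprime c p"

definition regulariser :: "nat \<Rightarrow> ('k::{field_char_0,metric_space} set \<Rightarrow> 'k)" where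
  "regulariser c =
     (\<lambda>U. dirac_measure padic_units 1 U - of_nat c * dirac_measure padic_units (of_nat c) U)"

definition reg_set :: "nat \<Rightarrow> ('k::{field_char_0,metric_space} set \<Rightarrow> 'k) set" where
  "reg_set p = mult_generated (iwasawa_algebra p) {regulariser c | c. admissible p c}"

definition iwasawa_frac ::
    "nat \<Rightarrow> ('k::{field_char_0,metric_space} set \<Rightarrow> 'k) \<Rightarrow> ('k set \<Rightarrow> 'k) \<Rightarrow>
     (('k set \<Rightarrow> 'k) \<times> ('k set \<Rightarrow> 'k)) set" where
  "iwasawa_frac p = loc_frac (iwasawa_algebra p) (reg_set p)"

definition iwasawa_loc ::
    "nat \<Rightarrow> (('k::{field_char_0,metric_space} set \<Rightarrow> 'k) \<times> ('k set \<Rightarrow> 'k)) set ring" where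
  "iwasawa_loc p = localization (iwasawa_algebra p) (reg_set p)"

definition iwasawa_embed ::
    "nat \<Rightarrow> ('k::{field_char_0,metric_space} set \<Rightarrow> 'k) \<Rightarrow>
     (('k set \<Rightarrow> 'k) \<times> ('k set \<Rightarrow> 'k)) set" where
  "iwasawa_embed p \<mu> = iwasawa_frac p \<mu> \<one>\<^bsub>iwasawa_algebra p\<^esub>"

text \<open>The power series \<open>\<integral> (1 + T)\<^sup>x d\<mu>(x)\<close>, with \<open>(1 + T)\<^sup>x\<close> the binomial series.\<close>

definition amice_transform ::
    "nat \<Rightarrow> ('k::{field_char_0,metric_space} set \<Rightarrow> 'k) \<Rightarrow> 'k fps" where
  "amice_transform p \<mu> =
     Abs_fps (\<lambda>k. padic_integral p padic_ints \<mu> (\<lambda>x. fps_nth (fps_binomial x) k))"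

text \<open>
  Both terms of the defining series have a simple pole at \<open>T = 0\<close>, so the identity is stated
  between Laurent series.
\<close>

definition lambda_half :: "nat \<Rightarrow> nat \<Rightarrow> ('k::{field_char_0,metric_space} set \<Rightarrow> 'k)" where
  "lambda_half p c = (THE \<mu>. bounded_measure padic_ints \<mu> \<and>
     fps_to_fls (amice_transform p \<mu>) =
       fps_to_fls (fps_binomial (1 / 2)) / fls_X
       - of_nat c * (fps_to_fls (fps_binomial (of_nat c / 2)) /
                     fps_to_fls ((1 + fps_X) ^ c - 1)))"

definition lambda_half_units :: "nat \<Rightarrow> nat \<Rightarrow> ('k::{field_char_0,metric_space} set \<Rightarrow> 'k)" where
  "lambda_half_units p c = restrict_measure padic_units (lambda_half p c)"

text \<open>
  The description by \<open>THE\<close>, ranging over all admissible \<open>c\<close>, expresses that the fraction does not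
  depend on \<open>c\<close>; the same holds for the pseudomeasure of a character below.
\<close>

definition zeta_half ::
    "nat \<Rightarrow> (('k::{field_char_0,metric_space} set \<Rightarrow> 'k) \<times> ('k set \<Rightarrow> 'k)) set" where
  "zeta_half p = (THE X. \<forall>c. admissible p c \<longrightarrow>
     X = iwasawa_frac p (lambda_half_units p c) (regulariser c))"

section \<open>Dirichlet characters and cyclotomic measures\<close>

definition dirichlet_char :: "nat \<Rightarrow> (int \<Rightarrow> 'k::field) \<Rightarrow> bool" where
  "dirichlet_char N chi \<longleftrightarrow>
     (\<forall>a b. chi (a * b) = chi a * chi b) \<and>
     (\<forall>a. chi (a + int N) = chi a) \<and>
     (\<forall>a. chi a \<noteq> 0 \<longleftrightarrow> coprime a (int N))"

definition primitive_char :: "nat \<Rightarrow> (int \<Rightarrow> 'k::field) \<Rightarrow> bool" where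
  "primitive_char N chi \<longleftrightarrow> dirichlet_char N chi \<and>
     (\<forall>d. d dvd N \<and> d < N \<longrightarrow>
        (\<exists>a. coprime a (int N) \<and> a mod int d = 1 mod int d \<and> chi a \<noteq> 1))"

definition odd_char :: "(int \<Rightarrow> 'k::field) \<Rightarrow> bool" where
  "odd_char chi \<longleftrightarrow> chi (- 1) = - 1"

definition primitive_unity_root :: "nat \<Rightarrow> 'k::field \<Rightarrow> bool" where
  "primitive_unity_root N z \<longleftrightarrow> 0 < N \<and> z ^ N = 1 \<and> (\<forall>k. 0 < k \<and> k < N \<longrightarrow> z ^ k \<noteq> 1)"

definition gauss_sum :: "nat \<Rightarrow> (int \<Rightarrow> 'k::field) \<Rightarrow> 'k \<Rightarrow> 'k" where
  "gauss_sum N chi \<zeta> = (\<Sum>a\<in>totatives N. chi (int a) * \<zeta> ^ a)"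

definition mu_root :: "nat \<Rightarrow> 'k::{field_char_0,metric_space} \<Rightarrow> ('k set \<Rightarrow> 'k)" where
  "mu_root p z = (THE \<mu>. bounded_measure padic_ints \<mu> \<and>
     (\<forall>m. \<forall>a<p ^ m. \<mu> (padic_ball p a m) = z ^ a / (1 - z ^ (p ^ m))))"

definition nu_root :: "nat \<Rightarrow> 'k::{field_char_0,metric_space} \<Rightarrow> ('k set \<Rightarrow> 'k)" where
  "nu_root p z =
     density_measure p padic_units inverse (restrict_measure padic_units (mu_root p z))"

definition nu_char ::
    "nat \<Rightarrow> nat \<Rightarrow> (int \<Rightarrow> 'k::{field_char_0,metric_space}) \<Rightarrow> 'k \<Rightarrow> ('k set \<Rightarrow> 'k)" where
  "nu_char p N chi \<zeta> = (\<lambda>U. \<Sum>a\<in>totatives N. chi (int a) * nu_root p (\<zeta> ^ a) U)"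

definition char_pseudomeasure ::
    "nat \<Rightarrow> nat \<Rightarrow> (int \<Rightarrow> 'k::{field_char_0,metric_space}) \<Rightarrow> 'k \<Rightarrow>
     (('k set \<Rightarrow> 'k) \<times> ('k set \<Rightarrow> 'k)) set" where
  "char_pseudomeasure p N chi \<zeta> = (THE X. \<forall>c. admissible p c \<longrightarrow>
     X = iwasawa_frac p
           (lambda_half_units p c \<otimes>\<^bsub>iwasawa_algebra p\<^esub> nu_char p N chi \<zeta>) (regulariser c))"

section \<open>Mellin branches\<close>

definition teichmueller :: "nat \<Rightarrow> 'k::{field_char_0,metric_space} \<Rightarrow> 'k" where
  "teichmueller p x = (THE w. w ^ (p - 1) = 1 \<and> x / w \<in> padic_ball p 1 1)"

definition unit_part :: "nat \<Rightarrow> 'k::{field_char_0,metric_space} \<Rightarrow> 'k" where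
  "unit_part p x = x / teichmueller p x"

text \<open>The power \<open>u\<^sup>s\<close> for \<open>u \<in> 1 + p\<int>\<^sub>p\<close> and \<open>s \<in> \<int>\<^sub>p\<close>, by the binomial series.\<close>

definition padic_power :: "'k::{field_char_0,metric_space} \<Rightarrow> 'k \<Rightarrow> 'k" where
  "padic_power u s = (\<Sum>k. (s gchoose k) * (u - 1) ^ k)"

text \<open>
  The branch index \<open>j\<close> is an integer representative of a class modulo \<open>p - 1\<close>.
\<close>

definition mellin ::
    "nat \<Rightarrow> ('k::{field_char_0,metric_space} set \<Rightarrow> 'k) \<Rightarrow> int \<Rightarrow> 'k \<Rightarrow> 'k" where
  "mellin p \<rho> j s = padic_integral p padic_units \<rho>
     (\<lambda>x. teichmueller p x powi j * padic_power (unit_part p x) s)"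

text \<open>
  The value at \<open>s\<close> of the quotient \<open>\<M>\<^sub>A / \<M>\<^sub>r\<close> for any representative \<open>(A, r)\<close> of the pseudomeasure
  whose denominator does not vanish at \<open>s\<close>; only meaningful if there is such a representative.
\<close>

definition mellin_loc ::
    "nat \<Rightarrow> (('k::{field_char_0,metric_space} set \<Rightarrow> 'k) \<times> ('k set \<Rightarrow> 'k)) set \<Rightarrow> int \<Rightarrow> 'k \<Rightarrow> 'k" where
  "mellin_loc p X j s =
     (THE v. \<exists>A r. (A, r) \<in> X \<and> mellin p r j s \<noteq> 0 \<and> v = mellin p A j s / mellin p r j s)"

definition zeta_half_branch :: "nat \<Rightarrow> int \<Rightarrow> 'k::{field_char_0,metric_space} \<Rightarrow> 'k" where
  "zeta_half_branch p j s = mellin_loc p (zeta_half p) j s"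

definition padic_L_inverse ::
    "nat \<Rightarrow> nat \<Rightarrow> (int \<Rightarrow> 'k::{field_char_0,metric_space}) \<Rightarrow> 'k \<Rightarrow> int \<Rightarrow> 'k \<Rightarrow> 'k" where
  "padic_L_inverse p N chi \<zeta> j s = inverse (gauss_sum N chi \<zeta>) * mellin p (nu_char p N chi \<zeta>) j s"

end

theory Submission
  imports Defs "HOL-Number_Theory.Number_Theory"
begin

text \<open>
  The pseudomeasures \<open>\<I>\<close> and \<open>\<Z>\<close> are fractions with the same denominator \<open>r\<^sub>c\<close>, so the factorization
  in the localization is the rule \<open>(\<lambda>\<^sub>c \<star> \<nu>) / r\<^sub>c = (\<lambda>\<^sub>c / r\<^sub>c) \<star> (\<nu> / 1)\<close>. A Mellin branch integrates
  a continuous character of the units, hence is multiplicative for the convolution, and turns that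
  product into a product of values; the Gauss sum cancels against its inverse because the Gauss sum
  of a primitive character does not vanish. The substance is that all these objects exist and
  that the fractions have well-defined values.

  \<^item> The \<open>p\<close>-adic integers are compact, so every clopen set is a finite disjoint union of balls of one
    radius \<open>p\<^sup>-\<^sup>n\<close> (\<open>clopen_iff\<close>, \<open>level_decomp\<close>). A finitely additive function is therefore the same as
    a compatible system of masses of balls (\<open>measure_from_balls\<close>), and the convolution of a set of
    radius \<open>p\<^sup>-\<^sup>n\<close> is a finite double sum (\<open>conv_sum\<close>). This makes the bounded measures on the units a
    commutative monoid (\<open>comm_monoid_IW\<close>).

  \<^item> Convolution with \<open>r\<^sub>c\<close> sends \<open>\<mu>(U)\<close> to \<open>\<mu>(U) - c \<mu>(c\<^sup>-\<^sup>1 U)\<close>. If \<open>c\<^sup>k \<equiv> 1\<close> modulo \<open>p\<^sup>n\<close>, then \<open>c\<^sup>-\<^sup>k\<close> fixes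
    the balls of radius \<open>p\<^sup>-\<^sup>n\<close>, so a measure killed by \<open>r\<^sub>c\<close> has mass \<open>\<mu>(U) = c\<^sup>k \<mu>(U)\<close> on them and vanishes
    (\<open>regulariser_cancel\<close>). Equality of fractions is thus equality of cross products
    (\<open>iwasawa_rel_iff\<close>), and the quotient of Mellin values depends only on the fraction
    (\<open>mellin_loc_frac\<close>).

  \<^item> The series that defines \<open>\<lambda>\<^sub>c\<close> is \<open>F(T) - c F((1 + T)\<^sup>c - 1)\<close> with \<open>F(T) = (1 + T)\<^sup>1\<^sup>/\<^sup>2 / T\<close>. Here \<open>F\<close> corresponds
    to an unbounded distribution \<open>E\<close>, the first Bernoulli distribution translated by \<open>1/2\<close>,
    and \<open>\<lambda>\<^sub>c(U) = E(U) - c E(c\<^sup>-\<^sup>1 U)\<close> is bounded (\<open>lambda_ball_measure\<close>). Its translation by \<open>c\<close> differs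
    from it by an explicit combination of Dirac measures, which is the defining series multiplied by
    \<open>(1 + T)\<^sup>c - 1\<close> (\<open>amice_lambda_ball\<close>). A measure is determined by its power series because the
    indicator function of a ball is a uniform limit of polynomials (\<open>amice_transform_inj\<close>). Since
    \<open>r\<^sub>d \<star> \<lambda>\<^sub>c\<close> takes \<open>U\<close> to \<open>E(U) - c E(c\<^sup>-\<^sup>1 U) - d E(d\<^sup>-\<^sup>1 U) + c d E((c d)\<^sup>-\<^sup>1 U)\<close>, it is symmetric in \<open>c\<close> and \<open>d\<close>,
    which is the independence of \<open>c\<close> (\<open>lambda_half_units_regulariser\<close>).

  \<^item> The value of \<open>r\<^sub>c\<close> at the branch \<open>j\<close> and \<open>s\<close> is \<open>1 - \<omega>(c)\<^sup>j\<^sup>+\<^sup>1 \<langle>c\<rangle>\<^sup>s\<^sup>+\<^sup>1\<close>. For \<open>s \<noteq> -1\<close> it is nonzero at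
    \<open>c = 1 + 2p\<close>, because raising an element of \<open>1 + p\<int>\<^sub>p\<close> to a power \<open>m\<close> multiplies its distance to \<open>1\<close>
    by \<open>|m|\<close> (\<open>lifting_the_exponent\<close>); for \<open>s = -1\<close> and \<open>j\<close> not congruent to \<open>-1\<close> it is nonzero at a
    primitive root (\<open>mellin_regulariser_nonzero\<close>).
\<close>

section \<open>Gauss sums of primitive characters\<close>

lemma dirichlet_char_one: "dirichlet_char N chi \<Longrightarrow> chi 1 = 1"
proof -
  assume d: "dirichlet_char N chi"
  then have "chi (1 * 1) = chi 1 * chi 1" "chi 1 \<noteq> 0"
    using coprime_1_left unfolding dirichlet_char_def by blast+
  then show ?thesis by simp
qed

lemma dirichlet_char_add_mult:
  assumes "dirichlet_char N chi"
  shows "chi (a + k * int N) = chi a"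
proof -
  have *: "chi (a + int m * int N) = chi a" for a m
  proof (induction m)
    case (Suc m)
    have "chi (a + int (Suc m) * int N) = chi ((a + int m * int N) + int N)"
      by (simp add: algebra_simps)
    then show ?case using Suc assms unfolding dirichlet_char_def by metis
  qed simp
  show ?thesis
  proof (cases "k \<ge> 0")
    case True
    then show ?thesis using *[of a "nat k"] by simp
  next
    case False
    then show ?thesis using *[of "a + k * int N" "nat (- k)"] by (simp add: algebra_simps)
  qed
qed

lemma dirichlet_char_mod:
  assumes "dirichlet_char N chi"
  shows "chi (a mod int N) = chi a"
  using dirichlet_char_add_mult[OF assms, of "a mod int N" "a div int N"] by simp

lemma primitive_unity_root_power_eq_1_iff:
  assumes "primitive_unity_root N z"
  shows "z ^ k = 1 \<longleftrightarrow> N dvd k"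
proof -
  have N: "0 < N" "z ^ N = 1" "\<And>k. 0 < k \<Longrightarrow> k < N \<Longrightarrow> z ^ k \<noteq> 1"
    using assms by (auto simp: primitive_unity_root_def)
  have "z ^ k = (z ^ N) ^ (k div N) * z ^ (k mod N)"
    by (simp flip: power_mult power_add)
  then have "z ^ k = z ^ (k mod N)" using N by simp
  moreover have "z ^ (k mod N) = 1 \<longleftrightarrow> k mod N = 0"
    using N(1) N(3)[of "k mod N"] by (cases "k mod N = 0") auto
  ultimately show ?thesis by (simp add: dvd_eq_mod_eq_0)
qed

lemma primitive_unity_root_power_mod:
  assumes "primitive_unity_root N z"
  shows "z ^ (k mod N) = z ^ k"
proof -
  have "z ^ N = 1" using assms by (simp add: primitive_unity_root_def)
  moreover have "z ^ k = (z ^ N) ^ (k div N) * z ^ (k mod N)"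
    by (simp flip: power_mult power_add)
  ultimately show ?thesis by simp
qed

lemma primitive_unity_root_power_cong:
  "primitive_unity_root N z \<Longrightarrow> [k = l] (mod N) \<Longrightarrow> z ^ k = z ^ l"
  by (metis cong_def primitive_unity_root_power_mod)

text \<open>Multiplication by a unit permutes the residues modulo \<open>N\<close>.\<close>

lemma sum_residues_mult:
  fixes F :: "nat \<Rightarrow> 'a::comm_monoid_add"
  assumes "coprime u N" "0 < N" "\<And>a. F (a mod N) = F a"
  shows "(\<Sum>a<N. F (u * a)) = (\<Sum>a<N. F a)"
proof -
  have inj: "inj_on (\<lambda>a. u * a mod N) {..<N}"
  proof (rule inj_onI)
    fix a b assume ab: "a \<in> {..<N}" "b \<in> {..<N}" "u * a mod N = u * b mod N"
    then have "[u * a = u * b] (mod N)" by (simp add: cong_def)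
    then have "[a = b] (mod N)" using cong_mult_lcancel_nat[OF assms(1)] by blast
    then show "a = b" using ab by (simp add: cong_def)
  qed
  have "(\<lambda>a. u * a mod N) ` {..<N} = {..<N}"
    using assms(2) inj by (intro endo_inj_surj) auto
  then have "(\<Sum>a<N. F a) = (\<Sum>a<N. F (u * a mod N))"
    using sum.reindex[OF inj, of F] by simp
  then show ?thesis by (simp add: assms(3))
qed

text \<open>
  The discrete Fourier transform of \<open>\<chi>\<close>; the Gauss sum is its value at \<open>1\<close>. Summing over all
  residues, and not only over the units, allows the orthogonality of the powers of \<open>z\<close> to be
  used.
\<close>

definition twisted_gauss_sum :: "nat \<Rightarrow> (int \<Rightarrow> 'k::field) \<Rightarrow> 'k \<Rightarrow> nat \<Rightarrow> 'k" where
  "twisted_gauss_sum N chi z b = (\<Sum>a<N. chi (int a) * z ^ (a * b))"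

lemma twisted_gauss_sum_mult:
  assumes chi: "dirichlet_char N chi" and z: "primitive_unity_root N z" and u: "coprime u N"
  shows "chi (int u) * twisted_gauss_sum N chi z (u * b) = twisted_gauss_sum N chi z b"
proof -
  have N: "0 < N" using z by (simp add: primitive_unity_root_def)
  have "chi (int u) * twisted_gauss_sum N chi z (u * b) =
    (\<Sum>a<N. chi (int (u * a)) * z ^ ((u * a) * b))"
    using chi unfolding twisted_gauss_sum_def dirichlet_char_def
    by (simp add: sum_distrib_left mult_ac)
  also have "\<dots> = twisted_gauss_sum N chi z b"
    unfolding twisted_gauss_sum_def
  proof (rule sum_residues_mult[OF u N, of "\<lambda>a. chi (int a) * z ^ (a * b)"])
    fix a
    have "z ^ ((a mod N) * b) = z ^ (a * b)"
      by (rule primitive_unity_root_power_cong[OF z]) (simp add: cong_def mod_mult_left_eq)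
    then show "chi (int (a mod N)) * z ^ ((a mod N) * b) = chi (int a) * z ^ (a * b)"
      using dirichlet_char_mod[OF chi, of "int a"] by (simp add: zmod_int)
  qed
  finally show ?thesis .
qed

lemma gauss_sum_eq_twisted:
  assumes "dirichlet_char N chi" "1 < N"
  shows "gauss_sum N chi z = twisted_gauss_sum N chi z 1"
  unfolding gauss_sum_def twisted_gauss_sum_def
proof (rule sum.mono_neutral_cong_left)
  show "\<forall>a\<in>{..<N} - totatives N. chi (int a) * z ^ (a * 1) = 0"
  proof
    fix a assume a: "a \<in> {..<N} - totatives N"
    have "\<not> coprime a N"
    proof
      assume "coprime a N"
      then have "a \<noteq> 0" using assms(2) by (metis coprime_0_left_iff nat_dvd_1_iff_1 less_irrefl)
      then show False using a \<open>coprime a N\<close> by (auto simp: totatives_def)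
    qed
    then have "chi (int a) = 0" using assms(1) unfolding dirichlet_char_def by (metis coprime_int_iff)
    then show "chi (int a) * z ^ (a * 1) = 0" by simp
  qed
  show "totatives N \<subseteq> {..<N}" using totatives_less[OF _ assms(2)] by auto
qed auto

text \<open>
  If \<open>g = gcd b N > 1\<close>, then \<open>z\<^sup>a\<^sup>b\<close> depends only on \<open>a\<close> modulo \<open>M = N / g\<close>. Primitivity gives a
  unit \<open>u \<equiv> 1\<close> modulo \<open>M\<close> with \<open>\<chi>(u) \<noteq> 1\<close>; substituting \<open>u a\<close> for \<open>a\<close> multiplies the sum by
  \<open>\<chi>(u)\<close> and does not change it.
\<close>

lemma twisted_gauss_sum_not_coprime:
  assumes chi: "primitive_char N chi" and z: "primitive_unity_root N z" and b: "\<not> coprime b N"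
  shows "twisted_gauss_sum N chi z b = 0"
proof -
  have d: "dirichlet_char N chi" using chi by (simp add: primitive_char_def)
  have N: "0 < N" using z by (simp add: primitive_unity_root_def)
  define g where "g = gcd b N"
  have g: "g dvd b" "g dvd N" "g > 0" unfolding g_def using N by simp_all
  have g1: "g \<noteq> 1" unfolding g_def using b coprime_iff_gcd_eq_1 by blast
  define M where "M = N div g"
  have NM: "N = M * g" unfolding M_def using g by simp
  have "M dvd N" using NM by simp
  moreover have "M < N" unfolding M_def using g g1 N by (intro div_less_dividend) linarith+
  ultimately obtain a where a: "coprime a (int N)" "a mod int M = 1 mod int M" "chi a \<noteq> 1"
    using chi unfolding primitive_char_def by blast
  define u where "u = nat (a mod int N)"
  have iu: "int u = a mod int N" unfolding u_def using N by simp
  have "coprime (int u) (int N)" unfolding iu using a(1) N by (simp add: coprime_mod_left_iff)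
  then have u: "coprime u N" by simp
  have cu: "chi (int u) \<noteq> 1" unfolding iu dirichlet_char_mod[OF d] by (rule a(3))
  have "int u mod int M = 1 mod int M"
    unfolding iu using a(2) \<open>M dvd N\<close> by (simp add: mod_mod_cancel)
  then have "[int u = 1] (mod int M)" by (simp add: cong_def)
  then have "int M dvd int u - 1" by (simp add: cong_iff_dvd_diff)
  then have "int M * int g dvd (int u - 1) * int b"
    using g(1) by (intro mult_dvd_mono) auto
  then have "[int (u * b) = int b] (mod int N)"
    by (simp add: cong_iff_dvd_diff NM algebra_simps)
  then have ub: "[u * b = b] (mod N)" by (simp only: cong_int_iff)
  have "z ^ (a * (u * b)) = z ^ (a * b)" for a
    using ub by (intro primitive_unity_root_power_cong[OF z] cong_mult cong_refl)
  then have "twisted_gauss_sum N chi z (u * b) = twisted_gauss_sum N chi z b"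
    by (simp add: twisted_gauss_sum_def)
  then have "(chi (int u) - 1) * twisted_gauss_sum N chi z b = 0"
    using twisted_gauss_sum_mult[OF d z u, of b] by (simp add: algebra_simps)
  then show ?thesis using cu by simp
qed

text \<open>
  If the Gauss sum vanished, then the whole Fourier transform of \<open>\<chi>\<close> would vanish: at units
  because it is there a multiple of the Gauss sum, elsewhere by the previous lemma. But the
  inverse transform recovers \<open>N \<chi>(1) = N\<close>, which is nonzero in characteristic \<open>0\<close>.
\<close>

lemma gauss_sum_nonzero:
  fixes chi :: "int \<Rightarrow> 'k::field_char_0"
  assumes chi: "primitive_char N chi" and z: "primitive_unity_root N z" and N: "1 < N"
  shows "gauss_sum N chi z \<noteq> 0"
proof
  have d: "dirichlet_char N chi" using chi by (simp add: primitive_char_def)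
  assume "gauss_sum N chi z = 0"
  then have 1: "twisted_gauss_sum N chi z 1 = 0" using gauss_sum_eq_twisted[OF d N] by simp
  have 0: "twisted_gauss_sum N chi z b = 0" for b
  proof (cases "coprime b N")
    case True
    then have "chi (int b) \<noteq> 0" using d unfolding dirichlet_char_def by (metis coprime_int_iff)
    then show ?thesis using twisted_gauss_sum_mult[OF d z True, of 1] 1 by simp
  next
    case False
    then show ?thesis by (rule twisted_gauss_sum_not_coprime[OF chi z])
  qed
  have orth: "(\<Sum>b<N. z ^ (a * b) * z ^ ((N - 1) * b)) = (if a = 1 then of_nat N else 0)"
    if "a < N" for a
  proof -
    define w where "w = z ^ (a + (N - 1))"
    have "(\<Sum>b<N. z ^ (a * b) * z ^ ((N - 1) * b)) = (\<Sum>b<N. w ^ b)"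
      by (intro sum.cong refl) (simp only: w_def distrib_right power_mult[symmetric] power_add[symmetric])
    moreover have "w = 1 \<longleftrightarrow> a = 1"
    proof -
      have "w = 1 \<longleftrightarrow> N dvd a + (N - 1)"
        unfolding w_def by (rule primitive_unity_root_power_eq_1_iff[OF z])
      also have "\<dots> \<longleftrightarrow> a = 1"
      proof
        assume "N dvd a + (N - 1)"
        then obtain k where k: "a + (N - 1) = N * k" by blast
        have "k < 2" using k that N by (metis add_less_mono diff_less less_trans mult_2 mult_2_right mult_less_cancel1 zero_less_one)
        moreover have "k \<noteq> 0" using k N by (cases "k = 0") auto
        ultimately have "k = 1" by simp
        then show "a = 1" using k N by simp
      qed (use N in auto)
      finally show ?thesis .
    qed
    moreover have "(\<Sum>b<N. w ^ b) = 0" if "w \<noteq> 1"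
    proof -
      have "w ^ N = (z ^ N) ^ (a + (N - 1))" unfolding w_def by (simp add: mult.commute flip: power_mult)
      then have "w ^ N = 1" using z by (simp add: primitive_unity_root_def)
      then show ?thesis using that by (simp add: geometric_sum)
    qed
    ultimately show ?thesis by auto
  qed
  \<comment> \<open>\<open>z\<^bsup>N - 1\<^esup>\<close> is the inverse of \<open>z\<close>, so this is the inverse Fourier transform at \<open>1\<close>\<close>
  have "0 = (\<Sum>b<N. twisted_gauss_sum N chi z b * z ^ ((N - 1) * b))" by (simp add: 0)
  also have "\<dots> = (\<Sum>a<N. chi (int a) * (\<Sum>b<N. z ^ (a * b) * z ^ ((N - 1) * b)))"
    unfolding twisted_gauss_sum_def sum_distrib_right sum_distrib_left
    by (subst sum.swap) (simp add: mult.assoc)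
  also have "\<dots> = (\<Sum>a<N. if a = 1 then chi (int a) * of_nat N else 0)"
  proof (rule sum.cong[OF refl])
    fix a assume "a \<in> {..<N}"
    then have "a < N" by simp
    then show "chi (int a) * (\<Sum>b<N. z ^ (a * b) * z ^ ((N - 1) * b)) =
        (if a = 1 then chi (int a) * of_nat N else 0)"
      unfolding orth[OF \<open>a < N\<close>] by simp
  qed
  also have "\<dots> = of_nat N" using N dirichlet_char_one[OF d] by simp
  finally show False using N by simp
qed

text \<open>
  Modulo \<open>1\<close> the arguments \<open>1\<close> and \<open>-1\<close> agree, so a character is even.
\<close>

lemma odd_char_modulus_gt_1:
  fixes chi :: "int \<Rightarrow> 'k::field_char_0"
  assumes "dirichlet_char N chi" "odd_char chi" "0 < N"
  shows "1 < N"
proof (rule ccontr)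
  assume "\<not> 1 < N"
  then have "N = 1" using assms(3) by simp
  then have "chi (- 1) = chi 1"
    using dirichlet_char_add_mult[OF assms(1), of "-1" 2] by simp
  then have "(1::'k) = - 1" using assms(2) dirichlet_char_one[OF assms(1)] by (simp add: odd_char_def)
  then show False by simp
qed

section \<open>Localization of a commutative monoid\<close>

text \<open>
  Fractions and their products involve only the multiplication, so they are treated for a ring
  structure whose multiplicative part is known to be a commutative monoid.
\<close>

locale ring_mult_monoid = comm_monoid R for R :: "('a, 'm) ring_scheme" (structure)
begin

context
  fixes S assumes S: "S \<subseteq> carrier R" "\<one> \<in> S" "\<And>x y. x \<in> S \<Longrightarrow> y \<in> S \<Longrightarrow> x \<otimes> y \<in> S"
begin

lemma loc_rel_trans:
  assumes "((a, s), (b, t)) \<in> loc_rel R S" "((b, t), (c, r)) \<in> loc_rel R S"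
  shows "((a, s), (c, r)) \<in> loc_rel R S"
proof -
  obtain u v where *: "a \<in> carrier R" "s \<in> S" "b \<in> carrier R" "t \<in> S" "c \<in> carrier R" "r \<in> S"
    "u \<in> S" "v \<in> S"
    and e: "u \<otimes> (a \<otimes> t) = u \<otimes> (b \<otimes> s)" "v \<otimes> (b \<otimes> r) = v \<otimes> (c \<otimes> t)"
    using assms unfolding loc_rel_def by blast
  have c: "s \<in> carrier R" "t \<in> carrier R" "r \<in> carrier R" "u \<in> carrier R" "v \<in> carrier R"
    using * S(1) by auto
  have "(u \<otimes> v \<otimes> t) \<otimes> (a \<otimes> r) = (v \<otimes> r) \<otimes> (u \<otimes> (a \<otimes> t))"
    using * c by (simp add: m_ac)
  also have "\<dots> = (v \<otimes> r) \<otimes> (u \<otimes> (b \<otimes> s))"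
    by (simp only: e)
  also have "\<dots> = (u \<otimes> s) \<otimes> (v \<otimes> (b \<otimes> r))"
    using * c by (simp add: m_ac)
  also have "\<dots> = (u \<otimes> s) \<otimes> (v \<otimes> (c \<otimes> t))"
    by (simp only: e)
  also have "\<dots> = (u \<otimes> v \<otimes> t) \<otimes> (c \<otimes> s)"
    using * c by (simp add: m_ac)
  finally have "(u \<otimes> v \<otimes> t) \<otimes> (a \<otimes> r) = (u \<otimes> v \<otimes> t) \<otimes> (c \<otimes> s)" .
  then show ?thesis using * S(3) unfolding loc_rel_def by blast
qed

lemma equiv_loc_rel: "equiv (carrier R \<times> S) (loc_rel R S)"
proof (rule equivI)
  show "loc_rel R S \<subseteq> (carrier R \<times> S) \<times> carrier R \<times> S"
    by (auto simp: loc_rel_def)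
  show "refl_on (carrier R \<times> S) (loc_rel R S)"
    using S(2) by (auto simp: loc_rel_def refl_on_def)
  show "sym (loc_rel R S)"
    by (auto simp: loc_rel_def sym_def) metis
  show "trans (loc_rel R S)"
    using loc_rel_trans by (auto simp: trans_def)
qed

lemma mem_loc_frac_iff: "(b, t) \<in> loc_frac R S a s \<longleftrightarrow> ((a, s), (b, t)) \<in> loc_rel R S"
  by (simp add: loc_frac_def)

lemma loc_frac_eqI:
  "((a, s), (b, t)) \<in> loc_rel R S \<Longrightarrow> loc_frac R S a s = loc_frac R S b t"
  unfolding loc_frac_def by (rule equiv_class_eq[OF equiv_loc_rel])

lemma loc_frac_self: "a \<in> carrier R \<Longrightarrow> s \<in> S \<Longrightarrow> (a, s) \<in> loc_frac R S a s"
  unfolding loc_frac_def by (rule equiv_class_self[OF equiv_loc_rel]) auto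

text \<open>
  The product of two classes is a union over all representatives; it is a single class because
  all products of representatives are related.
\<close>

lemma loc_frac_mult:
  assumes "a \<in> carrier R" "s \<in> S" "b \<in> carrier R" "t \<in> S"
  shows "loc_frac R S a s \<otimes>\<^bsub>localization R S\<^esub> loc_frac R S b t = loc_frac R S (a \<otimes> b) (s \<otimes> t)"
proof -
  have *: "loc_frac R S (a' \<otimes> b') (s' \<otimes> t') = loc_frac R S (a \<otimes> b) (s \<otimes> t)"
    if "(a', s') \<in> loc_frac R S a s" "(b', t') \<in> loc_frac R S b t" for a' s' b' t'
  proof -
    have rel: "((a, s), (a', s')) \<in> loc_rel R S" "((b, t), (b', t')) \<in> loc_rel R S"
      using that by (simp_all add: mem_loc_frac_iff)
    obtain u v where *: "a' \<in> carrier R" "s' \<in> S" "b' \<in> carrier R" "t' \<in> S" "u \<in> S" "v \<in> S"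
      and e: "u \<otimes> (a \<otimes> s') = u \<otimes> (a' \<otimes> s)" "v \<otimes> (b \<otimes> t') = v \<otimes> (b' \<otimes> t)"
      using rel unfolding loc_rel_def by blast
    have c: "s \<in> carrier R" "t \<in> carrier R" "s' \<in> carrier R" "t' \<in> carrier R" "u \<in> carrier R" "v \<in> carrier R"
      using * assms S(1) by auto
    have "(u \<otimes> v) \<otimes> ((a \<otimes> b) \<otimes> (s' \<otimes> t')) = (u \<otimes> (a \<otimes> s')) \<otimes> (v \<otimes> (b \<otimes> t'))"
      using * c assms by (simp add: m_ac)
    also have "\<dots> = (u \<otimes> (a' \<otimes> s)) \<otimes> (v \<otimes> (b' \<otimes> t))"
      by (simp only: e)
    also have "\<dots> = (u \<otimes> v) \<otimes> ((a' \<otimes> b') \<otimes> (s \<otimes> t))"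
      using * c assms by (simp add: m_ac)
    finally have eq: "(u \<otimes> v) \<otimes> ((a \<otimes> b) \<otimes> (s' \<otimes> t')) = (u \<otimes> v) \<otimes> ((a' \<otimes> b') \<otimes> (s \<otimes> t))" .
    have "u \<otimes> v \<in> S" "s \<otimes> t \<in> S" "s' \<otimes> t' \<in> S" "a \<otimes> b \<in> carrier R" "a' \<otimes> b' \<in> carrier R"
      using * assms S(3) by auto
    then have "((a \<otimes> b, s \<otimes> t), (a' \<otimes> b', s' \<otimes> t')) \<in> loc_rel R S"
      using eq unfolding loc_rel_def by blast
    then show ?thesis using loc_frac_eqI by metis
  qed
  have "loc_frac R S a s \<otimes>\<^bsub>localization R S\<^esub> loc_frac R S b t =
    (\<Union>(a', s')\<in>loc_frac R S a s. \<Union>(b', t')\<in>loc_frac R S b t. loc_frac R S (a' \<otimes> b') (s' \<otimes> t'))"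
    by (simp add: localization_def)
  also have "\<dots> = (\<Union>(a', s')\<in>loc_frac R S a s. \<Union>(b', t')\<in>loc_frac R S b t. loc_frac R S (a \<otimes> b) (s \<otimes> t))"
    by (intro SUP_cong refl) (auto simp: *)
  also have "\<dots> = loc_frac R S (a \<otimes> b) (s \<otimes> t)"
    using loc_frac_self assms by (auto simp: case_prod_beta)
  finally show ?thesis .
qed

end

lemma mult_generated_closed:
  assumes "A \<subseteq> carrier R"
  shows mult_generated_subset: "mult_generated R A \<subseteq> carrier R"
    and mult_generated_mult: "x \<in> mult_generated R A \<Longrightarrow> y \<in> mult_generated R A \<Longrightarrow> x \<otimes> y \<in> mult_generated R A"
    and mult_generated_incl: "a \<in> A \<Longrightarrow> a \<in> mult_generated R A"
proof -
  have 1: "x \<in> carrier R" if "x \<in> mult_generated R A" for x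
    using that by induction (use assms in auto)
  then show "mult_generated R A \<subseteq> carrier R" by blast
  show "x \<otimes> y \<in> mult_generated R A" if "x \<in> mult_generated R A" "y \<in> mult_generated R A"
    using that
  proof induction
    case (step a s)
    then have "a \<otimes> (s \<otimes> y) \<in> mult_generated R A" by (blast intro: mult_generated.step)
    moreover have "a \<otimes> s \<otimes> y = a \<otimes> (s \<otimes> y)"
      using step assms 1 by (intro m_assoc) auto
    ultimately show ?case by simp
  qed (use 1 in auto)
  show "a \<in> mult_generated R A" if "a \<in> A"
    using mult_generated.step[OF that mult_generated.one[of R A]] assms that by (simp add: subset_iff)
qed

lemma mult_generated_cancel:
  assumes A: "A \<subseteq> carrier R"
    and c: "\<And>a x y. a \<in> A \<Longrightarrow> x \<in> carrier R \<Longrightarrow> y \<in> carrier R \<Longrightarrow> a \<otimes> x = a \<otimes> y \<Longrightarrow> x = y"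
    and s: "s \<in> mult_generated R A"
  shows "x \<in> carrier R \<Longrightarrow> y \<in> carrier R \<Longrightarrow> s \<otimes> x = s \<otimes> y \<Longrightarrow> x = y"
  using s
proof induction
  case (step a s)
  have "s \<in> carrier R" "a \<in> carrier R" using step A mult_generated_subset[OF A] by auto
  then have "a \<otimes> (s \<otimes> x) = a \<otimes> (s \<otimes> y)" using step.prems by (simp add: m_assoc)
  then have "s \<otimes> x = s \<otimes> y" using c[OF step.hyps(1)] \<open>s \<in> carrier R\<close> step.prems by simp
  then show ?case using step.IH step.prems by simp
qed simp

end

section \<open>The absolute value and the ring of p-adic integers\<close>

text \<open>
  A constant in its own right, so that the simplifier does not apply the general rules for
  distances to it.
\<close>

definition absv :: "'a::{zero,metric_space} \<Rightarrow> real" where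
  "absv x = dist x 0"

locale odd_padic_extension =
  fixes p :: nat and K :: "'k::{field_char_0,complete_space} itself"
  assumes ext: "padic_finite_extension p K" and odd_p: "odd p"
begin

lemma prime_p: "prime p"
  using ext by (simp add: padic_finite_extension_def)

lemma p_gt_2: "p > 2"
  using prime_ge_2_nat[OF prime_p] odd_p by (cases "p = 2") auto

lemma p_pos [simp]: "p > 0" "0 < real p"
  using p_gt_2 by simp_all

lemma dist_absv: "dist x y = absv (x - y :: 'k)"
  using ext unfolding padic_finite_extension_def absv_def by blast

lemma absv_mult: "absv (x * y :: 'k) = absv x * absv y"
  using ext unfolding padic_finite_extension_def absv_def by blast

lemma absv_add: "absv (x + y :: 'k) \<le> max (absv x) (absv y)"
  using ext unfolding padic_finite_extension_def absv_def by blast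

lemma absv_p: "absv (of_nat p :: 'k) = 1 / real p"
  using ext unfolding padic_finite_extension_def absv_def by blast

lemma absv_nonneg [simp]: "absv (x::'k) \<ge> 0"
  by (simp add: absv_def)

lemma absv_0 [simp]: "absv (0::'k) = 0"
  by (simp add: absv_def)

lemma absv_eq_0_iff [simp]: "absv (x::'k) = 0 \<longleftrightarrow> x = 0"
  by (simp add: absv_def)

lemma absv_pos_iff [simp]: "absv (x::'k) > 0 \<longleftrightarrow> x \<noteq> 0"
  by (simp add: absv_def)

lemma absv_1 [simp]: "absv (1::'k) = 1"
  using absv_mult[of 1 1] by simp

lemma absv_minus [simp]: "absv (- x::'k) = absv x"
proof -
  have "absv (-1::'k) * absv (-1::'k) = 1"
    using absv_mult[of "-1" "-1"] by simp
  then have "absv (-1::'k) = 1"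
    by (metis absv_nonneg abs_of_nonneg real_sqrt_abs2 real_sqrt_one)
  then show ?thesis
    using absv_mult[of "-1" x] by simp
qed

lemma absv_minus_commute: "absv (x - y :: 'k) = absv (y - x)"
  using absv_minus[of "x - y"] by simp

lemma absv_diff: "absv (x - y :: 'k) \<le> max (absv x) (absv y)"
  using absv_add[of x "- y"] by simp

lemma absv_add_le: "absv (x::'k) \<le> C \<Longrightarrow> absv y \<le> C \<Longrightarrow> absv (x + y) \<le> C"
  using absv_add[of x y] by simp

lemma absv_diff_le: "absv (x::'k) \<le> C \<Longrightarrow> absv y \<le> C \<Longrightarrow> absv (x - y) \<le> C"
  using absv_diff[of x y] by simp

lemma absv_trans_le: "absv (x - y::'k) \<le> C \<Longrightarrow> absv (y - z) \<le> C \<Longrightarrow> absv (x - z) \<le> C"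
  using absv_add_le[of "x - y" C "y - z"] by simp

lemma absv_add_less: "absv (x::'k) < C \<Longrightarrow> absv y < C \<Longrightarrow> absv (x + y) < C"
  using absv_add[of x y] by linarith

lemma absv_trans_less: "absv (x - y::'k) < C \<Longrightarrow> absv (y - z) < C \<Longrightarrow> absv (x - z) < C"
  using absv_add_less[of "x - y" C "y - z"] by simp

text \<open>In an ultrametric space every triangle is isosceles.\<close>

lemma absv_eqI: "absv (x - y :: 'k) < absv y \<Longrightarrow> absv x = absv y"
  using absv_add[of "x - y" y] absv_diff[of x "x - y"] by auto

lemma absv_power: "absv (x ^ n :: 'k) = absv x ^ n"
  by (induction n) (simp_all add: absv_mult)

lemma absv_inverse: "absv (inverse x :: 'k) = inverse (absv x)"
proof (cases "x = 0")
  case False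
  then have "absv x * absv (inverse x) = 1"
    by (simp flip: absv_mult)
  then show ?thesis
    by (metis inverse_unique)
qed auto

lemma absv_divide: "absv (x / y :: 'k) = absv x / absv y"
  by (simp add: divide_inverse absv_mult absv_inverse)

lemma absv_sum_le: "(\<And>i. i \<in> A \<Longrightarrow> absv (f i :: 'k) \<le> C) \<Longrightarrow> 0 \<le> C \<Longrightarrow> absv (sum f A) \<le> C"
  by (induction A rule: infinite_finite_induct) (auto intro: absv_add_le)

lemma absv_of_nat_le_1 [simp]: "absv (of_nat n :: 'k) \<le> 1"
  by (induction n) (auto intro: absv_add_le)

lemma absv_of_int_le_1 [simp]: "absv (of_int n :: 'k) \<le> 1"
  by (cases n rule: int_cases2) auto

lemma absv_p_power: "absv (of_nat p ^ n :: 'k) = 1 / real p ^ n"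
  by (simp add: absv_power absv_p power_one_over)

text \<open>
  A Bezout relation \<open>u z + v p = 1\<close> would have two terms of absolute value less than \<open>1\<close> if \<open>|z|
  < 1\<close>.
\<close>

lemma absv_of_int_coprime:
  assumes "coprime z (int p)"
  shows "absv (of_int z :: 'k) = 1"
proof (rule ccontr)
  assume "absv (of_int z :: 'k) \<noteq> 1"
  then have lt: "absv (of_int z :: 'k) < 1"
    using absv_of_int_le_1[of z] by linarith
  obtain u v where uv: "u * z + v * int p = 1"
    using bezout_int[of z "int p"] assms by (auto simp: coprime_iff_gcd_eq_1)
  have "absv (of_int u * of_int z :: 'k) < 1"
    using lt absv_of_int_le_1[of u] absv_nonneg[of "of_int u"] absv_nonneg[of "of_int z"]
    by (smt (verit) absv_mult mult_left_le_one_le)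
  moreover have "absv (of_int v * of_nat p :: 'k) < 1"
  proof -
    have "absv (of_nat p :: 'k) < 1"
      using absv_p p_gt_2 by simp
    then show ?thesis
      using absv_of_int_le_1[of v] absv_nonneg[of "of_int v"] absv_nonneg[of "of_nat p"]
      by (smt (verit) absv_mult mult_left_le_one_le)
  qed
  ultimately have "absv (of_int u * of_int z + of_int v * of_nat p :: 'k) < 1"
    by (rule absv_add_less)
  moreover have "of_int u * of_int z + of_int v * of_nat p = (1::'k)"
    by (metis of_int_1 of_int_add of_int_mult of_int_of_nat_eq uv)
  ultimately show False
    by simp
qed

lemma absv_of_nat_coprime: "coprime n p \<Longrightarrow> absv (of_nat n :: 'k) = 1"
  using absv_of_int_coprime[of "int n"] by simp

lemma absv_of_int_le_iff:
  "absv (of_int z :: 'k) \<le> 1 / real p ^ n \<longleftrightarrow> int p ^ n dvd z"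
proof
  assume "int p ^ n dvd z"
  then obtain w where "z = int p ^ n * w" by blast
  then have "absv (of_int z :: 'k) = 1 / real p ^ n * absv (of_int w :: 'k)"
    by (simp add: absv_mult absv_p_power)
  then show "absv (of_int z :: 'k) \<le> 1 / real p ^ n"
    by (simp add: mult_left_le divide_right_mono)
next
  assume le: "absv (of_int z :: 'k) \<le> 1 / real p ^ n"
  show "int p ^ n dvd z"
  proof (cases "z = 0")
    case False
    have pp: "prime (int p)" using prime_p by simp
    then obtain w where w: "z = int p ^ multiplicity (int p) z * w" "\<not> int p dvd w"
      using multiplicity_decompose'[of z "int p"] False
      by (metis not_prime_unit)
    define k where "k = multiplicity (int p) z"
    have "coprime w (int p)"
      using w(2) pp by (metis prime_imp_coprime coprime_commute)
    then have "absv (of_int z :: 'k) = 1 / real p ^ k"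
      by (subst w(1)) (simp add: absv_mult absv_p_power absv_of_int_coprime k_def)
    then have "1 / real p ^ k \<le> 1 / real p ^ n"
      using le by simp
    then have "real p ^ n \<le> real p ^ k"
      by (simp add: divide_simps)
    then have "n \<le> k"
      using p_gt_2 by (intro power_le_imp_le_exp[of "real p"]) auto
    then show ?thesis
      by (metis k_def multiplicity_dvd')
  qed simp
qed

lemma inverse_p_power_tendsto: "(\<lambda>n. 1 / real p ^ n) \<longlonglongrightarrow> 0"
proof -
  have "(\<lambda>n. (1 / real p) ^ n) \<longlonglongrightarrow> 0"
    using p_gt_2 by (intro LIMSEQ_realpow_zero) auto
  then show ?thesis
    by (simp add: power_one_over)
qed

lemma small_p_power: "e > 0 \<Longrightarrow> \<exists>n. 1 / real p ^ n < e"
  using inverse_p_power_tendsto[THEN order_tendstoD(2)] by (auto simp: eventually_sequentially)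

lemma p_power_mono: "m \<le> n \<Longrightarrow> 1 / real p ^ n \<le> 1 / real p ^ m"
  using p_gt_2 by (simp add: frac_le power_increasing)

abbreviation Zp :: "'k set" where "Zp \<equiv> padic_ints"
abbreviation Up :: "'k set" where "Up \<equiv> padic_units"

text \<open>Congruence modulo \<open>p\<^sup>n\<close>, for arbitrary elements of the field.\<close>

definition pcong :: "nat \<Rightarrow> 'k \<Rightarrow> 'k \<Rightarrow> bool" where
  "pcong n x y \<longleftrightarrow> absv (x - y) \<le> 1 / real p ^ n"

lemma pcong_refl [simp]: "pcong n x x"
  by (simp add: pcong_def)

lemma pcong_sym: "pcong n x y \<Longrightarrow> pcong n y x"
  by (simp add: pcong_def absv_minus_commute)

lemma pcong_commute: "pcong n x y \<longleftrightarrow> pcong n y x"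
  using pcong_sym by blast

lemma pcong_trans: "pcong n x y \<Longrightarrow> pcong n y z \<Longrightarrow> pcong n x z"
  unfolding pcong_def by (rule absv_trans_le)

lemma pcong_mono: "m \<le> n \<Longrightarrow> pcong n x y \<Longrightarrow> pcong m x y"
  unfolding pcong_def using p_power_mono by (meson order_trans)

lemma pcong_add: "pcong n x y \<Longrightarrow> pcong n x' y' \<Longrightarrow> pcong n (x + x') (y + y')"
  unfolding pcong_def using absv_add_le[of "x - y" _ "x' - y'"] by (simp add: algebra_simps)

lemma pcong_diff: "pcong n x y \<Longrightarrow> pcong n x' y' \<Longrightarrow> pcong n (x - x') (y - y')"
  unfolding pcong_def using absv_diff_le[of "x - y" _ "x' - y'"] by (simp add: algebra_simps)

lemma pcong_scale: "absv c \<le> 1 \<Longrightarrow> pcong n x y \<Longrightarrow> pcong n (c * x) (c * y)"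
  unfolding pcong_def
  by (metis absv_mult absv_nonneg mult_left_le_one_le order_trans right_diff_distrib)

lemma pcong_mult:
  assumes "absv x' \<le> 1" "absv y \<le> 1" "pcong n x y" "pcong n x' y'"
  shows "pcong n (x * x') (y * y')"
  using pcong_scale[OF assms(1,3)] pcong_scale[OF assms(2,4)] by (metis pcong_trans mult.commute)

lemma pcong_of_int: "pcong n (of_int a) (of_int b) \<longleftrightarrow> [a = b] (mod int p ^ n)"
  unfolding pcong_def using absv_of_int_le_iff[of "a - b" n] by (simp add: cong_iff_dvd_diff)

lemma pcong_of_nat: "pcong n (of_nat a) (of_nat b) \<longleftrightarrow> [a = b] (mod p ^ n)"
  using pcong_of_int[of n "int a" "int b"] by (simp add: cong_int_iff flip: of_nat_power)

lemma pcong_of_nat_less: "a < p ^ n \<Longrightarrow> b < p ^ n \<Longrightarrow> pcong n (of_nat a) (of_nat b) \<longleftrightarrow> a = b"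
  by (auto simp: pcong_of_nat cong_less_modulus_unique_nat)

lemma Zp_iff: "x \<in> Zp \<longleftrightarrow> (\<forall>n. \<exists>z::int. pcong n x (of_int z))"
proof
  assume x: "x \<in> Zp"
  show "\<forall>n. \<exists>z::int. pcong n x (of_int z)"
  proof
    fix n
    have "1 / real p ^ n > 0" by simp
    then obtain y where "y \<in> \<int>" "dist y x < 1 / real p ^ n"
      using x unfolding padic_ints_def closure_approachable by blast
    then show "\<exists>z::int. pcong n x (of_int z)"
      unfolding pcong_def dist_absv by (metis Ints_cases absv_minus_commute less_imp_le)
  qed
next
  assume *: "\<forall>n. \<exists>z::int. pcong n x (of_int z)"
  show "x \<in> Zp"
    unfolding padic_ints_def closure_approachable
  proof (intro allI impI)
    fix e :: real assume "e > 0"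
    then obtain n where n: "1 / real p ^ n < e" using small_p_power by blast
    obtain z where "pcong n x (of_int z)" using * by blast
    then have "dist (of_int z) x < e"
      using n unfolding pcong_def dist_absv by (simp add: absv_minus_commute)
    then show "\<exists>y\<in>\<int>. dist y x < e"
      by (intro bexI[of _ "of_int z"]) auto
  qed
qed

lemma of_int_Zp [simp]: "of_int z \<in> Zp"
  unfolding Zp_iff using pcong_refl by blast

lemma of_nat_Zp [simp]: "of_nat n \<in> Zp"
  using of_int_Zp[of "int n"] by simp

lemma Zp_1 [simp]: "1 \<in> Zp" and Zp_0 [simp]: "0 \<in> Zp"
  using of_nat_Zp[of 1] of_nat_Zp[of 0] by simp_all

lemma absv_Zp: "x \<in> Zp \<Longrightarrow> absv x \<le> 1"
proof -
  assume "x \<in> Zp"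
  then obtain z where "pcong 0 x (of_int z)" unfolding Zp_iff by blast
  then show ?thesis
    unfolding pcong_def using absv_add_le[of "x - of_int z" 1 "of_int z"] by simp
qed

lemma Zp_add [simp]: "x \<in> Zp \<Longrightarrow> y \<in> Zp \<Longrightarrow> x + y \<in> Zp"
  unfolding Zp_iff by (metis pcong_add of_int_add)

lemma Zp_diff [simp]: "x \<in> Zp \<Longrightarrow> y \<in> Zp \<Longrightarrow> x - y \<in> Zp"
  unfolding Zp_iff by (metis pcong_diff of_int_diff)

lemma Zp_mult [simp]: "x \<in> Zp \<Longrightarrow> y \<in> Zp \<Longrightarrow> x * y \<in> Zp"
proof -
  assume xy: "x \<in> Zp" "y \<in> Zp"
  show ?thesis
    unfolding Zp_iff
  proof
    fix n
    obtain z w :: int where "pcong n x (of_int z)" "pcong n y (of_int w)"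
      using xy unfolding Zp_iff by meson
    then have "pcong n (x * y) (of_int (z * w))"
      unfolding of_int_mult by (intro pcong_mult) (auto simp: absv_Zp xy)
    then show "\<exists>z. pcong n (x * y) (of_int z)" by blast
  qed
qed

lemma Zp_power [simp]: "x \<in> Zp \<Longrightarrow> x ^ n \<in> Zp"
  by (induction n) auto

lemma Zp_minus [simp]: "x \<in> Zp \<Longrightarrow> - x \<in> Zp"
  using Zp_diff[of 0 x] by simp

lemma Zp_limit: "(\<And>n. \<exists>y\<in>Zp. pcong n x y) \<Longrightarrow> x \<in> Zp"
  using Zp_iff by (meson pcong_trans)

lemma residue_exists:
  assumes "x \<in> Zp"
  shows "\<exists>!a. a < p ^ n \<and> pcong n x (of_nat a)"
proof -
  obtain z :: int where z: "pcong n x (of_int z)" using assms unfolding Zp_iff by blast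
  define a where "a = nat (z mod int p ^ n)"
  have "int a = z mod int p ^ n" unfolding a_def by simp
  then have "pcong n (of_int z) (of_nat a)"
    using pcong_of_int[of n z "int a"] by (metis cong_mod_right cong_refl of_int_of_nat_eq)
  then have "pcong n x (of_nat a)" using z pcong_trans by blast
  moreover have "a < p ^ n"
    unfolding a_def using nat_less_iff[of "z mod int p ^ n" "p ^ n"] by simp
  ultimately show ?thesis
    using pcong_of_nat_less pcong_trans pcong_sym by (intro ex1I[of _ a]) blast+
qed

definition res :: "nat \<Rightarrow> 'k \<Rightarrow> nat" where
  "res n x = (THE a. a < p ^ n \<and> pcong n x (of_nat a))"

lemma res_less: "x \<in> Zp \<Longrightarrow> res n x < p ^ n"
  and pcong_res: "x \<in> Zp \<Longrightarrow> pcong n x (of_nat (res n x))"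
  using theI'[OF residue_exists] unfolding res_def by blast+

lemma res_eqI: "x \<in> Zp \<Longrightarrow> a < p ^ n \<Longrightarrow> pcong n x (of_nat a) \<Longrightarrow> res n x = a"
  using residue_exists res_less pcong_res by blast

lemma res_eq_iff: "x \<in> Zp \<Longrightarrow> y \<in> Zp \<Longrightarrow> res n x = res n y \<longleftrightarrow> pcong n x y"
  using pcong_res[of x n] pcong_res[of y n] res_eqI[of y "res n x" n] res_less[of x n] pcong_sym pcong_trans
  by (metis (no_types))

lemma res_of_nat: "a < p ^ n \<Longrightarrow> res n (of_nat a) = a"
  by (rule res_eqI) auto

lemma Zp_div_p_power:
  assumes "x \<in> Zp" "absv x \<le> 1 / real p ^ n"
  shows "x / of_nat p ^ n \<in> Zp"
  unfolding Zp_iff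
proof
  fix m
  obtain z :: int where z: "pcong (m + n) x (of_int z)" using assms(1) unfolding Zp_iff by blast
  have "absv (of_int z :: 'k) \<le> 1 / real p ^ n"
    using pcong_mono[OF _ z, of n] assms(2) absv_diff_le[of x "1 / real p ^ n" "x - of_int z"]
    by (simp add: pcong_def)
  then obtain w where w: "z = int p ^ n * w"
    unfolding absv_of_int_le_iff by blast
  have "x / of_nat p ^ n - of_int w = (x - of_int z) / of_nat p ^ n"
    by (simp add: w field_simps prime_p)
  then have "absv (x / of_nat p ^ n - of_int w) = absv (x - of_int z) * real p ^ n"
    by (simp add: absv_divide absv_p_power)
  also have "\<dots> \<le> 1 / real p ^ (m + n) * real p ^ n"
    using z unfolding pcong_def by (intro mult_right_mono) auto
  finally show "\<exists>z. pcong m (x / of_nat p ^ n) (of_int z)"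
    unfolding pcong_def by (auto simp: power_add field_simps intro!: exI[of _ w])
qed

lemma padic_ball_eq: "padic_ball p a n = {x \<in> Zp. pcong n x (of_nat a)}"
proof (intro equalityI subsetI)
  fix x :: 'k assume "x \<in> padic_ball p a n"
  then obtain y where y: "y \<in> Zp" "x = of_nat a + of_nat p ^ n * y"
    unfolding padic_ball_def by blast
  then have "absv (x - of_nat a) \<le> 1 / real p ^ n"
    using absv_Zp[of y] by (simp add: absv_mult absv_p_power divide_right_mono)
  moreover have "x \<in> Zp" using y by (simp flip: of_nat_power)
  ultimately show "x \<in> {x \<in> Zp. pcong n x (of_nat a)}" by (simp add: pcong_def)
next
  fix x :: 'k assume "x \<in> {x \<in> Zp. pcong n x (of_nat a)}"
  then have "x = of_nat a + of_nat p ^ n * ((x - of_nat a) / of_nat p ^ n)"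
    "(x - of_nat a) / of_nat p ^ n \<in> Zp"
    using p_pos by (auto intro!: Zp_div_p_power simp: pcong_def)
  then show "x \<in> padic_ball p a n" unfolding padic_ball_def by blast
qed

text \<open>
  An element of absolute value \<open>1\<close> is congruent to an integer prime to \<open>p\<close>, which can be
  inverted modulo every \<open>p\<^sup>n\<close>; so its inverse is again a limit of integers.
\<close>

lemma Up_iff: "x \<in> Up \<longleftrightarrow> x \<in> Zp \<and> absv x = 1"
proof
  assume x: "x \<in> Up"
  then have "x \<in> Zp" "x \<noteq> 0" "inverse x \<in> Zp" unfolding padic_units_def by auto
  then have "absv x \<le> 1" "inverse (absv x) \<le> 1" "absv x > 0"
    using absv_Zp[of x] absv_Zp[of "inverse x"] by (auto simp: absv_inverse)
  then show "x \<in> Zp \<and> absv x = 1"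
    using \<open>x \<in> Zp\<close> by (metis antisym inverse_le_1_iff not_less)
next
  assume x: "x \<in> Zp \<and> absv x = 1"
  then have nz: "x \<noteq> 0" by auto
  have "inverse x \<in> Zp"
    unfolding Zp_iff
  proof
    fix n
    obtain z :: int where z: "pcong (Suc n) x (of_int z)" using x unfolding Zp_iff by blast
    have "\<not> int p dvd z"
    proof
      assume "int p dvd z"
      then have "absv (of_int z :: 'k) \<le> 1 / real p"
        using absv_of_int_le_iff[of z 1] by simp
      moreover have "absv (x - of_int z) \<le> 1 / real p"
        using pcong_mono[OF _ z, of 1] by (simp add: pcong_def)
      ultimately have "absv x \<le> 1 / real p"
        using absv_add_le[of "x - of_int z" _ "of_int z"] by simp
      then show False using x p_gt_2 by (simp add: divide_simps)
    qed
    then have "coprime z (int p)"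
      using prime_p by (metis coprime_commute prime_imp_coprime prime_nat_int_transfer)
    then obtain w where w: "[z * w = 1] (mod int p ^ n)"
      using cong_solve_coprime_int[of z "int p ^ n"] by auto
    have "pcong n (x * of_int w) (of_int z * of_int w)"
      using pcong_mono[OF _ z, of n] by (intro pcong_mult) (auto)
    moreover have "pcong n (of_int z * of_int w) (1::'k)"
      using w pcong_of_int[of n "z * w" 1] by simp
    ultimately have "pcong n (x * of_int w) 1" by (rule pcong_trans)
    then have "pcong n (inverse x * (x * of_int w)) (inverse x * 1)"
      using x by (intro pcong_scale) (auto simp: absv_inverse)
    then have "pcong n (inverse x) (of_int w)"
      using nz pcong_sym by (simp flip: mult.assoc)
    then show "\<exists>z. pcong n (inverse x) (of_int z)" by blast
  qed
  then show "x \<in> Up" using x nz unfolding padic_units_def by auto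
qed

lemma Up_subset: "Up \<subseteq> Zp"
  by (auto simp: Up_iff)

lemma Up_mult [simp]: "x \<in> Up \<Longrightarrow> y \<in> Up \<Longrightarrow> x * y \<in> Up"
  by (simp add: Up_iff absv_mult)

lemma Up_nonzero: "x \<in> Up \<Longrightarrow> x \<noteq> 0"
  by (auto simp: Up_iff)

lemma Up_inverse [simp]: "x \<in> Up \<Longrightarrow> inverse x \<in> Up"
  by (auto simp: padic_units_def)

lemma Up_divide [simp]: "x \<in> Up \<Longrightarrow> y \<in> Up \<Longrightarrow> x / y \<in> Up"
  by (simp add: divide_inverse)

lemma Zp_divide: "x \<in> Zp \<Longrightarrow> u \<in> Up \<Longrightarrow> x / u \<in> Zp"
  unfolding divide_inverse using Zp_mult[of x "inverse u"] Up_inverse[of u] Up_subset by blast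

lemma Up_1 [simp]: "1 \<in> Up"
  by (simp add: Up_iff)

lemma Up_power [simp]: "x \<in> Up \<Longrightarrow> x ^ n \<in> Up"
  by (induction n) auto

lemma of_nat_Up: "coprime n p \<Longrightarrow> of_nat n \<in> Up"
  by (simp add: Up_iff absv_of_nat_coprime)

lemma pcong_unit_mult_iff: "u \<in> Up \<Longrightarrow> pcong n (u * x) (u * y) \<longleftrightarrow> pcong n x y"
  unfolding pcong_def right_diff_distrib[symmetric] absv_mult by (simp add: Up_iff)

lemma pcong_Up: "x \<in> Up \<Longrightarrow> y \<in> Zp \<Longrightarrow> n \<ge> 1 \<Longrightarrow> pcong n x y \<Longrightarrow> y \<in> Up"
proof -
  assume *: "x \<in> Up" "y \<in> Zp" "n \<ge> 1" "pcong n x y"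
  then have "absv (y - x) \<le> 1 / real p"
    using pcong_sym[OF pcong_mono[of 1 n x y]] by (simp add: pcong_def)
  also have "\<dots> < absv x" using * p_gt_2 by (simp add: Up_iff)
  finally show ?thesis using * absv_eqI[of y x] by (simp add: Up_iff)
qed

lemma half_mem_Zp: "1 / 2 \<in> Zp"
proof -
  have "of_nat 2 \<in> Up" using odd_p by (intro of_nat_Up) simp
  then have "inverse (of_nat 2) \<in> Up" by (rule Up_inverse)
  then show ?thesis by (simp add: Up_iff inverse_eq_divide)
qed

section \<open>Limits for the absolute value\<close>

text \<open>
  The type of the field is only a metric space, so the continuity of the field operations has to
  be derived from the absolute value.
\<close>

lemma tendsto_absv_iff: "(f \<longlonglongrightarrow> (l::'k)) \<longleftrightarrow> (\<forall>e>0. \<exists>N. \<forall>n\<ge>N. absv (f n - l) < e)"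
  by (simp add: LIMSEQ_def dist_absv)

lemma tendsto_add_absv:
  assumes "f \<longlonglongrightarrow> (a::'k)" "g \<longlonglongrightarrow> b"
  shows "(\<lambda>n. f n + g n) \<longlonglongrightarrow> a + b"
  unfolding tendsto_absv_iff
proof (intro allI impI)
  fix e :: real assume "e > 0"
  then obtain N M where *: "\<And>n. n \<ge> N \<Longrightarrow> absv (f n - a) < e" "\<And>n. n \<ge> M \<Longrightarrow> absv (g n - b) < e"
    using assms unfolding tendsto_absv_iff by meson
  have "absv (f n + g n - (a + b)) < e" if "n \<ge> max N M" for n
    using absv_add_less[OF *(1)[of n] *(2)[of n]] that by (simp add: algebra_simps)
  then show "\<exists>N. \<forall>n\<ge>N. absv (f n + g n - (a + b)) < e" by blast
qed

lemma tendsto_cmult_absv: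
  assumes "f \<longlonglongrightarrow> (a::'k)"
  shows "(\<lambda>n. c * f n) \<longlonglongrightarrow> c * a"
proof (cases "c = 0")
  case False
  show ?thesis
    unfolding tendsto_absv_iff
  proof (intro allI impI)
    fix e :: real assume "e > 0"
    then have "e / absv c > 0" using False by simp
    then obtain N where *: "\<And>n. n \<ge> N \<Longrightarrow> absv (f n - a) < e / absv c"
      using assms unfolding tendsto_absv_iff by meson
    have "absv (c * f n - c * a) < e" if "n \<ge> N" for n
      using *[OF that] False
      unfolding right_diff_distrib[symmetric] absv_mult by (simp add: pos_less_divide_eq mult.commute)
    then show "\<exists>N. \<forall>n\<ge>N. absv (c * f n - c * a) < e" by blast
  qed
qed simp

lemma tendsto_sum_absv:
  "(\<And>i. i \<in> A \<Longrightarrow> (\<lambda>n. f i n) \<longlonglongrightarrow> (l i::'k)) \<Longrightarrow> (\<lambda>n. \<Sum>i\<in>A. f i n) \<longlonglongrightarrow> (\<Sum>i\<in>A. l i)"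
  by (induction A rule: infinite_finite_induct) (auto intro: tendsto_add_absv)

lemma tendsto_absv_le:
  assumes "f \<longlonglongrightarrow> (a::'k)" "\<And>n. n \<ge> N \<Longrightarrow> absv (f n) \<le> C"
  shows "absv a \<le> C"
proof (rule ccontr)
  assume "\<not> absv a \<le> C"
  moreover have "C \<ge> 0" using assms(2)[of N] absv_nonneg[of "f N"] by linarith
  ultimately have "absv a > 0" by linarith
  then obtain M where M: "\<And>n. n \<ge> M \<Longrightarrow> absv (f n - a) < absv a"
    using assms(1) unfolding tendsto_absv_iff by meson
  have "absv (f (max M N)) = absv a"
    by (rule absv_eqI) (simp add: M)
  then show False using assms(2)[of "max M N"] \<open>\<not> absv a \<le> C\<close> by simp
qed

lemma tendsto_absv_transform:
  assumes "f \<longlonglongrightarrow> (a::'k)" "\<And>e. e > 0 \<Longrightarrow> \<exists>N. \<forall>n\<ge>N. absv (g n - f n) < e"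
  shows "g \<longlonglongrightarrow> a"
  unfolding tendsto_absv_iff
proof (intro allI impI)
  fix e :: real assume e: "e > 0"
  then obtain N M where *: "\<And>n. n \<ge> N \<Longrightarrow> absv (f n - a) < e" "\<And>n. n \<ge> M \<Longrightarrow> absv (g n - f n) < e"
    using assms unfolding tendsto_absv_iff by meson
  have "absv (g n - a) < e" if "n \<ge> max N M" for n
    using absv_trans_less[OF *(2)[of n] *(1)[of n]] that by simp
  then show "\<exists>N. \<forall>n\<ge>N. absv (g n - a) < e" by blast
qed

section \<open>Clopen sets and finitely additive functions\<close>

text \<open>
  The two domains of integration that occur. Both consist of whole residue classes modulo \<open>p\<close>,
  which is why levels below start at \<open>n = 1\<close>.
\<close>

definition pdom :: "'k set \<Rightarrow> bool" where
  "pdom X \<longleftrightarrow> X = Zp \<or> X = Up"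

lemma pdom_Zp [simp]: "pdom Zp" and pdom_Up [simp]: "pdom Up"
  by (simp_all add: pdom_def)

lemma pdom_Zp_mem: "pdom X \<Longrightarrow> x \<in> X \<Longrightarrow> x \<in> Zp"
  using Up_subset by (auto simp: pdom_def)

lemma pdom_pcong: "pdom X \<Longrightarrow> x \<in> X \<Longrightarrow> y \<in> Zp \<Longrightarrow> n \<ge> 1 \<Longrightarrow> pcong n x y \<Longrightarrow> y \<in> X"
  using pcong_Up by (auto simp: pdom_def)

lemma pdom_res: "pdom X \<Longrightarrow> x \<in> X \<Longrightarrow> n \<ge> 1 \<Longrightarrow> of_nat (res n x) \<in> X"
  using pdom_pcong[of X x "of_nat (res n x)" n] pcong_res pdom_Zp_mem by simp

text \<open>
  Finitely many residues modulo \<open>p\<^sup>n\<close> give total boundedness; completeness is that of the field.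
\<close>

lemma compact_Zp: "compact Zp"
  unfolding compact_eq_totally_bounded
proof (intro conjI allI impI)
  show "complete Zp"
    by (simp add: complete_eq_closed padic_ints_def)
  fix e :: real assume "e > 0"
  then obtain n where n: "1 / real p ^ n < e" using small_p_power by blast
  have "Zp \<subseteq> (\<Union>x\<in>of_nat ` {..<p ^ n}. ball x e)"
  proof
    fix x assume x: "x \<in> Zp"
    have "x \<in> ball (of_nat (res n x)) e"
      using pcong_sym[OF pcong_res[OF x, of n]] n by (simp add: dist_absv pcong_def)
    then show "x \<in> (\<Union>x\<in>of_nat ` {..<p ^ n}. ball x e)"
      using res_less[OF x] by blast
  qed
  then show "\<exists>k. finite k \<and> Zp \<subseteq> (\<Union>x\<in>k. ball x e)"
    by blast
qed

lemma compact_pdom: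
  assumes "pdom X"
  shows "compact X"
proof -
  have "closed Up"
  proof -
    have "closure Up \<subseteq> Up"
    proof
      fix x assume x: "x \<in> closure Up"
      have "x \<in> Zp"
        using x closure_mono[OF Up_subset] compact_imp_closed[OF compact_Zp] by auto
      obtain y where "y \<in> Up" "dist y x < 1 / real p"
        using x p_pos(2) unfolding closure_approachable by (meson divide_pos_pos zero_less_one)
      then have "pcong 1 y x" by (simp add: pcong_def dist_absv)
      then show "x \<in> Up" using pcong_Up \<open>y \<in> Up\<close> \<open>x \<in> Zp\<close> by blast
    qed
    then show ?thesis using closure_subset_eq by blast
  qed
  then have "compact Up"
    using compact_Int_closed[OF compact_Zp, of Up] Up_subset by (simp add: Int_absorb1)
  then show ?thesis using assms compact_Zp by (auto simp: pdom_def)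
qed

text \<open>
  \<open>U\<close> is a union of residue classes of \<open>X\<close> modulo \<open>p\<^sup>n\<close>.
\<close>

definition level :: "'k set \<Rightarrow> nat \<Rightarrow> 'k set \<Rightarrow> bool" where
  "level X n U \<longleftrightarrow> U \<subseteq> X \<and> (\<forall>x\<in>U. \<forall>y\<in>X. pcong n x y \<longrightarrow> y \<in> U)"

lemma level_mono: "level X m U \<Longrightarrow> m \<le> n \<Longrightarrow> level X n U"
  unfolding level_def using pcong_mono by blast

lemma level_diff: "level X n U \<Longrightarrow> level X n (X - U)"
  unfolding level_def using pcong_sym by blast

lemma level_openin: "level X n U \<Longrightarrow> openin (top_of_set X) U"
  unfolding openin_euclidean_subtopology_iff
proof (intro conjI ballI)
  assume l: "level X n U"
  then show "U \<subseteq> X" by (simp add: level_def)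
  fix x assume x: "x \<in> U"
  have "y \<in> U" if "y \<in> X" "dist y x < 1 / real p ^ n" for y
  proof -
    have "pcong n y x" using that by (simp add: pcong_def dist_absv)
    then have "pcong n x y" by (rule pcong_sym)
    then show ?thesis using l x that unfolding level_def by blast
  qed
  then show "\<exists>e>0. \<forall>x'\<in>X. dist x' x < e \<longrightarrow> x' \<in> U"
    by (intro exI[of _ "1 / real p ^ n"]) auto
qed

text \<open>
  If a clopen set were a union of residue classes for no \<open>n\<close>, there would be pairs of points,
  one inside and one outside, at distance at most \<open>p\<^sup>-\<^sup>n\<close>. By compactness a subsequence of these
  pairs would have a common limit, which would lie neither in the open set nor in its open
  complement.
\<close>

lemma clopen_iff:
  assumes "pdom X"
  shows "clopen_in X U \<longleftrightarrow> (\<exists>n\<ge>1. level X n U)"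
proof
  assume "\<exists>n\<ge>1. level X n U"
  then obtain n where "level X n U" by blast
  then show "clopen_in X U"
    unfolding clopen_in_def closedin_def using level_openin level_openin[OF level_diff]
    by (auto simp: level_def)
next
  assume c: "clopen_in X U"
  then have op: "openin (top_of_set X) U" "openin (top_of_set X) (X - U)" and sub: "U \<subseteq> X"
    unfolding clopen_in_def closedin_def by auto
  have "\<exists>n. level X n U"
  proof (rule ccontr)
    assume "\<not> ?thesis"
    then have "\<forall>n. \<exists>x y. x \<in> U \<and> y \<in> X - U \<and> pcong n x y"
      unfolding level_def using sub by blast
    then obtain x y where xy: "\<And>n. x n \<in> U" "\<And>n. y n \<in> X - U" "\<And>n. pcong n (x n) (y n)"
      by metis
    have "seq_compact X" using compact_pdom[OF assms] by (rule compact_imp_seq_compact)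
    then obtain l r where l: "l \<in> X" "strict_mono (r::nat\<Rightarrow>nat)" "(x \<circ> r) \<longlonglongrightarrow> l"
      using xy(1) sub unfolding seq_compact_def by (metis subsetD)
    \<comment> \<open>both members of a suitable pair come close to the limit \<open>l\<close>\<close>
    have close: "\<exists>n. dist (x n) l < e \<and> dist (y n) l < e" if e: "e > 0" for e
    proof -
      obtain N where N: "1 / real p ^ N < e" using small_p_power e by blast
      obtain M where M: "\<And>n. n \<ge> M \<Longrightarrow> absv (x (r n) - l) < e"
        using l(3) e unfolding tendsto_absv_iff by auto
      define n where "n = r (max M N)"
      have "n \<ge> N" unfolding n_def using seq_suble[OF l(2), of "max M N"] by simp
      then have "pcong N (y n) (x n)" using pcong_mono xy(3) pcong_sym by blast
      then have "absv (y n - x n) < e" using N by (simp add: pcong_def)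
      moreover have "absv (x n - l) < e" unfolding n_def by (rule M) simp
      ultimately show ?thesis
        using absv_trans_less[of "y n" "x n" e l] unfolding dist_absv by blast
    qed
    show False
    proof (cases "l \<in> U")
      case True
      then obtain e where "e > 0" "\<forall>z\<in>X. dist z l < e \<longrightarrow> z \<in> U"
        using op(1) unfolding openin_euclidean_subtopology_iff by blast
      then show False using close[of e] xy(2) by blast
    next
      case False
      then have "l \<in> X - U" using l by blast
      then obtain e where "e > 0" "\<forall>z\<in>X. dist z l < e \<longrightarrow> z \<in> X - U"
        using op(2) unfolding openin_euclidean_subtopology_iff by blast
      then show False using close[of e] xy(1) sub by blast
    qed
  qed
  then obtain n where "level X n U" by blast
  then have "level X (Suc n) U" using level_mono by (meson le_SucI order_refl)
  then show "\<exists>n\<ge>1. level X n U" by (intro exI[of _ "Suc n"]) simp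
qed

lemma level_clopen: "pdom X \<Longrightarrow> level X n U \<Longrightarrow> clopen_in X U"
  unfolding clopen_iff using level_mono[of X n U "Suc n"]
  by (intro exI[of _ "Suc n"]) auto

lemma clopen_subset: "clopen_in X U \<Longrightarrow> U \<subseteq> X"
  by (metis clopen_in_def closedin_subset topspace_euclidean_subtopology)

text \<open>
  The ball of radius \<open>p\<^sup>-\<^sup>n\<close> around any centre; the centre need not be a natural number, as it
  is in the definition of the integral.
\<close>

definition pball :: "nat \<Rightarrow> 'k \<Rightarrow> 'k set" where
  "pball n x = {y \<in> Zp. pcong n y x}"

lemma padic_ball_pball: "padic_ball p a n = pball n (of_nat a)"
  by (simp add: padic_ball_eq pball_def)

lemma pball_eq: "pcong n x y \<Longrightarrow> pball n x = pball n y"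
  unfolding pball_def using pcong_sym pcong_trans by blast

lemma pball_subset: "pdom X \<Longrightarrow> x \<in> X \<Longrightarrow> n \<ge> 1 \<Longrightarrow> pball n x \<subseteq> X"
  unfolding pball_def using pdom_pcong pcong_sym by blast

lemma level_pball: "pdom X \<Longrightarrow> x \<in> X \<Longrightarrow> n \<ge> 1 \<Longrightarrow> level X n (pball n x)"
  unfolding level_def
  using pball_subset pdom_Zp_mem by (auto simp: pball_def) (meson pcong_sym pcong_trans)

lemma pball_res: "x \<in> Zp \<Longrightarrow> pball n (of_nat (res n x)) = pball n x"
  using pcong_res pball_eq pcong_sym by blast

definition reps :: "'k set \<Rightarrow> nat \<Rightarrow> nat set" where
  "reps X n = {a. a < p ^ n \<and> of_nat a \<in> X}"

lemma finite_reps [simp]: "finite (reps X n)"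
  by (simp add: reps_def)

lemma reps_mem: "a \<in> reps X n \<Longrightarrow> of_nat a \<in> X"
  by (simp add: reps_def)

lemma res_reps: "pdom X \<Longrightarrow> x \<in> X \<Longrightarrow> n \<ge> 1 \<Longrightarrow> res n x \<in> reps X n"
  using res_less pdom_res pdom_Zp_mem by (simp add: reps_def)

definition fin_add :: "'k set \<Rightarrow> ('k set \<Rightarrow> 'k) \<Rightarrow> bool" where
  "fin_add X \<mu> \<longleftrightarrow> (\<forall>U V. clopen_in X U \<and> clopen_in X V \<and> U \<inter> V = {} \<longrightarrow> \<mu> (U \<union> V) = \<mu> U + \<mu> V)"

lemma clopen_Un: "clopen_in X U \<Longrightarrow> clopen_in X V \<Longrightarrow> clopen_in X (U \<union> V)"
  by (auto simp: clopen_in_def)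

lemma clopen_empty [simp]: "clopen_in X {}"
  by (auto simp: clopen_in_def)

lemma clopen_Union: "finite A \<Longrightarrow> (\<And>a. a \<in> A \<Longrightarrow> clopen_in X (F a)) \<Longrightarrow> clopen_in X (\<Union>a\<in>A. F a)"
  by (induction A rule: finite_induct) (auto intro: clopen_Un)

lemma fin_add_empty: "fin_add X \<mu> \<Longrightarrow> \<mu> {} = 0"
  unfolding fin_add_def using clopen_empty[of X] by (metis Int_empty_left Un_empty add_cancel_right_left)

lemma fin_add_Union:
  assumes "fin_add X \<mu>"
  shows "finite A \<Longrightarrow> (\<And>a. a \<in> A \<Longrightarrow> clopen_in X (F a)) \<Longrightarrow>
    (\<And>a b. a \<in> A \<Longrightarrow> b \<in> A \<Longrightarrow> a \<noteq> b \<Longrightarrow> F a \<inter> F b = {}) \<Longrightarrow> \<mu> (\<Union>a\<in>A. F a) = (\<Sum>a\<in>A. \<mu> (F a))"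
proof (induction A rule: finite_induct)
  case empty
  then show ?case using fin_add_empty[OF assms] by simp
next
  case (insert x A)
  have "F x \<inter> (\<Union>a\<in>A. F a) = {}" using insert.hyps insert.prems(2)[of x] by blast
  moreover have "clopen_in X (\<Union>a\<in>A. F a)" using insert.hyps insert.prems by (intro clopen_Union) auto
  ultimately have "\<mu> (F x \<union> (\<Union>a\<in>A. F a)) = \<mu> (F x) + \<mu> (\<Union>a\<in>A. F a)"
    using assms insert.prems(1)[of x] unfolding fin_add_def by blast
  then show ?case using insert by simp
qed

lemma level_decomp:
  assumes "pdom X" "n \<ge> 1" "level X n U"
  shows "U = (\<Union>a\<in>{a \<in> reps X n. of_nat a \<in> U}. pball n (of_nat a))"
proof (intro equalityI subsetI)
  fix x assume x: "x \<in> U"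
  then have X: "x \<in> X" using assms by (auto simp: level_def)
  have Z: "x \<in> Zp" using X assms pdom_Zp_mem by blast
  have "of_nat (res n x) \<in> U"
    using x assms pdom_res[OF assms(1) X assms(2)] pcong_res[OF Z] unfolding level_def by blast
  moreover have "x \<in> pball n (of_nat (res n x))" using Z pcong_res by (simp add: pball_def)
  ultimately show "x \<in> (\<Union>a\<in>{a \<in> reps X n. of_nat a \<in> U}. pball n (of_nat a))"
    using res_reps[OF assms(1) X assms(2)] by blast
next
  fix x assume "x \<in> (\<Union>a\<in>{a \<in> reps X n. of_nat a \<in> U}. pball n (of_nat a))"
  then obtain a where a: "of_nat a \<in> U" "a \<in> reps X n" "x \<in> pball n (of_nat a)" by blast
  then have "x \<in> X" using pball_subset[OF assms(1) _ assms(2)] reps_mem by blast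
  then show "x \<in> U" using a assms(3) pcong_sym unfolding level_def pball_def by blast
qed

lemma pball_disjoint: "a < p ^ n \<Longrightarrow> b < p ^ n \<Longrightarrow> a \<noteq> b \<Longrightarrow> pball n (of_nat a) \<inter> pball n (of_nat b) = {}"
  unfolding pball_def using pcong_of_nat_less pcong_sym pcong_trans by blast

lemma fin_add_level:
  assumes "pdom X" "n \<ge> 1" "level X n U" "fin_add X \<mu>"
  shows "\<mu> U = (\<Sum>a | a \<in> reps X n \<and> of_nat a \<in> U. \<mu> (pball n (of_nat a)))"
proof -
  have "\<mu> (\<Union>a\<in>{a \<in> reps X n. of_nat a \<in> U}. pball n (of_nat a)) =
    (\<Sum>a | a \<in> reps X n \<and> of_nat a \<in> U. \<mu> (pball n (of_nat a)))"
    using assms(1,2,4) pball_disjoint by (intro fin_add_Union) (auto simp: reps_def level_clopen[OF assms(1) level_pball])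
  then show ?thesis using level_decomp[OF assms(1-3)] by simp
qed

lemma bounded_measure_iff:
  "bounded_measure X \<mu> \<longleftrightarrow> (\<forall>U. \<not> clopen_in X U \<longrightarrow> \<mu> U = 0) \<and> fin_add X \<mu> \<and> (\<exists>B. \<forall>U. absv (\<mu> U) \<le> B)"
  by (simp add: bounded_measure_def fin_add_def absv_def)

lemma bm_fin_add: "bounded_measure X \<mu> \<Longrightarrow> fin_add X \<mu>"
  by (simp add: bounded_measure_iff)

lemma bm_bound: "bounded_measure X (\<mu>::'k set \<Rightarrow> 'k) \<Longrightarrow> \<exists>B>0. \<forall>U. absv (\<mu> U) \<le> B"
proof -
  assume "bounded_measure X \<mu>"
  then obtain B where B: "\<forall>U. absv (\<mu> U) \<le> B" unfolding bounded_measure_iff by blast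
  have "\<forall>U. absv (\<mu> U) \<le> max B 1" using B le_max_iff_disj by blast
  then show ?thesis by (intro exI[of _ "max B 1"]) auto
qed

text \<open>By the ultrametric inequality a bound on the masses of balls bounds all masses.\<close>

lemma bounded_measureI:
  assumes "pdom X" "fin_add X \<mu>" "\<And>U. \<not> clopen_in X U \<Longrightarrow> \<mu> U = 0"
    "\<And>n x. n \<ge> 1 \<Longrightarrow> x \<in> X \<Longrightarrow> absv (\<mu> (pball n x)) \<le> B"
  shows "bounded_measure X \<mu>"
proof -
  have "1 \<in> X" using assms(1) by (auto simp: pdom_def)
  then have B: "B \<ge> 0" using assms(4)[of 1 1] absv_nonneg[of "\<mu> (pball 1 1)"] by linarith
  have "absv (\<mu> U) \<le> B" for U
  proof (cases "clopen_in X U")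
    case True
    then obtain n where "n \<ge> 1" "level X n U" using clopen_iff assms(1) by blast
    then show ?thesis
      using fin_add_level[OF assms(1) _ _ assms(2)] B by (auto intro!: absv_sum_le assms(4) reps_mem)
  qed (simp add: assms(3) B)
  then show ?thesis using assms unfolding bounded_measure_iff by blast
qed

lemma bounded_measure_eqI:
  assumes "pdom X" "bounded_measure X \<mu>" "bounded_measure X \<nu>"
    "\<And>n x. n \<ge> 1 \<Longrightarrow> x \<in> X \<Longrightarrow> \<mu> (pball n x) = \<nu> (pball n x)"
  shows "\<mu> = \<nu>"
proof
  fix U
  show "\<mu> U = \<nu> U"
  proof (cases "clopen_in X U")
    case True
    then obtain n where n: "n \<ge> 1" "level X n U" using clopen_iff assms(1) by blast
    show ?thesis
      unfolding fin_add_level[OF assms(1) n bm_fin_add[OF assms(2)]] fin_add_level[OF assms(1) n bm_fin_add[OF assms(3)]]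
      using n by (intro sum.cong) (auto intro!: assms(4) reps_mem)
  qed (use assms in \<open>auto simp: bounded_measure_iff\<close>)
qed

section \<open>Integration\<close>

definition riemann :: "'k set \<Rightarrow> nat \<Rightarrow> ('k set \<Rightarrow> 'k) \<Rightarrow> ('k \<Rightarrow> 'k) \<Rightarrow> 'k" where
  "riemann X n \<mu> f = (\<Sum>a\<in>reps X n. f (of_nat a) * \<mu> (pball n (of_nat a)))"

lemma padic_integralI:
  assumes "pdom X" "(\<lambda>n. riemann X n \<mu> f) \<longlonglongrightarrow> L"
  shows "padic_integral p X \<mu> f = L"
proof -
  have "(\<Sum>a | a < p ^ n \<and> of_nat a \<in> X. f (of_nat a) * \<mu> (X \<inter> padic_ball p a n)) = riemann X n \<mu> f"
    if "n \<ge> 1" for n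
  proof -
    have "X \<inter> pball n (of_nat a) = pball n (of_nat a)" if "of_nat a \<in> X" for a
      using pball_subset[OF assms(1) that \<open>n \<ge> 1\<close>] by blast
    then show ?thesis
      unfolding riemann_def reps_def padic_ball_pball by (intro sum.cong) auto
  qed
  then have "(\<lambda>n. \<Sum>a | a < p ^ n \<and> of_nat a \<in> X. f (of_nat a) * \<mu> (X \<inter> padic_ball p a n)) \<longlonglongrightarrow> L"
    using assms(2) by (intro Lim_transform_eventually[OF assms(2)])
      (auto simp: eventually_sequentially intro!: exI[of _ 1])
  then show ?thesis unfolding padic_integral_def by (rule limI)
qed

text \<open>
  Uniform continuity in terms of congruences. On the compact domains it is the same as
  continuity, and it is easier to verify for the functions needed here.
\<close>

definition ucont :: "'k set \<Rightarrow> ('k \<Rightarrow> 'k) \<Rightarrow> bool" where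
  "ucont X f \<longleftrightarrow> (\<forall>e>0. \<exists>n. \<forall>x\<in>X. \<forall>y\<in>X. pcong n x y \<longrightarrow> absv (f x - f y) < e)"

text \<open>
  If the mass of each ball of radius \<open>p\<^sup>-\<^sup>m\<close> is the sum of weights \<open>\<nu> b\<close> over a fibre of \<open>h\<close>,
  then a Riemann sum of level \<open>m\<close> is a sum over the domain of \<open>h\<close>.
\<close>

lemma sum_pball_refine:
  assumes X: "pdom X" "fin_add X \<mu>" "m \<ge> 1"
    and h: "\<And>b. b \<in> reps Y n \<Longrightarrow> h b \<in> reps X m"
    and F: "\<And>a. a \<in> reps X m \<Longrightarrow> \<mu> (pball m (of_nat a)) = (\<Sum>b | b \<in> reps Y n \<and> h b = a. \<nu> b)"
  shows "riemann X m \<mu> f = (\<Sum>b\<in>reps Y n. f (of_nat (h b)) * \<nu> b)"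
proof -
  have "riemann X m \<mu> f = (\<Sum>a\<in>reps X m. \<Sum>b | b \<in> reps Y n \<and> h b = a. f (of_nat (h b)) * \<nu> b)"
    unfolding riemann_def by (intro sum.cong) (auto simp: F sum_distrib_left)
  also have "\<dots> = (\<Sum>b\<in>reps Y n. f (of_nat (h b)) * \<nu> b)"
    by (rule sum.group) (auto intro: h)
  finally show ?thesis .
qed

text \<open>This makes the Riemann sums of two levels comparable term by term.\<close>

lemma riemann_refine:
  assumes "pdom X" "fin_add X \<mu>" "m \<ge> 1" "m \<le> n"
  shows "riemann X m \<mu> f = (\<Sum>b\<in>reps X n. f (of_nat (res m (of_nat b))) * \<mu> (pball n (of_nat b)))"
proof (rule sum_pball_refine[OF assms(1-3)])
  show "res m (of_nat b) \<in> reps X m" if "b \<in> reps X n" for b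
    using that assms by (intro res_reps) (auto simp: reps_def)
  fix a assume a: "a \<in> reps X m"
  have "level X n (pball m (of_nat a))"
    using level_mono[OF level_pball] assms a by (auto simp: reps_def)
  then have "\<mu> (pball m (of_nat a)) = (\<Sum>b | b \<in> reps X n \<and> of_nat b \<in> pball m (of_nat a). \<mu> (pball n (of_nat b)))"
    using assms by (intro fin_add_level) auto
  moreover have "of_nat b \<in> pball m (of_nat a) \<longleftrightarrow> res m (of_nat b) = a" for b
    using a res_of_nat[of a m] res_eq_iff[of "of_nat b" "of_nat a" m] by (auto simp: pball_def reps_def)
  ultimately show "\<mu> (pball m (of_nat a)) =
      (\<Sum>b | b \<in> reps X n \<and> res m (of_nat b) = a. \<mu> (pball n (of_nat b)))"
    by simp
qed

lemma riemann_diff_le: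
  assumes "pdom X" "fin_add X \<mu>" "m \<ge> 1" "m \<le> n" "\<And>U. absv (\<mu> U) \<le> B" "e \<ge> 0"
    and f: "\<And>x y. x \<in> X \<Longrightarrow> y \<in> X \<Longrightarrow> pcong m x y \<Longrightarrow> absv (f x - f y) \<le> e"
  shows "absv (riemann X n \<mu> f - riemann X m \<mu> f) \<le> e * B"
proof -
  have B: "B \<ge> 0" using assms(5)[of "{}"] absv_nonneg[of "\<mu> {}"] by linarith
  have "riemann X n \<mu> f - riemann X m \<mu> f =
    (\<Sum>b\<in>reps X n. (f (of_nat b) - f (of_nat (res m (of_nat b)))) * \<mu> (pball n (of_nat b)))"
    unfolding riemann_refine[OF assms(1-4)] unfolding riemann_def
    by (simp add: sum_subtractf algebra_simps)
  also have "absv \<dots> \<le> e * B"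
  proof (rule absv_sum_le)
    fix b assume b: "b \<in> reps X n"
    then have "absv (f (of_nat b) - f (of_nat (res m (of_nat b)))) \<le> e"
      using assms pdom_res[OF assms(1) _ assms(3), of "of_nat b"] by (intro f) (auto simp: reps_def pcong_res)
    then show "absv ((f (of_nat b) - f (of_nat (res m (of_nat b)))) * \<mu> (pball n (of_nat b))) \<le> e * B"
      unfolding absv_mult using assms by (intro mult_mono) auto
  qed (use B assms in auto)
  finally show ?thesis .
qed

text \<open>
  Riemann sums of levels \<open>m \<le> n\<close> differ by at most the oscillation of \<open>f\<close> at level \<open>m\<close> times a
  bound for the measure, hence form a Cauchy sequence.
\<close>

lemma integral_tendsto:
  assumes "pdom X" "bounded_measure X \<mu>" "ucont X f"
  shows "(\<lambda>n. riemann X n \<mu> f) \<longlonglongrightarrow> padic_integral p X \<mu> f"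
proof -
  obtain B where B: "B > 0" "\<And>U. absv (\<mu> U) \<le> B" using bm_bound[OF assms(2)] by blast
  have "Cauchy (\<lambda>n. riemann X n \<mu> f)"
  proof (rule metric_CauchyI)
    fix e :: real assume e: "e > 0"
    define d where "d = e / (2 * B)"
    have "d > 0" using e B by (simp add: d_def)
    then obtain m where m: "\<And>x y. x \<in> X \<Longrightarrow> y \<in> X \<Longrightarrow> pcong m x y \<Longrightarrow> absv (f x - f y) < d"
      using assms(3) unfolding ucont_def by meson
    \<comment> \<open>a level of at least \<open>1\<close> is needed to split the domain into balls\<close>
    define k where "k = Suc m"
    have k: "absv (f x - f y) \<le> d" if "x \<in> X" "y \<in> X" "pcong k x y" for x y
      using m[OF that(1,2)] pcong_mono[OF _ that(3), of m] by (simp add: k_def)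
    have bd: "absv (riemann X n \<mu> f - riemann X k \<mu> f) \<le> d * B" if "n \<ge> k" for n
      using that \<open>d > 0\<close> k by (intro riemann_diff_le[OF assms(1) bm_fin_add[OF assms(2)] _ _ B(2)]) (auto simp: k_def)
    have "dist (riemann X n \<mu> f) (riemann X n' \<mu> f) < e" if "n \<ge> k" "n' \<ge> k" for n n'
    proof -
      have "dist (riemann X n \<mu> f) (riemann X n' \<mu> f) \<le> d * B"
        unfolding dist_absv using bd[OF that(1)] bd[OF that(2)]
        by (metis absv_minus_commute absv_trans_le)
      also have "\<dots> < e" using e B by (simp add: d_def)
      finally show ?thesis .
    qed
    then show "\<exists>M. \<forall>m\<ge>M. \<forall>n\<ge>M. dist (riemann X m \<mu> f) (riemann X n \<mu> f) < e" by blast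
  qed
  then obtain L where L: "(\<lambda>n. riemann X n \<mu> f) \<longlonglongrightarrow> L"
    using Cauchy_convergent convergent_def by blast
  then show ?thesis using padic_integralI[OF assms(1) L] by simp
qed

text \<open>
  For a function that is constant on residue classes the Riemann sums are eventually constant.
\<close>

lemma integral_locconst:
  assumes "pdom X" "fin_add X \<mu>" "m \<ge> 1"
    and f: "\<And>x y. x \<in> X \<Longrightarrow> y \<in> X \<Longrightarrow> pcong m x y \<Longrightarrow> f x = f y"
  shows "padic_integral p X \<mu> f = riemann X m \<mu> f"
proof (rule padic_integralI[OF assms(1)])
  have "riemann X n \<mu> f = riemann X m \<mu> f" if "n \<ge> m" for n
    unfolding riemann_refine[OF assms(1-3) that] unfolding riemann_def
  proof (intro sum.cong refl)
    fix b assume b: "b \<in> reps X n"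
    have "f (of_nat b) = f (of_nat (res m (of_nat b)))"
      using b assms pdom_res[OF assms(1) _ assms(3), of "of_nat b"] by (intro f) (auto simp: reps_def pcong_res)
    then show "f (of_nat b) * \<mu> (pball n (of_nat b)) =
      f (of_nat (res m (of_nat b))) * \<mu> (pball n (of_nat b))" by simp
  qed
  then show "(\<lambda>n. riemann X n \<mu> f) \<longlonglongrightarrow> riemann X m \<mu> f"
    by (intro tendsto_eventually eventually_sequentiallyI[of m]) blast
qed

lemma ucont_locconst:
  assumes "\<And>x y. x \<in> X \<Longrightarrow> y \<in> X \<Longrightarrow> pcong m x y \<Longrightarrow> f x = f y"
  shows "ucont X f"
  unfolding ucont_def using assms by (metis absv_0 diff_self)

lemma integral_bound:
  assumes "pdom X" "bounded_measure X \<mu>" "ucont X f" "\<And>U. absv (\<mu> U) \<le> B" "\<And>x. x \<in> X \<Longrightarrow> absv (f x) \<le> C"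
  shows "absv (padic_integral p X \<mu> f) \<le> C * B"
proof (rule tendsto_absv_le[OF integral_tendsto[OF assms(1-3)]])
  have B: "B \<ge> 0" using assms(4)[of "{}"] absv_nonneg[of "\<mu> {}"] by linarith
  have "1 \<in> X" using assms(1) by (auto simp: pdom_def)
  then have C: "C \<ge> 0" using assms(5)[of 1] absv_nonneg[of "f 1"] by linarith
  show "absv (riemann X n \<mu> f) \<le> C * B" for n
    unfolding riemann_def using B C
    by (intro absv_sum_le) (auto simp: absv_mult intro!: mult_mono assms reps_mem)
qed

lemma integral_cong:
  "(\<And>x. x \<in> X \<Longrightarrow> f x = g x) \<Longrightarrow> padic_integral p X \<mu> f = padic_integral p X \<mu> g"
  unfolding padic_integral_def by (intro arg_cong[of _ _ lim] ext sum.cong) auto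

lemma ucontE:
  assumes "ucont X f" "e > 0"
  obtains n where "n \<ge> 1" "\<And>x y. x \<in> X \<Longrightarrow> y \<in> X \<Longrightarrow> pcong n x y \<Longrightarrow> absv (f x - f y) < e"
proof -
  obtain m where m: "\<And>x y. x \<in> X \<Longrightarrow> y \<in> X \<Longrightarrow> pcong m x y \<Longrightarrow> absv (f x - f y) < e"
    using assms unfolding ucont_def by meson
  show ?thesis
  proof (rule that[of "Suc m"])
    show "absv (f x - f y) < e" if "x \<in> X" "y \<in> X" "pcong (Suc m) x y" for x y
      using m[OF that(1,2)] pcong_mono[OF _ that(3), of m] by simp
  qed simp
qed

lemma ucont_const [simp]: "ucont X (\<lambda>_. c)"
  by (simp add: ucont_def)

lemma ucont_add: "ucont X f \<Longrightarrow> ucont X g \<Longrightarrow> ucont X (\<lambda>x. f x + g x)"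
proof -
  assume fg: "ucont X f" "ucont X g"
  show ?thesis
    unfolding ucont_def
  proof (intro allI impI)
    fix e :: real assume e: "e > 0"
    obtain n where n: "\<And>x y. x \<in> X \<Longrightarrow> y \<in> X \<Longrightarrow> pcong n x y \<Longrightarrow> absv (f x - f y) < e"
      by (rule ucontE[OF fg(1) e]) blast
    obtain m where m: "\<And>x y. x \<in> X \<Longrightarrow> y \<in> X \<Longrightarrow> pcong m x y \<Longrightarrow> absv (g x - g y) < e"
      by (rule ucontE[OF fg(2) e]) blast
    have "absv (f x + g x - (f y + g y)) < e" if "x \<in> X" "y \<in> X" "pcong (max n m) x y" for x y
      using absv_add_less[OF n[OF that(1,2)] m[OF that(1,2)]] pcong_mono[OF _ that(3)]
      by (simp add: algebra_simps)
    then show "\<exists>n. \<forall>x\<in>X. \<forall>y\<in>X. pcong n x y \<longrightarrow> absv (f x + g x - (f y + g y)) < e" by blast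
  qed
qed

lemma ucont_bounded:
  assumes "pdom X" "ucont X f"
  shows "\<exists>C>0. \<forall>x\<in>X. absv (f x) \<le> C"
proof -
  obtain n where n: "n \<ge> 1" "\<And>x y. x \<in> X \<Longrightarrow> y \<in> X \<Longrightarrow> pcong n x y \<Longrightarrow> absv (f x - f y) < 1"
    by (rule ucontE[OF assms(2), of 1]) auto
  define C where "C = 1 + (\<Sum>a\<in>reps X n. absv (f (of_nat a)))"
  have "absv (f x) \<le> C" if "x \<in> X" for x
  proof -
    have "absv (f (of_nat (res n x))) \<le> (\<Sum>a\<in>reps X n. absv (f (of_nat a)))"
      using res_reps[OF assms(1) that n(1)]
        member_le_sum[of "res n x" "reps X n" "\<lambda>a. absv (f (of_nat a))"] by simp
    moreover have "absv (f x - f (of_nat (res n x))) < 1"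
      using that pdom_res[OF assms(1) that n(1)] pcong_res pdom_Zp_mem[OF assms(1) that] by (intro n) auto
    moreover have "(\<Sum>a\<in>reps X n. absv (f (of_nat a))) \<ge> 0" by (simp add: sum_nonneg)
    ultimately show ?thesis
      using absv_add[of "f x - f (of_nat (res n x))" "f (of_nat (res n x))"] by (simp add: C_def)
  qed
  moreover have "C > 0" unfolding C_def by (simp add: sum_nonneg add_pos_nonneg)
  ultimately show ?thesis by blast
qed

lemma ucont_mult:
  assumes "pdom X" "ucont X f" "ucont X g"
  shows "ucont X (\<lambda>x. f x * g x)"
  unfolding ucont_def
proof (intro allI impI)
  fix e :: real assume e: "e > 0"
  obtain C where C: "C > 0" "\<And>x. x \<in> X \<Longrightarrow> absv (f x) \<le> C" using ucont_bounded[OF assms(1,2)] by blast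
  obtain D where D: "D > 0" "\<And>x. x \<in> X \<Longrightarrow> absv (g x) \<le> D" using ucont_bounded[OF assms(1,3)] by blast
  have eC: "e / C > 0" "e / D > 0" using e C D by auto
  obtain n where n: "\<And>x y. x \<in> X \<Longrightarrow> y \<in> X \<Longrightarrow> pcong n x y \<Longrightarrow> absv (f x - f y) < e / D"
    by (rule ucontE[OF assms(2) eC(2)]) blast
  obtain m where m: "\<And>x y. x \<in> X \<Longrightarrow> y \<in> X \<Longrightarrow> pcong m x y \<Longrightarrow> absv (g x - g y) < e / C"
    by (rule ucontE[OF assms(3) eC(1)]) blast
  have "absv (f x * g x - f y * g y) < e" if "x \<in> X" "y \<in> X" "pcong (max n m) x y" for x y
  proof -
    have "absv ((f x - f y) * g x) < e"
    proof -
      have "absv (f x - f y) * absv (g x) \<le> absv (f x - f y) * D"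
        using D that by (intro mult_left_mono) auto
      also have "\<dots> < e / D * D"
        using D n[OF that(1,2)] pcong_mono[OF _ that(3)] by (intro mult_strict_right_mono) auto
      finally show ?thesis using D by (simp add: absv_mult)
    qed
    moreover have "absv (f y * (g x - g y)) < e"
    proof -
      have "absv (f y) * absv (g x - g y) \<le> C * absv (g x - g y)"
        using C that by (intro mult_right_mono) auto
      also have "\<dots> < C * (e / C)"
        using C m[OF that(1,2)] pcong_mono[OF _ that(3)] by (intro mult_strict_left_mono) auto
      finally show ?thesis using C by (simp add: absv_mult)
    qed
    ultimately have "absv ((f x - f y) * g x + f y * (g x - g y)) < e" by (rule absv_add_less)
    then show ?thesis by (simp add: algebra_simps)
  qed
  then show "\<exists>n. \<forall>x\<in>X. \<forall>y\<in>X. pcong n x y \<longrightarrow> absv (f x * g x - f y * g y) < e" by blast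
qed

lemma ucont_prod:
  "pdom X \<Longrightarrow> (\<And>i. i \<in> A \<Longrightarrow> ucont X (f i)) \<Longrightarrow> ucont X (\<lambda>x. \<Prod>i\<in>A. f i x)"
  by (induction A rule: infinite_finite_induct) (auto intro: ucont_mult)

lemma ucont_lipschitz:
  assumes "m \<ge> 1" "\<And>x y. x \<in> X \<Longrightarrow> y \<in> X \<Longrightarrow> pcong m x y \<Longrightarrow> absv (f x - f y) \<le> absv (x - y)"
  shows "ucont X f"
  unfolding ucont_def
proof (intro allI impI)
  fix e :: real assume "e > 0"
  then obtain n where n: "1 / real p ^ n < e" using small_p_power by blast
  have "absv (f x - f y) < e" if "x \<in> X" "y \<in> X" "pcong (max m n) x y" for x y
  proof -
    have "pcong m x y" "pcong n x y" using pcong_mono[OF _ that(3)] by auto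
    then show ?thesis using assms(2)[OF that(1,2)] n by (simp add: pcong_def)
  qed
  then show "\<exists>n. \<forall>x\<in>X. \<forall>y\<in>X. pcong n x y \<longrightarrow> absv (f x - f y) < e" by blast
qed

lemma ucont_id: "ucont X (\<lambda>x. x)"
  by (rule ucont_lipschitz[of 1]) auto

lemma integral_add:
  assumes "pdom X" "bounded_measure X \<mu>" "ucont X f" "ucont X g"
  shows "padic_integral p X \<mu> (\<lambda>x. f x + g x) = padic_integral p X \<mu> f + padic_integral p X \<mu> g"
  using tendsto_add_absv[OF integral_tendsto[OF assms(1-3)] integral_tendsto[OF assms(1,2,4)]]
  by (intro padic_integralI[OF assms(1)]) (simp add: riemann_def sum.distrib algebra_simps)

lemma integral_cmult:
  assumes "pdom X" "bounded_measure X \<mu>" "ucont X f"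
  shows "padic_integral p X \<mu> (\<lambda>x. c * f x) = c * padic_integral p X \<mu> f"
  using tendsto_cmult_absv[OF integral_tendsto[OF assms], of c]
  by (intro padic_integralI[OF assms(1)]) (simp add: riemann_def sum_distrib_left algebra_simps)

lemma integral_diff:
  assumes "pdom X" "bounded_measure X \<mu>" "ucont X f" "ucont X g"
  shows "padic_integral p X \<mu> (\<lambda>x. f x - g x) = padic_integral p X \<mu> f - padic_integral p X \<mu> g"
  using integral_add[OF assms(1-3) ucont_mult[OF assms(1) ucont_const[of _ "-1"] assms(4)]]
    integral_cmult[OF assms(1,2,4), of "-1"] by simp

lemma integral_sum:
  assumes "pdom X" "bounded_measure X \<mu>" "finite A" "\<And>i. i \<in> A \<Longrightarrow> ucont X (f i)"
  shows "padic_integral p X \<mu> (\<lambda>x. \<Sum>i\<in>A. f i x) = (\<Sum>i\<in>A. padic_integral p X \<mu> (f i))"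
  using tendsto_sum_absv[of A "\<lambda>i n. riemann X n \<mu> (f i)", OF integral_tendsto[OF assms(1,2,4)]]
  by (intro padic_integralI[OF assms(1)])
    (simp add: riemann_def sum_distrib_right sum.swap[of _ A])

lemma integral_measure_lincomb:
  assumes "pdom X" "\<And>i. i \<in> A \<Longrightarrow> bounded_measure X (\<mu> i)" "ucont X f"
  shows "padic_integral p X (\<lambda>U. \<Sum>i\<in>A. c i * \<mu> i U) f = (\<Sum>i\<in>A. c i * padic_integral p X (\<mu> i) f)"
  using tendsto_sum_absv[of A "\<lambda>i n. c i * riemann X n (\<mu> i) f",
      OF tendsto_cmult_absv[OF integral_tendsto[OF assms(1,2,3)]]]
  by (intro padic_integralI[OF assms(1)])
    (simp add: riemann_def sum_distrib_left sum.swap[of _ A] mult.left_commute)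

lemma bounded_measure_lincomb:
  assumes "pdom X" "\<And>i. i \<in> A \<Longrightarrow> bounded_measure X (\<mu> i)" "finite A"
  shows "bounded_measure X (\<lambda>U. \<Sum>i\<in>A. c i * \<mu> i U)"
proof -
  have "\<exists>B. \<forall>i\<in>A. \<forall>U. absv (c i * \<mu> i U) \<le> B"
    using assms(3,2)
  proof (induction A rule: finite_induct)
    case (insert j A)
    then obtain B where B: "\<And>i U. i \<in> A \<Longrightarrow> absv (c i * \<mu> i U) \<le> B" by auto
    obtain C where C: "\<And>U. absv (\<mu> j U) \<le> C" using insert.prems[of j] bm_bound by blast
    have "absv (c i * \<mu> i U) \<le> max B (absv (c j) * C)" if "i \<in> insert j A" for i U
    proof (cases "i = j")
      case True
      then show ?thesis using mult_left_mono[OF C[of U], of "absv (c j)"] by (auto simp: absv_mult)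
    next
      case False
      then show ?thesis using B[of i U] that by auto
    qed
    then show ?case by blast
  qed auto
  then obtain B where B: "\<And>i U. i \<in> A \<Longrightarrow> absv (c i * \<mu> i U) \<le> B" by blast
  have "absv (\<Sum>i\<in>A. c i * \<mu> i U) \<le> max 0 B" for U
    using B by (intro absv_sum_le) (auto simp: le_max_iff_disj)
  moreover have "fin_add X (\<lambda>U. \<Sum>i\<in>A. c i * \<mu> i U)"
    using assms(2) unfolding bounded_measure_iff fin_add_def
    by (auto simp: sum.distrib[symmetric] distrib_left[symmetric] intro!: sum.cong)
  ultimately show ?thesis
    using assms(2) unfolding bounded_measure_iff by (auto intro!: sum.neutral)
qed

lemma bounded_measure_diff:
  assumes "pdom X" "bounded_measure X \<mu>" "bounded_measure X \<nu>"
  shows "bounded_measure X (\<lambda>U. \<mu> U - c * \<nu> U)"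
  using bounded_measure_lincomb[of X "{True, False}" "\<lambda>b. if b then \<mu> else \<nu>" "\<lambda>b. if b then 1 else - c"] assms
  by simp

lemma integral_measure_diff:
  assumes "pdom X" "bounded_measure X \<mu>" "bounded_measure X \<nu>" "ucont X f"
  shows "padic_integral p X (\<lambda>U. \<mu> U - c * \<nu> U) f = padic_integral p X \<mu> f - c * padic_integral p X \<nu> f"
  using integral_measure_lincomb[of X "{True, False}" "\<lambda>b. if b then \<mu> else \<nu>" f "\<lambda>b. if b then 1 else - c"] assms
  by simp

lemma dirac_bounded_measure:
  assumes "pdom X" "x \<in> X"
  shows "bounded_measure X (dirac_measure X x)"
  using assms(2) unfolding bounded_measure_iff fin_add_def dirac_measure_def
  by (auto simp: clopen_Un intro!: exI[of _ 1])

lemma dirac_pball: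
  assumes "pdom X" "x \<in> X" "y \<in> X" "n \<ge> 1"
  shows "dirac_measure X x (pball n y) = (if pcong n x y then 1 else 0)"
  using level_clopen[OF assms(1) level_pball[OF assms(1,3,4)]] pdom_Zp_mem[OF assms(1,2)]
  by (simp add: dirac_measure_def pball_def)

lemma integral_dirac:
  assumes "pdom X" "x \<in> X" "ucont X f"
  shows "padic_integral p X (dirac_measure X x) f = f x"
proof (rule padic_integralI[OF assms(1)])
  have Z: "x \<in> Zp" using assms pdom_Zp_mem by blast
  have *: "riemann X n (dirac_measure X x) f = f (of_nat (res n x))" if n: "n \<ge> 1" for n
  proof -
    have "riemann X n (dirac_measure X x) f = (\<Sum>a\<in>reps X n. if a = res n x then f (of_nat a) else 0)"
      unfolding riemann_def
    proof (intro sum.cong refl)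
      fix a assume a: "a \<in> reps X n"
      then have "pcong n x (of_nat a) \<longleftrightarrow> a = res n x"
        using res_eqI[OF Z] pcong_res[OF Z] by (auto simp: reps_def)
      then show "f (of_nat a) * dirac_measure X x (pball n (of_nat a)) = (if a = res n x then f (of_nat a) else 0)"
        using dirac_pball[OF assms(1,2) reps_mem[OF a] n] by auto
    qed
    also have "\<dots> = f (of_nat (res n x))"
      using res_reps[OF assms(1,2) n] by (simp add: sum.delta)
    finally show ?thesis .
  qed
  show "(\<lambda>n. riemann X n (dirac_measure X x) f) \<longlonglongrightarrow> f x"
    unfolding tendsto_absv_iff
  proof (intro allI impI)
    fix e :: real assume e: "e > 0"
    obtain m where m: "m \<ge> 1" "\<And>x y. x \<in> X \<Longrightarrow> y \<in> X \<Longrightarrow> pcong m x y \<Longrightarrow> absv (f x - f y) < e"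
      by (rule ucontE[OF assms(3) e]) blast
    have "absv (riemann X n (dirac_measure X x) f - f x) < e" if "n \<ge> m" for n
    proof -
      have "n \<ge> 1" using that m by simp
      moreover have "pcong m (of_nat (res n x)) x" using pcong_mono[OF that pcong_res[OF Z]] pcong_sym by blast
      ultimately show ?thesis using * m(2)[OF pdom_res[OF assms(1,2), of n] assms(2)] by simp
    qed
    then show "\<exists>N. \<forall>n\<ge>N. absv (riemann X n (dirac_measure X x) f - f x) < e" by blast
  qed
qed

section \<open>Push-forward of measures\<close>

text \<open>Extensional like all measures: zero outside the clopen subsets of the target.\<close>

definition pushforward :: "'k set \<Rightarrow> 'k set \<Rightarrow> ('k \<Rightarrow> 'k) \<Rightarrow> ('k set \<Rightarrow> 'k) \<Rightarrow> ('k set \<Rightarrow> 'k)" where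
  "pushforward X Y \<phi> \<mu> = (\<lambda>U. if clopen_in Y U then \<mu> {x \<in> X. \<phi> x \<in> U} else 0)"

context
  fixes X Y :: "'k set" and \<phi> :: "'k \<Rightarrow> 'k"
  assumes XY: "pdom X" "pdom Y" and \<phi>: "\<And>x. x \<in> X \<Longrightarrow> \<phi> x \<in> Y"
    and \<phi>_pcong: "\<And>n x y. x \<in> X \<Longrightarrow> y \<in> X \<Longrightarrow> pcong n x y \<Longrightarrow> pcong n (\<phi> x) (\<phi> y)"
begin

lemma level_vimage: "level Y n U \<Longrightarrow> level X n {x \<in> X. \<phi> x \<in> U}"
  unfolding level_def using \<phi> \<phi>_pcong by blast

lemma clopen_vimage: "clopen_in Y U \<Longrightarrow> clopen_in X {x \<in> X. \<phi> x \<in> U}"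
  using level_vimage XY clopen_iff by blast

lemma fin_add_pushforward:
  assumes "fin_add X \<mu>"
  shows "fin_add Y (pushforward X Y \<phi> \<mu>)"
  unfolding fin_add_def
proof (intro allI impI)
  fix U V assume UV: "clopen_in Y U \<and> clopen_in Y V \<and> U \<inter> V = {}"
  then have "\<mu> ({x \<in> X. \<phi> x \<in> U} \<union> {x \<in> X. \<phi> x \<in> V}) = \<mu> {x \<in> X. \<phi> x \<in> U} + \<mu> {x \<in> X. \<phi> x \<in> V}"
    using assms clopen_vimage unfolding fin_add_def by blast
  moreover have "{x \<in> X. \<phi> x \<in> U \<union> V} = {x \<in> X. \<phi> x \<in> U} \<union> {x \<in> X. \<phi> x \<in> V}" by blast
  ultimately show "pushforward X Y \<phi> \<mu> (U \<union> V) = pushforward X Y \<phi> \<mu> U + pushforward X Y \<phi> \<mu> V"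
    using UV clopen_Un[of Y U V] unfolding pushforward_def by simp
qed

lemma bounded_measure_pushforward:
  assumes "bounded_measure X \<mu>"
  shows "bounded_measure Y (pushforward X Y \<phi> \<mu>)"
proof -
  obtain B where B: "B > 0" "\<And>U. absv (\<mu> U) \<le> B" using bm_bound[OF assms] by blast
  have "absv (pushforward X Y \<phi> \<mu> U) \<le> B" for U
    using B by (simp add: pushforward_def)
  then show ?thesis
    using fin_add_pushforward[OF bm_fin_add[OF assms]] unfolding bounded_measure_iff
    by (intro conjI exI[of _ B]) (simp_all add: pushforward_def)
qed

lemma ucont_comp: "ucont Y f \<Longrightarrow> ucont X (\<lambda>x. f (\<phi> x))"
  unfolding ucont_def using \<phi> \<phi>_pcong by meson

text \<open>
  Regrouping a Riemann sum over the fibres of \<open>\<phi>\<close> replaces \<open>f (\<phi> b)\<close> by the value of \<open>f\<close> at the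
  residue of \<open>\<phi> b\<close>; the error tends to \<open>0\<close> by uniform continuity.
\<close>

lemma integral_pushforward:
  assumes "bounded_measure X \<mu>" "ucont Y f"
  shows "padic_integral p Y (pushforward X Y \<phi> \<mu>) f = padic_integral p X \<mu> (\<lambda>x. f (\<phi> x))"
proof (rule padic_integralI[OF XY(2)])
  obtain B where B: "B > 0" "\<And>U. absv (\<mu> U) \<le> B" using bm_bound[OF assms(1)] by blast
  have *: "riemann Y n (pushforward X Y \<phi> \<mu>) f =
      (\<Sum>b\<in>reps X n. f (of_nat (res n (\<phi> (of_nat b)))) * \<mu> (pball n (of_nat b)))" if n: "n \<ge> 1" for n
  proof (rule sum_pball_refine[OF XY(2) fin_add_pushforward[OF bm_fin_add[OF assms(1)]] n])
    show "res n (\<phi> (of_nat b)) \<in> reps Y n" if "b \<in> reps X n" for b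
      using res_reps[OF XY(2) _ n] \<phi> reps_mem[OF that] by blast
    fix a assume a: "a \<in> reps Y n"
    have l: "level Y n (pball n (of_nat a))" using level_pball[OF XY(2) reps_mem[OF a] n] .
    have "pushforward X Y \<phi> \<mu> (pball n (of_nat a)) = \<mu> {x \<in> X. \<phi> x \<in> pball n (of_nat a)}"
      using level_clopen[OF XY(2) l] by (simp add: pushforward_def)
    also have "\<dots> = (\<Sum>b | b \<in> reps X n \<and> of_nat b \<in> {x \<in> X. \<phi> x \<in> pball n (of_nat a)}. \<mu> (pball n (of_nat b)))"
      by (rule fin_add_level[OF XY(1) n level_vimage[OF l] bm_fin_add[OF assms(1)]])
    also have "\<dots> = (\<Sum>b | b \<in> reps X n \<and> res n (\<phi> (of_nat b)) = a. \<mu> (pball n (of_nat b)))"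
    proof (intro sum.cong refl Collect_cong conj_cong)
      fix b assume b: "b \<in> reps X n"
      then have Z: "\<phi> (of_nat b) \<in> Zp" using \<phi> pdom_Zp_mem[OF XY(2)] reps_mem by blast
      show "of_nat b \<in> {x \<in> X. \<phi> x \<in> pball n (of_nat a)} \<longleftrightarrow> res n (\<phi> (of_nat b)) = a"
        using b a Z res_of_nat[of a n] res_eq_iff[OF Z, of "of_nat a" n] reps_mem[OF b]
        by (auto simp: pball_def reps_def)
    qed
    finally show "pushforward X Y \<phi> \<mu> (pball n (of_nat a)) =
      (\<Sum>b | b \<in> reps X n \<and> res n (\<phi> (of_nat b)) = a. \<mu> (pball n (of_nat b)))" .
  qed
  show "(\<lambda>n. riemann Y n (pushforward X Y \<phi> \<mu>) f) \<longlonglongrightarrow> padic_integral p X \<mu> (\<lambda>x. f (\<phi> x))"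
  proof (rule tendsto_absv_transform[OF integral_tendsto[OF XY(1) assms(1) ucont_comp[OF assms(2)]]])
    fix e :: real assume "e > 0"
    then have "e / (2 * B) > 0" using B by simp
    then obtain m where m: "m \<ge> 1" "\<And>x y. x \<in> Y \<Longrightarrow> y \<in> Y \<Longrightarrow> pcong m x y \<Longrightarrow> absv (f x - f y) < e / (2 * B)"
      by (rule ucontE[OF assms(2)]) blast
    have "absv (riemann Y n (pushforward X Y \<phi> \<mu>) f - riemann X n \<mu> (\<lambda>x. f (\<phi> x))) < e" if "n \<ge> m" for n
    proof -
      have n: "n \<ge> 1" using that m by simp
      have "riemann Y n (pushforward X Y \<phi> \<mu>) f - riemann X n \<mu> (\<lambda>x. f (\<phi> x)) =
        (\<Sum>b\<in>reps X n. (f (of_nat (res n (\<phi> (of_nat b)))) - f (\<phi> (of_nat b))) * \<mu> (pball n (of_nat b)))"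
        unfolding *[OF n] by (simp add: riemann_def sum_subtractf algebra_simps)
      also have "absv \<dots> \<le> e / (2 * B) * B"
      proof (rule absv_sum_le)
        fix b assume b: "b \<in> reps X n"
        have Y: "\<phi> (of_nat b) \<in> Y" using \<phi> reps_mem[OF b] by blast
        have "pcong m (of_nat (res n (\<phi> (of_nat b)))) (\<phi> (of_nat b))"
          using pcong_mono[OF that pcong_res] pdom_Zp_mem[OF XY(2) Y] pcong_sym by blast
        then have "absv (f (of_nat (res n (\<phi> (of_nat b)))) - f (\<phi> (of_nat b))) \<le> e / (2 * B)"
          using m(2)[OF pdom_res[OF XY(2) Y n] Y] by simp
        then show "absv ((f (of_nat (res n (\<phi> (of_nat b)))) - f (\<phi> (of_nat b))) * \<mu> (pball n (of_nat b)))
            \<le> e / (2 * B) * B"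
          unfolding absv_mult using B \<open>e > 0\<close> by (intro mult_mono) auto
      qed (use \<open>e > 0\<close> B in auto)
      also have "\<dots> < e" using \<open>e > 0\<close> B by (simp add: field_simps)
      finally show ?thesis .
    qed
    then show "\<exists>N. \<forall>n\<ge>N. absv (riemann Y n (pushforward X Y \<phi> \<mu>) f - riemann X n \<mu> (\<lambda>x. f (\<phi> x))) < e"
      by blast
  qed
qed

end

section \<open>Multiplicative convolution\<close>

abbreviation conv :: "('k set \<Rightarrow> 'k) \<Rightarrow> ('k set \<Rightarrow> 'k) \<Rightarrow> ('k set \<Rightarrow> 'k)"  (infixl "\<star>" 70)
  where "\<mu> \<star> \<nu> \<equiv> mult_convolution p \<mu> \<nu>"

text \<open>
  These rules turn a sum weighted by an indicator into a sum over a subset, which prevents the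
  exchange of summations below.
\<close>

lemmas [simp del] = Bochner_Integration.sum_mult_indicator Bochner_Integration.sum_indicator_mult
  Indicator_Function.sum_mult_indicator Indicator_Function.sum_indicator_mult

lemma sum_rotate:
  "(\<Sum>c\<in>A. \<Sum>a\<in>B. \<Sum>b\<in>C. F c a b) = (\<Sum>a\<in>B. \<Sum>b\<in>C. \<Sum>c\<in>A. F c a b)"
  by (subst sum.swap) (rule sum.cong[OF refl], rule sum.swap)

lemma integral_indicator:
  assumes "pdom X" "n \<ge> 1" "level X n U" "fin_add X \<mu>"
  shows "padic_integral p X \<mu> (indicator U) = \<mu> U"
proof -
  have "padic_integral p X \<mu> (indicator U) = riemann X n \<mu> (indicator U)"
    using assms by (intro integral_locconst) (auto simp: indicator_def level_def pcong_commute)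
  also have "\<dots> = \<mu> U"
    unfolding fin_add_level[OF assms] riemann_def
    by (intro sum.mono_neutral_cong_right) (auto simp: indicator_def)
  finally show ?thesis .
qed

lemma Up_mult_pcong:
  assumes "u \<in> Up"
  shows "x \<in> Up \<Longrightarrow> u * x \<in> Up" "pcong n x y \<Longrightarrow> pcong n (u * x) (u * y)"
  using assms by (simp_all add: pcong_unit_mult_iff)

lemma level_scale: "u \<in> Up \<Longrightarrow> level Up n U \<Longrightarrow> level Up n {y \<in> Up. u * y \<in> U}"
  using level_vimage[of Up Up "\<lambda>x. u * x"] Up_mult_pcong by simp

text \<open>
  The inner integral of the indicator of \<open>U\<close> at \<open>x y\<close> is the mass of \<open>x\<^sup>-\<^sup>1 U\<close>.
\<close>

lemma conv_eq:
  assumes "bounded_measure Up \<nu>" "clopen_in Up U"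
  shows "(\<mu> \<star> \<nu>) U = padic_integral p Up \<mu> (\<lambda>x. \<nu> {y \<in> Up. x * y \<in> U})"
proof -
  obtain n where n: "n \<ge> 1" "level Up n U" using assms(2) by (auto simp: clopen_iff)
  have "padic_integral p Up \<nu> (\<lambda>y. indicator U (x * y)) = \<nu> {y \<in> Up. x * y \<in> U}" if "x \<in> Up" for x
  proof -
    have "padic_integral p Up \<nu> (\<lambda>y. indicator U (x * y)) =
      padic_integral p Up \<nu> (indicator {y \<in> Up. x * y \<in> U})"
      by (rule integral_cong) (simp add: indicator_def)
    also have "\<dots> = \<nu> {y \<in> Up. x * y \<in> U}"
      by (rule integral_indicator[OF pdom_Up n(1) level_scale[OF that n(2)] bm_fin_add[OF assms(1)]])
    finally show ?thesis .
  qed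
  then show ?thesis
    using assms(2) unfolding mult_convolution_def by (auto intro: integral_cong)
qed

lemma scale_cong:
  assumes "level Up n U" "x \<in> Up" "x' \<in> Up" "pcong n x x'"
  shows "{y \<in> Up. x * y \<in> U} = {y \<in> Up. x' * y \<in> U}"
proof -
  have "x * y \<in> U \<longleftrightarrow> x' * y \<in> U" if "y \<in> Up" for y
  proof -
    have "pcong n (x * y) (x' * y)" using pcong_unit_mult_iff[OF that, of n x x'] assms by (simp add: mult.commute)
    then show ?thesis using assms that pcong_sym Up_mult unfolding level_def by blast
  qed
  then show ?thesis by blast
qed

text \<open>
  For a union of residue classes modulo \<open>p\<^sup>n\<close> both integrals are Riemann sums of level \<open>n\<close>. From
  this formula commutativity is an exchange of two finite sums.
\<close>

lemma conv_sum:
  assumes "bounded_measure Up \<mu>" "bounded_measure Up \<nu>" "n \<ge> 1" "level Up n U"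
  shows "(\<mu> \<star> \<nu>) U = (\<Sum>a\<in>reps Up n. \<Sum>b\<in>reps Up n.
    indicator U (of_nat a * of_nat b) * (\<mu> (pball n (of_nat a)) * \<nu> (pball n (of_nat b))))"
proof -
  have "(\<mu> \<star> \<nu>) U = padic_integral p Up \<mu> (\<lambda>x. \<nu> {y \<in> Up. x * y \<in> U})"
    using assms level_clopen by (intro conv_eq) auto
  also have "\<dots> = riemann Up n \<mu> (\<lambda>x. \<nu> {y \<in> Up. x * y \<in> U})"
    by (rule integral_locconst[OF pdom_Up bm_fin_add[OF assms(1)] assms(3)])
      (simp only: scale_cong[OF assms(4)])
  also have "\<dots> = (\<Sum>a\<in>reps Up n. \<Sum>b\<in>reps Up n.
    indicator U (of_nat a * of_nat b) * (\<mu> (pball n (of_nat a)) * \<nu> (pball n (of_nat b))))"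
    unfolding riemann_def
  proof (intro sum.cong refl)
    fix a assume a: "a \<in> reps Up n"
    have "\<nu> {y \<in> Up. of_nat a * y \<in> U} =
        (\<Sum>b | b \<in> reps Up n \<and> of_nat b \<in> {y \<in> Up. of_nat a * y \<in> U}. \<nu> (pball n (of_nat b)))"
      using fin_add_level[OF pdom_Up assms(3) level_scale[OF reps_mem[OF a] assms(4)] bm_fin_add[OF assms(2)]] .
    also have "\<dots> = (\<Sum>b\<in>reps Up n. indicator U (of_nat a * of_nat b) * \<nu> (pball n (of_nat b)))"
      by (rule sum.mono_neutral_cong_left) (auto simp: indicator_def reps_def)
    finally show "\<nu> {y \<in> Up. of_nat a * y \<in> U} * \<mu> (pball n (of_nat a)) = (\<Sum>b\<in>reps Up n.
        indicator U (of_nat a * of_nat b) * (\<mu> (pball n (of_nat a)) * \<nu> (pball n (of_nat b))))"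
      by (simp add: sum_distrib_left sum_distrib_right mult_ac)
  qed
  finally show ?thesis .
qed

lemma bounded_measure_conv:
  assumes "bounded_measure Up \<mu>" "bounded_measure Up \<nu>"
  shows "bounded_measure Up (\<mu> \<star> \<nu>)"
proof -
  obtain B where B: "B > 0" "\<And>U. absv (\<mu> U) \<le> B" using bm_bound[OF assms(1)] by blast
  obtain C where C: "C > 0" "\<And>U. absv (\<nu> U) \<le> C" using bm_bound[OF assms(2)] by blast
  show ?thesis
  proof (rule bounded_measureI[OF pdom_Up])
    show "fin_add Up (\<mu> \<star> \<nu>)"
      unfolding fin_add_def
    proof (intro allI impI)
      fix U V assume UV: "clopen_in Up U \<and> clopen_in Up V \<and> U \<inter> V = {}"
      then obtain n m where "n \<ge> 1" "level Up n U" "m \<ge> 1" "level Up m V" by (auto simp: clopen_iff)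
      then have l: "max n m \<ge> 1" "level Up (max n m) U" "level Up (max n m) V"
        using level_mono[of Up n U "max n m"] level_mono[of Up m V "max n m"] by auto
      then have l': "level Up (max n m) (U \<union> V)" unfolding level_def by blast
      have "indicator (U \<union> V) x = indicator U x + (indicator V x :: 'k)" for x
        using UV by (auto simp: indicator_def)
      then show "(\<mu> \<star> \<nu>) (U \<union> V) = (\<mu> \<star> \<nu>) U + (\<mu> \<star> \<nu>) V"
        unfolding conv_sum[OF assms l(1,2)] conv_sum[OF assms l(1,3)] conv_sum[OF assms l(1) l']
        by (simp add: sum.distrib distrib_right)
    qed
    show "(\<mu> \<star> \<nu>) U = 0" if "\<not> clopen_in Up U" for U
      using that by (simp add: mult_convolution_def)
    show "absv ((\<mu> \<star> \<nu>) (pball n x)) \<le> B * C" if "n \<ge> 1" "x \<in> Up" for n x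
      unfolding conv_sum[OF assms that(1) level_pball[OF pdom_Up that(2,1)]]
      using B C by (intro absv_sum_le) (auto simp: indicator_def absv_mult intro!: mult_mono)
  qed
qed

text \<open>
  The Riemann sum of a product measure regroups a double sum by the residue of \<open>a b\<close>.
\<close>

lemma conv_riemann:
  assumes "bounded_measure Up \<mu>" "bounded_measure Up \<nu>" "n \<ge> 1"
  shows "riemann Up n (\<mu> \<star> \<nu>) f = (\<Sum>a\<in>reps Up n. \<Sum>b\<in>reps Up n.
    f (of_nat (res n (of_nat a * of_nat b))) * (\<mu> (pball n (of_nat a)) * \<nu> (pball n (of_nat b))))"
proof -
  define M where "M = (\<lambda>a b. \<mu> (pball n (of_nat a)) * \<nu> (pball n (of_nat b)))"
  have "riemann Up n (\<mu> \<star> \<nu>) f = (\<Sum>c\<in>reps Up n. \<Sum>a\<in>reps Up n. \<Sum>b\<in>reps Up n.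
      f (of_nat c) * indicator (pball n (of_nat c)) (of_nat a * of_nat b) * M a b)"
    unfolding riemann_def
  proof (intro sum.cong refl)
    fix c assume c: "c \<in> reps Up n"
    show "f (of_nat c) * (\<mu> \<star> \<nu>) (pball n (of_nat c)) = (\<Sum>a\<in>reps Up n. \<Sum>b\<in>reps Up n.
      f (of_nat c) * indicator (pball n (of_nat c)) (of_nat a * of_nat b) * M a b)"
      unfolding conv_sum[OF assms level_pball[OF pdom_Up reps_mem[OF c] assms(3)]] M_def
      by (simp add: sum_distrib_left mult.assoc)
  qed
  also have "\<dots> = (\<Sum>a\<in>reps Up n. \<Sum>b\<in>reps Up n. \<Sum>c\<in>reps Up n.
      f (of_nat c) * indicator (pball n (of_nat c)) (of_nat a * of_nat b) * M a b)"
    by (rule sum_rotate)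
  also have "\<dots> = (\<Sum>a\<in>reps Up n. \<Sum>b\<in>reps Up n. f (of_nat (res n (of_nat a * of_nat b))) * M a b)"
  proof (intro sum.cong refl)
    fix a b assume "a \<in> reps Up n" "b \<in> reps Up n"
    then have ab: "of_nat a * of_nat b \<in> Up" using reps_mem by simp
    then have Z: "of_nat a * of_nat b \<in> Zp" using Up_subset by blast
    have "(\<Sum>c\<in>reps Up n. f (of_nat c) * indicator (pball n (of_nat c)) (of_nat a * of_nat b) * M a b) =
      (\<Sum>c\<in>reps Up n. if c = res n (of_nat a * of_nat b) then f (of_nat c) * M a b else 0)"
    proof (intro sum.cong refl)
      fix c assume c: "c \<in> reps Up n"
      have "of_nat a * of_nat b \<in> pball n (of_nat c) \<longleftrightarrow> c = res n (of_nat a * of_nat b)"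
        using res_eqI[OF Z] pcong_res[OF Z] Z c by (auto simp: pball_def reps_def)
      then show "f (of_nat c) * indicator (pball n (of_nat c)) (of_nat a * of_nat b) * M a b =
        (if c = res n (of_nat a * of_nat b) then f (of_nat c) * M a b else 0)"
        by (simp add: indicator_def)
    qed
    also have "\<dots> = f (of_nat (res n (of_nat a * of_nat b))) * M a b"
      using res_reps[OF pdom_Up ab assms(3)] by (simp add: sum.delta)
    finally show "(\<Sum>c\<in>reps Up n. f (of_nat c) * indicator (pball n (of_nat c)) (of_nat a * of_nat b) * M a b) =
      f (of_nat (res n (of_nat a * of_nat b))) * M a b" .
  qed
  finally show ?thesis by (simp add: M_def)
qed

lemma conv_riemann_level:
  assumes "bounded_measure Up \<mu>" "bounded_measure Up \<nu>" "n \<ge> 1"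
    and f: "\<And>x y. x \<in> Up \<Longrightarrow> y \<in> Up \<Longrightarrow> pcong n x y \<Longrightarrow> f x = f y"
  shows "riemann Up n (\<mu> \<star> \<nu>) f = (\<Sum>a\<in>reps Up n. \<Sum>b\<in>reps Up n.
    f (of_nat a * of_nat b) * (\<mu> (pball n (of_nat a)) * \<nu> (pball n (of_nat b))))"
  unfolding conv_riemann[OF assms(1-3)]
proof (intro sum.cong refl)
  fix a b assume "a \<in> reps Up n" "b \<in> reps Up n"
  then have ab: "of_nat a * of_nat b \<in> Up" using reps_mem by simp
  then have Z: "of_nat a * of_nat b \<in> Zp" using Up_subset by blast
  have "f (of_nat (res n (of_nat a * of_nat b))) = f (of_nat a * of_nat b)"
    using pdom_res[OF pdom_Up ab assms(3)] ab pcong_sym[OF pcong_res[OF Z]] by (intro f) auto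
  then show "f (of_nat (res n (of_nat a * of_nat b))) * (\<mu> (pball n (of_nat a)) * \<nu> (pball n (of_nat b))) =
    f (of_nat a * of_nat b) * (\<mu> (pball n (of_nat a)) * \<nu> (pball n (of_nat b)))" by simp
qed

lemma conv_commute:
  assumes "bounded_measure Up \<mu>" "bounded_measure Up \<nu>"
  shows "\<mu> \<star> \<nu> = \<nu> \<star> \<mu>"
proof (rule bounded_measure_eqI[OF pdom_Up])
  fix n :: nat and x :: 'k assume n: "n \<ge> 1" "x \<in> Up"
  show "(\<mu> \<star> \<nu>) (pball n x) = (\<nu> \<star> \<mu>) (pball n x)"
    unfolding conv_sum[OF assms n(1) level_pball[OF pdom_Up n(2,1)]]
      conv_sum[OF assms(2,1) n(1) level_pball[OF pdom_Up n(2,1)]]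
    by (subst sum.swap) (simp add: mult_ac)
qed (intro bounded_measure_conv assms)+

lemma indicator_level:
  assumes "level Up n U" "x \<in> Up" "y \<in> Up" "pcong n x y"
  shows "indicator U x = (indicator U y :: 'k)"
  using assms pcong_sym unfolding level_def indicator_def by auto

lemma conv_assoc:
  assumes "bounded_measure Up \<mu>" "bounded_measure Up \<nu>" "bounded_measure Up \<rho>"
  shows "\<mu> \<star> \<nu> \<star> \<rho> = \<mu> \<star> (\<nu> \<star> \<rho>)"
proof (rule bounded_measure_eqI[OF pdom_Up])
  fix n :: nat and x :: 'k assume n: "n \<ge> 1" "x \<in> Up"
  have l: "level Up n (pball n x)" using level_pball[OF pdom_Up n(2,1)] .
  have 1: "(\<Sum>a\<in>reps Up n. indicator (pball n x) (of_nat a * z) * (\<mu> \<star> \<nu>) (pball n (of_nat a)))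
     = (\<Sum>a\<in>reps Up n. \<Sum>b\<in>reps Up n. indicator (pball n x) (of_nat a * of_nat b * z) *
          (\<mu> (pball n (of_nat a)) * \<nu> (pball n (of_nat b))))"
    if z: "z \<in> Up" and b: "bounded_measure Up \<mu>" "bounded_measure Up \<nu>" for z \<mu> \<nu>
    using conv_riemann_level[OF b n(1), of "\<lambda>y. indicator (pball n x) (y * z)"] indicator_level[OF l]
      Up_mult[OF _ z] pcong_unit_mult_iff[OF z]
    unfolding riemann_def by (simp add: mult.commute)
  have "(\<mu> \<star> \<nu> \<star> \<rho>) (pball n x) = (\<Sum>b\<in>reps Up n.
    (\<Sum>a\<in>reps Up n. indicator (pball n x) (of_nat a * of_nat b) * (\<mu> \<star> \<nu>) (pball n (of_nat a)))
      * \<rho> (pball n (of_nat b)))"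
    unfolding conv_sum[OF bounded_measure_conv[OF assms(1,2)] assms(3) n(1) l]
    by (subst sum.swap) (simp add: sum_distrib_left sum_distrib_right mult_ac)
  also have "\<dots> = (\<Sum>c\<in>reps Up n. \<Sum>a\<in>reps Up n. \<Sum>b\<in>reps Up n.
    indicator (pball n x) (of_nat a * of_nat b * of_nat c) *
     (\<mu> (pball n (of_nat a)) * \<nu> (pball n (of_nat b)) * \<rho> (pball n (of_nat c))))"
  proof (rule sum.cong[OF refl])
    fix c assume c: "c \<in> reps Up n"
    show "(\<Sum>a\<in>reps Up n. indicator (pball n x) (of_nat a * of_nat c) * (\<mu> \<star> \<nu>) (pball n (of_nat a)))
      * \<rho> (pball n (of_nat c)) = (\<Sum>a\<in>reps Up n. \<Sum>b\<in>reps Up n.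
      indicator (pball n x) (of_nat a * of_nat b * of_nat c) *
      (\<mu> (pball n (of_nat a)) * \<nu> (pball n (of_nat b)) * \<rho> (pball n (of_nat c))))"
      unfolding 1[OF reps_mem[OF c] assms(1,2)] by (simp add: sum_distrib_left sum_distrib_right mult_ac)
  qed
  also have "\<dots> = (\<Sum>a\<in>reps Up n. \<Sum>b\<in>reps Up n. \<Sum>c\<in>reps Up n.
    indicator (pball n x) (of_nat a * of_nat b * of_nat c) *
     (\<mu> (pball n (of_nat a)) * \<nu> (pball n (of_nat b)) * \<rho> (pball n (of_nat c))))"
    by (rule sum_rotate)
  also have "\<dots> = (\<Sum>a\<in>reps Up n.
    (\<Sum>b\<in>reps Up n. \<Sum>c\<in>reps Up n. indicator (pball n x) (of_nat b * of_nat c * of_nat a) *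
     (\<nu> (pball n (of_nat b)) * \<rho> (pball n (of_nat c)))) * \<mu> (pball n (of_nat a)))"
    by (simp add: sum_distrib_left sum_distrib_right mult_ac)
  also have "\<dots> = (\<Sum>a\<in>reps Up n.
    (\<Sum>b\<in>reps Up n. indicator (pball n x) (of_nat b * of_nat a) * (\<nu> \<star> \<rho>) (pball n (of_nat b)))
     * \<mu> (pball n (of_nat a)))"
  proof (rule sum.cong[OF refl])
    fix a assume a: "a \<in> reps Up n"
    show "(\<Sum>b\<in>reps Up n. \<Sum>c\<in>reps Up n. indicator (pball n x) (of_nat b * of_nat c * of_nat a) *
       (\<nu> (pball n (of_nat b)) * \<rho> (pball n (of_nat c)))) * \<mu> (pball n (of_nat a)) =
      (\<Sum>b\<in>reps Up n. indicator (pball n x) (of_nat b * of_nat a) * (\<nu> \<star> \<rho>) (pball n (of_nat b)))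
       * \<mu> (pball n (of_nat a))"
      unfolding 1[OF reps_mem[OF a] assms(2,3)] ..
  qed
  also have "\<dots> = (\<mu> \<star> (\<nu> \<star> \<rho>)) (pball n x)"
    unfolding conv_sum[OF assms(1) bounded_measure_conv[OF assms(2,3)] n(1) l]
    by (simp add: sum_distrib_left sum_distrib_right mult_ac)
  finally show "(\<mu> \<star> \<nu> \<star> \<rho>) (pball n x) =
    (\<mu> \<star> (\<nu> \<star> \<rho>)) (pball n x)" .
qed (intro bounded_measure_conv assms)+

lemma ucont_scale_measure:
  assumes "clopen_in Up U"
  shows "ucont Up (\<lambda>x. \<nu> {y \<in> Up. x * y \<in> U} :: 'k)"
proof -
  obtain n where n: "level Up n U" using assms by (auto simp: clopen_iff)
  show ?thesis by (rule ucont_locconst[of _ n]) (simp only: scale_cong[OF n])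
qed

lemma conv_dirac:
  assumes "bounded_measure Up \<nu>" "u \<in> Up" "clopen_in Up U"
  shows "(dirac_measure Up u \<star> \<nu>) U = \<nu> {y \<in> Up. u * y \<in> U}"
  unfolding conv_eq[OF assms(1,3)]
  by (rule integral_dirac[OF pdom_Up assms(2) ucont_scale_measure[OF assms(3)]])

abbreviation IW :: "('k set \<Rightarrow> 'k) ring" where "IW \<equiv> iwasawa_algebra p"

lemma carrier_IW [simp]: "\<mu> \<in> carrier IW \<longleftrightarrow> bounded_measure Up \<mu>"
  and mult_IW: "\<mu> \<otimes>\<^bsub>IW\<^esub> \<nu> = \<mu> \<star> \<nu>"
  and one_IW: "\<one>\<^bsub>IW\<^esub> = dirac_measure Up 1"
  by (simp_all add: iwasawa_algebra_def)

lemma comm_monoid_IW: "comm_monoid IW"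
proof (rule comm_monoidI)
  show "\<one>\<^bsub>IW\<^esub> \<otimes>\<^bsub>IW\<^esub> \<mu> = \<mu>" if "\<mu> \<in> carrier IW" for \<mu>
  proof (rule bounded_measure_eqI[OF pdom_Up])
    fix n :: nat and x :: 'k assume n: "n \<ge> 1" "x \<in> Up"
    have "{y \<in> Up. 1 * y \<in> pball n x} = pball n x" using pball_subset[OF pdom_Up n(2,1)] by auto
    then show "(\<one>\<^bsub>IW\<^esub> \<otimes>\<^bsub>IW\<^esub> \<mu>) (pball n x) = \<mu> (pball n x)"
      using that level_clopen[OF pdom_Up level_pball[OF pdom_Up n(2,1)]]
      by (simp add: mult_IW one_IW conv_dirac del: mult_1)
  qed (use that in \<open>simp_all add: mult_IW one_IW bounded_measure_conv dirac_bounded_measure\<close>)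
next
  show "\<mu> \<otimes>\<^bsub>IW\<^esub> \<nu> = \<nu> \<otimes>\<^bsub>IW\<^esub> \<mu>" if "\<mu> \<in> carrier IW" "\<nu> \<in> carrier IW" for \<mu> \<nu>
    using that conv_commute by (simp add: mult_IW)
qed (simp_all add: mult_IW one_IW bounded_measure_conv conv_assoc dirac_bounded_measure)

section \<open>The regularisers and fractions of measures\<close>

lemma admissible_Up: "admissible p c \<Longrightarrow> of_nat c \<in> Up"
  by (rule of_nat_Up) (simp add: admissible_def)

lemma bounded_measure_regulariser:
  "of_nat c \<in> Up \<Longrightarrow> bounded_measure Up (regulariser c)"
  unfolding regulariser_def by (intro bounded_measure_diff dirac_bounded_measure) auto

lemma integral_regulariser:
  "of_nat c \<in> Up \<Longrightarrow> ucont Up f \<Longrightarrow>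
    padic_integral p Up (regulariser c) f = f 1 - of_nat c * f (of_nat c)"
  unfolding regulariser_def
  by (simp add: integral_measure_diff dirac_bounded_measure integral_dirac)

text \<open>
  Both the cancellability of \<open>r\<^sub>c\<close> and the independence of \<open>c\<close> are read off from this formula.
\<close>

lemma conv_regulariser:
  assumes "of_nat c \<in> Up" "bounded_measure Up \<nu>" "clopen_in Up U"
  shows "(regulariser c \<star> \<nu>) U = \<nu> U - of_nat c * \<nu> {y \<in> Up. of_nat c * y \<in> U}"
proof -
  have "{y \<in> Up. 1 * y \<in> U} = U" using clopen_subset[OF assms(3)] by auto
  then show ?thesis
    using integral_regulariser[OF assms(1) ucont_scale_measure[OF assms(3), of \<nu>]]
    by (simp add: conv_eq[OF assms(2,3)])
qed

lemma scale_pball: "u \<in> Up \<Longrightarrow> x \<in> Up \<Longrightarrow> n \<ge> 1 \<Longrightarrow> {y \<in> Up. u * y \<in> pball n x} = pball n (x / u)"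
proof -
  assume *: "u \<in> Up" "x \<in> Up" "n \<ge> 1"
  have "pcong n (u * y) x \<longleftrightarrow> pcong n y (x / u)" for y
    using pcong_unit_mult_iff[OF *(1), of n y "x / u"] Up_nonzero[OF *(1)] by simp
  then show ?thesis
    using pball_subset[OF pdom_Up Up_divide[OF *(2,1)] *(3)] Up_subset * Up_mult[OF *(1)]
    by (auto simp: pball_def)
qed

text \<open>
  The difference \<open>D\<close> of the masses satisfies \<open>D(U) = c D(c\<^sup>-\<^sup>1 U)\<close>. After as many iterations as
  there are units modulo \<open>p\<^sup>n\<close>, one returns to the same ball by Euler's theorem, with a factor
  \<open>c\<^sup>k \<noteq> 1\<close>.
\<close>

lemma regulariser_cancel:
  assumes c: "admissible p c" and "bounded_measure Up A" "bounded_measure Up B"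
    and eq: "(regulariser c \<star> A) = (regulariser c \<star> B)"
  shows "A = B"
proof (rule bounded_measure_eqI[OF pdom_Up assms(2,3)])
  fix n :: nat and x :: 'k assume n: "n \<ge> 1" "x \<in> Up"
  have cU: "of_nat c \<in> Up" using admissible_Up[OF c] .
  define D where "D = (\<lambda>x. A (pball n x) - B (pball n x))"
  have step: "D x = of_nat c * D (x / of_nat c)" if "x \<in> Up" for x
  proof -
    have cl: "clopen_in Up (pball n x)" using level_clopen[OF pdom_Up level_pball[OF pdom_Up that n(1)]] .
    have "A (pball n x) - of_nat c * A (pball n (x / of_nat c)) = B (pball n x) - of_nat c * B (pball n (x / of_nat c))"
      using fun_cong[OF eq, of "pball n x"] conv_regulariser[OF cU assms(2) cl] conv_regulariser[OF cU assms(3) cl]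
        scale_pball[OF cU that n(1)] by simp
    then show ?thesis unfolding D_def by (simp add: algebra_simps)
  qed
  have iter: "D x = of_nat c ^ k * D (x / of_nat c ^ k)" if "x \<in> Up" for x k
  proof (induction k)
    case (Suc k)
    have "D (x / of_nat c ^ k) = of_nat c * D (x / of_nat c ^ k / of_nat c)"
      using that cU by (intro step) auto
    then show ?case using Suc by (simp add: mult_ac divide_divide_eq_left)
  qed simp
  define k where "k = totient (p ^ n)"
  have "coprime c (p ^ n)" using c by (simp add: admissible_def)
  then have "[c ^ k = 1] (mod p ^ n)" unfolding k_def by (rule euler_theorem)
  then have "pcong n (of_nat c ^ k) 1"
    using pcong_of_nat[of n "c ^ k" 1] by simp
  then have "pcong n (x / of_nat c ^ k * of_nat c ^ k) (x / of_nat c ^ k * 1)"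
    using n cU by (simp only: pcong_unit_mult_iff Up_divide Up_power)
  then have "pcong n x (x / of_nat c ^ k)" using Up_nonzero[OF cU] by simp
  then have "D (x / of_nat c ^ k) = D x" unfolding D_def using pball_eq by simp
  then have "D x * (1 - of_nat c ^ k) = 0" using iter[OF n(2), of k] by (simp add: algebra_simps)
  moreover have "(of_nat c ^ k :: 'k) \<noteq> 1"
  proof -
    have "k > 0" unfolding k_def by simp
    then have "c ^ k \<noteq> 1" using c by (auto simp: admissible_def)
    then show ?thesis by (metis of_nat_1 of_nat_eq_iff of_nat_power)
  qed
  ultimately show "A (pball n x) = B (pball n x)" unfolding D_def by auto
qed

lemma regulariser_subset: "{regulariser c | c. admissible p c} \<subseteq> carrier IW"
  using bounded_measure_regulariser admissible_Up by auto

lemma reg_set_carrier: "reg_set p \<subseteq> carrier IW"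
  and reg_set_one: "\<one>\<^bsub>IW\<^esub> \<in> reg_set p"
  and reg_set_mult: "s \<in> reg_set p \<Longrightarrow> t \<in> reg_set p \<Longrightarrow> s \<otimes>\<^bsub>IW\<^esub> t \<in> reg_set p"
  and regulariser_reg_set: "admissible p c \<Longrightarrow> (regulariser c :: 'k set \<Rightarrow> 'k) \<in> reg_set p"
proof -
  interpret ring_mult_monoid IW by (intro ring_mult_monoid.intro comm_monoid_IW)
  show "reg_set p \<subseteq> carrier IW" "\<one>\<^bsub>IW\<^esub> \<in> reg_set p"
    unfolding reg_set_def using mult_generated_subset[OF regulariser_subset] mult_generated.one by auto
  show "s \<otimes>\<^bsub>IW\<^esub> t \<in> reg_set p" if "s \<in> reg_set p" "t \<in> reg_set p"
    using mult_generated_mult[OF regulariser_subset] that unfolding reg_set_def by blast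
  show "(regulariser c :: 'k set \<Rightarrow> 'k) \<in> reg_set p" if "admissible p c"
    unfolding reg_set_def by (rule mult_generated_incl[OF regulariser_subset]) (use that in blast)
qed

text \<open>All denominators are cancellable, so the auxiliary factor in the relation cancels.\<close>

lemma iwasawa_rel_iff:
  "((A, r), (B, t)) \<in> loc_rel IW (reg_set p) \<longleftrightarrow>
    A \<in> carrier IW \<and> r \<in> reg_set p \<and> B \<in> carrier IW \<and> t \<in> reg_set p \<and> A \<otimes>\<^bsub>IW\<^esub> t = B \<otimes>\<^bsub>IW\<^esub> r"
proof -
  interpret ring_mult_monoid IW by (intro ring_mult_monoid.intro comm_monoid_IW)
  have c: "a = b" if "u \<in> reg_set p" "a \<in> carrier IW" "b \<in> carrier IW" "u \<otimes>\<^bsub>IW\<^esub> a = u \<otimes>\<^bsub>IW\<^esub> b" for u a b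
    using mult_generated_cancel[OF regulariser_subset, of u a b] that regulariser_cancel
    unfolding reg_set_def by (auto simp: mult_IW)
  show ?thesis
  proof
    assume "((A, r), (B, t)) \<in> loc_rel IW (reg_set p)"
    then obtain u where u: "A \<in> carrier IW" "r \<in> reg_set p" "B \<in> carrier IW" "t \<in> reg_set p"
      "u \<in> reg_set p" "u \<otimes>\<^bsub>IW\<^esub> (A \<otimes>\<^bsub>IW\<^esub> t) = u \<otimes>\<^bsub>IW\<^esub> (B \<otimes>\<^bsub>IW\<^esub> r)"
      unfolding loc_rel_def by blast
    have "A \<otimes>\<^bsub>IW\<^esub> t \<in> carrier IW" "B \<otimes>\<^bsub>IW\<^esub> r \<in> carrier IW"
      using u reg_set_carrier by (auto simp: subset_iff simp del: carrier_IW)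
    then show "A \<in> carrier IW \<and> r \<in> reg_set p \<and> B \<in> carrier IW \<and> t \<in> reg_set p \<and>
      A \<otimes>\<^bsub>IW\<^esub> t = B \<otimes>\<^bsub>IW\<^esub> r"
      using c[OF u(5) _ _ u(6)] u by blast
  next
    assume "A \<in> carrier IW \<and> r \<in> reg_set p \<and> B \<in> carrier IW \<and> t \<in> reg_set p \<and> A \<otimes>\<^bsub>IW\<^esub> t = B \<otimes>\<^bsub>IW\<^esub> r"
    then show "((A, r), (B, t)) \<in> loc_rel IW (reg_set p)"
      unfolding loc_rel_def using reg_set_one by auto
  qed
qed

section \<open>Teichmueller representatives\<close>

lemma pcong_eqI: "(\<And>n. n \<ge> N \<Longrightarrow> pcong n x y) \<Longrightarrow> x = y"
proof (rule ccontr)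
  assume *: "\<And>n. n \<ge> N \<Longrightarrow> pcong n x y" and "x \<noteq> y"
  then obtain n where n: "1 / real p ^ n < absv (x - y)" using small_p_power[of "absv (x - y)"] by auto
  have "pcong n x y" using pcong_mono[OF _ *[of "max n N"], of n] by simp
  then show False using n by (simp add: pcong_def)
qed

lemma absv_power_le_1: "absv x \<le> 1 \<Longrightarrow> absv (x ^ k :: 'k) \<le> 1"
  by (simp add: absv_power power_le_one)

lemma pcong_power: "absv x \<le> 1 \<Longrightarrow> absv y \<le> 1 \<Longrightarrow> pcong n x y \<Longrightarrow> pcong n (x ^ k) (y ^ k)"
proof (induction k)
  case (Suc k)
  then show ?case using pcong_mult[of "x ^ k" y n x "y ^ k"] absv_power_le_1[of x k] by simp
qed simp

lemma absv_power_diff_le: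
  "absv x \<le> 1 \<Longrightarrow> absv y \<le> 1 \<Longrightarrow> absv (x ^ k - y ^ k :: 'k) \<le> absv (x - y)"
proof (induction k)
  case (Suc k)
  have "absv (x * (x ^ k - y ^ k)) \<le> absv (x - y)"
    using Suc mult_mono[of "absv x" 1 "absv (x ^ k - y ^ k)" "absv (x - y)"] by (simp add: absv_mult)
  moreover have "absv ((x - y) * y ^ k) \<le> absv (x - y)"
    using absv_power_le_1[OF Suc.prems(2), of k] by (simp add: absv_mult mult_left_le)
  ultimately have "absv (x * (x ^ k - y ^ k) + (x - y) * y ^ k) \<le> absv (x - y)" by (rule absv_add_le)
  then show ?case by (simp add: algebra_simps)
qed simp

lemma pcong_sum: "(\<And>i. i \<in> A \<Longrightarrow> pcong n (f i) (g i)) \<Longrightarrow> pcong n (sum f A) (sum g A)"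
  unfolding pcong_def sum_subtractf[symmetric] by (rule absv_sum_le) auto

text \<open>
  In \<open>x\<^sup>p - y\<^sup>p = (x - y) \<Sum> x\<^sup>i y\<^sup>p\<^sup>-\<^sup>1\<^sup>-\<^sup>i\<close> the second factor is congruent to \<open>p y\<^sup>p\<^sup>-\<^sup>1\<close>
  modulo \<open>p\<close>, so it is divisible by \<open>p\<close>.
\<close>

lemma pcong_frobenius:
  assumes "absv x \<le> 1" "absv y \<le> 1" "pcong n x y" "n \<ge> 1"
  shows "pcong (Suc n) (x ^ p) (y ^ p)"
proof -
  obtain q where q: "p = Suc q" using p_pos by (metis gr0_implies_Suc)
  define S where "S = (\<Sum>i<p. x ^ i * y ^ (q - i))"
  have "pcong 1 S (\<Sum>i<p. y ^ q)"
    unfolding S_def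
  proof (rule pcong_sum)
    fix i assume "i \<in> {..<p}"
    then have "y ^ q = y ^ i * y ^ (q - i)" by (simp add: q flip: power_add)
    moreover have "pcong 1 (x ^ i * y ^ (q - i)) (y ^ i * y ^ (q - i))"
      using assms pcong_mono[OF assms(4,3)] by (intro pcong_mult pcong_power absv_power_le_1) auto
    ultimately show "pcong 1 (x ^ i * y ^ (q - i)) (y ^ q)" by simp
  qed
  moreover have "absv (\<Sum>i<p. y ^ q) \<le> 1 / real p"
    using absv_power_le_1[OF assms(2), of q] by (simp add: absv_mult absv_p divide_right_mono)
  ultimately have S: "absv S \<le> 1 / real p"
    using absv_add_le[of "S - (\<Sum>i<p. y ^ q)" "1 / real p" "\<Sum>i<p. y ^ q"] by (simp add: pcong_def)
  have "x ^ p - y ^ p = (x - y) * S"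
    unfolding S_def q by (rule diff_power_eq_sum)
  then have "absv (x ^ p - y ^ p) = absv (x - y) * absv S" by (simp add: absv_mult)
  also have "\<dots> \<le> 1 / real p ^ n * (1 / real p)"
    using assms S by (intro mult_mono) (auto simp: pcong_def)
  finally show ?thesis by (simp add: pcong_def mult_ac)
qed

lemma pcong_fermat: "x \<in> Up \<Longrightarrow> pcong 1 (x ^ (p - 1)) 1"
proof -
  assume x: "x \<in> Up"
  then have Z: "x \<in> Zp" using Up_subset by blast
  define a where "a = res 1 x"
  have a: "pcong 1 x (of_nat a)" unfolding a_def by (rule pcong_res[OF Z])
  have "\<not> p dvd a"
  proof
    assume "p dvd a"
    then have "pcong 1 (of_nat a) (0 :: 'k)"
      using pcong_of_nat[of 1 a 0] by (simp add: cong_0_iff)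
    then have "pcong 1 x 0" using a pcong_trans by blast
    then show False using x p_gt_2 by (simp add: pcong_def Up_iff)
  qed
  then have "[a ^ (p - 1) = 1] (mod p)" using fermat_theorem[OF prime_p] by blast
  then have "pcong 1 (of_nat a ^ (p - 1)) (1 :: 'k)" using pcong_of_nat[of 1 "a ^ (p - 1)" 1] by simp
  moreover have "pcong 1 (x ^ (p - 1)) (of_nat a ^ (p - 1))"
    using a by (intro pcong_power) (auto simp: absv_Zp Z)
  ultimately show ?thesis using pcong_trans by blast
qed

lemma pcong_frobenius_iter:
  assumes "absv y \<le> 1" "pcong 1 y 1"
  shows "pcong (Suc n) (y ^ (p ^ n)) 1"
proof (induction n)
  case (Suc n)
  have "pcong (Suc (Suc n)) ((y ^ (p ^ n)) ^ p) (1 ^ p)"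
    using Suc absv_power_le_1[OF assms(1)] by (intro pcong_frobenius) auto
  then show ?case by (simp add: power_mult mult.commute flip: power_mult)
qed (use assms in simp)

text \<open>
  The representative is the limit of \<open>x\<close> raised to the powers \<open>p\<^sup>n\<close>: consecutive terms are
  congruent modulo \<open>p\<^sup>n\<^sup>+\<^sup>1\<close> by Fermat's theorem and iteration of the Frobenius congruence.
\<close>

lemma teichmueller_exists:
  assumes x: "x \<in> Up"
  shows "\<exists>w\<in>Up. w ^ (p - 1) = 1 \<and> pcong 1 x w"
proof -
  have Z: "x \<in> Zp" using x Up_subset by blast
  define t where "t n = x ^ (p ^ n)" for n
  have tU: "t n \<in> Up" for n unfolding t_def using x by simp
  have t1: "pcong (Suc n) (t n ^ (p - 1)) 1" for n
  proof -
    have "pcong (Suc n) ((x ^ (p - 1)) ^ (p ^ n)) 1"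
      using pcong_fermat[OF x] absv_power_le_1[OF absv_Zp[OF Z]] by (intro pcong_frobenius_iter)
    then show ?thesis unfolding t_def by (simp add: mult.commute flip: power_mult)
  qed
  have step: "pcong (Suc n) (t (Suc n)) (t n)" for n
  proof -
    have "t (Suc n) = t n ^ p"
      unfolding t_def power_mult[symmetric] by (simp add: mult.commute)
    also have "\<dots> = t n * t n ^ (p - 1)"
      using p_pos(1) by (cases p) auto
    finally have "t (Suc n) = t n * t n ^ (p - 1)" .
    then show ?thesis
      using pcong_scale[OF _ t1[of n], of "t n"] absv_Zp[of "t n"] tU[of n] Up_subset by auto
  qed
  have tt: "pcong (Suc n) (t (n + k)) (t n)" for n k
  proof (induction k)
    case (Suc k)
    have "pcong (Suc n) (t (Suc (n + k))) (t (n + k))" using pcong_mono[OF _ step[of "n + k"]] by simp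
    then show ?case using Suc pcong_trans by auto
  qed simp
  have "Cauchy t"
  proof (rule metric_CauchyI)
    fix e :: real assume "e > 0"
    then obtain N where N: "1 / real p ^ N < e" using small_p_power by blast
    have "dist (t m) (t n) < e" if "m \<ge> N" "n \<ge> N" for m n
    proof -
      have "pcong (Suc N) (t m) (t N)" "pcong (Suc N) (t N) (t n)"
        using tt[of N "m - N"] pcong_sym[OF tt[of N "n - N"]] that by auto
      then have "pcong N (t m) (t n)" using pcong_trans pcong_mono[of N "Suc N"] by (meson le_SucI order_refl)
      then show ?thesis using N by (simp add: pcong_def dist_absv)
    qed
    then show "\<exists>M. \<forall>m\<ge>M. \<forall>n\<ge>M. dist (t m) (t n) < e" by blast
  qed
  then obtain w where w: "t \<longlonglongrightarrow> w" using Cauchy_convergent convergent_def by blast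
  have wt: "pcong (Suc n) w (t n)" for n
  proof -
    obtain M where M: "\<And>m. m \<ge> M \<Longrightarrow> absv (t m - w) < 1 / real p ^ Suc n"
      using w p_pos(2) unfolding tendsto_absv_iff by (meson divide_pos_pos zero_less_one zero_less_power)
    have "pcong (Suc n) (t (n + M)) w"
      using M[of "n + M"] by (simp add: pcong_def)
    then have "pcong (Suc n) w (t (n + M))" by (rule pcong_sym)
    then show ?thesis using tt pcong_trans by blast
  qed
  have wZ: "w \<in> Zp"
  proof (rule Zp_limit)
    fix n
    have "pcong n w (t n)" using wt pcong_mono[of n "Suc n"] by simp
    then show "\<exists>y\<in>Zp. pcong n w y" using tU Up_subset by blast
  qed
  have xw: "pcong 1 x w" using pcong_sym[OF wt[of 0]] by (simp add: t_def)
  have "w ^ (p - 1) = 1"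
  proof (rule pcong_eqI[of 0])
    fix n
    have "pcong (Suc n) (w ^ (p - 1)) (t n ^ (p - 1))"
      using wt[of n] tU[of n] wZ Up_subset by (intro pcong_power absv_Zp) auto
    then have "pcong (Suc n) (w ^ (p - 1)) 1" using t1 pcong_trans by blast
    then show "pcong n (w ^ (p - 1)) 1" using pcong_mono[of n "Suc n"] by simp
  qed
  then show ?thesis using pcong_Up[OF x wZ _ xw] xw by auto
qed

lemma geometric_sum_pcong: "absv u \<le> 1 \<Longrightarrow> pcong n u 1 \<Longrightarrow> pcong n (\<Sum>i<m. u ^ i) (of_nat m)"
  using pcong_sum[of "{..<m}" n "\<lambda>i. u ^ i" "\<lambda>_. 1"] pcong_power[of u 1 n] by simp

lemma pcong_1_absv: "pcong 1 u 1 \<Longrightarrow> absv u = 1"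
proof -
  assume "pcong 1 u 1"
  then have "absv (u - 1) \<le> 1 / real p" by (simp add: pcong_def)
  also have "\<dots> < absv (1::'k)" using p_gt_2 by simp
  finally show ?thesis using absv_eqI[of u 1] by simp
qed

lemma geometric_sum_coprime:
  assumes "pcong 1 u 1" "coprime m p"
  shows "absv (\<Sum>i<m. u ^ i) = 1"
proof -
  have "pcong 1 (\<Sum>i<m. u ^ i) (of_nat m)"
    using geometric_sum_pcong assms(1) pcong_1_absv[OF assms(1)] by simp
  then have "absv ((\<Sum>i<m. u ^ i) - of_nat m) \<le> 1 / real p" by (simp add: pcong_def)
  also have "\<dots> < absv (of_nat m :: 'k)" using absv_of_nat_coprime[OF assms(2)] p_gt_2 by simp
  finally show ?thesis using absv_eqI absv_of_nat_coprime[OF assms(2)] by metis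
qed

lemma coprime_p_minus_1: "coprime (p - 1) p"
  using p_pos(1) by (metis Suc_pred' coprime_Suc_right_nat coprime_commute)

text \<open>
  The cofactor of \<open>u - 1\<close> in \<open>u\<^sup>p\<^sup>-\<^sup>1 - 1\<close> is congruent to \<open>p - 1\<close>, hence a unit.
\<close>

lemma root_of_unity_pcong_1:
  assumes "u ^ (p - 1) = 1" "pcong 1 u 1"
  shows "u = 1"
proof -
  have "(u - 1) * (\<Sum>i<p - 1. u ^ i) = 0"
    using assms(1) power_diff_1_eq[of u "p - 1"] by simp
  moreover have "(\<Sum>i<p - 1. u ^ i) \<noteq> 0"
    using geometric_sum_coprime[OF assms(2) coprime_p_minus_1] by auto
  ultimately show ?thesis by simp
qed

lemma absv_root_of_unity: "w ^ m = 1 \<Longrightarrow> m > 0 \<Longrightarrow> absv (w::'k) = 1"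
  by (metis absv_1 absv_nonneg absv_power power_eq_1_iff not_gr_zero power_eq_iff_eq_base power_one zero_le_one)

lemma mem_ball_1: "x \<in> padic_ball p 1 1 \<longleftrightarrow> x \<in> Zp \<and> pcong 1 x 1"
  by (simp add: padic_ball_pball pball_def)

text \<open>Two candidates differ by a root of unity that is congruent to \<open>1\<close>.\<close>

lemma teichmueller_eqI:
  assumes x: "x \<in> Up" and w: "w \<in> Up" "w ^ (p - 1) = 1" "pcong 1 x w"
  shows "teichmueller p x = w"
  unfolding teichmueller_def
proof (rule the_equality)
  have "pcong 1 (w * (x / w)) (w * 1)" using w Up_nonzero[OF w(1)] by simp
  then have xw: "pcong 1 (x / w) 1" using w(1) by (simp only: pcong_unit_mult_iff)
  then show "w ^ (p - 1) = 1 \<and> x / w \<in> padic_ball p 1 1"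
    unfolding mem_ball_1 using w x Up_subset Up_divide by blast
  fix v assume v: "v ^ (p - 1) = 1 \<and> x / v \<in> padic_ball p 1 1"
  then have xv: "pcong 1 (x / v) 1" unfolding mem_ball_1 by blast
  have nz: "v \<noteq> 0" "w \<noteq> 0" "x \<noteq> 0"
    using v Up_nonzero[OF w(1)] Up_nonzero[OF x] p_gt_2 by (auto simp: power_0_left)
  have "pcong 1 (x / w) (x / v)" using xw xv pcong_sym pcong_trans by blast
  \<comment> \<open>the common factor turns the two quotients into \<open>v\<close> and \<open>w\<close>\<close>
  then have "pcong 1 (x / w * (v / x * w)) (x / v * (v / x * w))"
    using absv_root_of_unity[of v "p - 1"] v w(1) x p_gt_2
    by (intro pcong_mult) (auto simp: absv_mult absv_divide Up_iff)
  then have "pcong 1 v w" using nz by (simp add: field_simps)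
  then have "pcong 1 (w * (v / w)) (w * 1)" using nz by simp
  then have "pcong 1 (v / w) 1" using w(1) by (simp only: pcong_unit_mult_iff)
  moreover have "(v / w) ^ (p - 1) = 1" using v w by (simp add: power_divide)
  ultimately have "v / w = 1" using root_of_unity_pcong_1 by blast
  then show "v = w" using nz by simp
qed

lemma teichmueller:
  assumes "x \<in> Up"
  shows teichmueller_Up: "teichmueller p x \<in> Up"
    and teichmueller_power: "teichmueller p x ^ (p - 1) = 1"
    and pcong_teichmueller: "pcong 1 x (teichmueller p x)"
  using teichmueller_exists[OF assms] teichmueller_eqI[OF assms] by auto

lemma teichmueller_mult:
  assumes "x \<in> Up" "y \<in> Up"
  shows "teichmueller p (x * y) = teichmueller p x * teichmueller p y"
proof (rule teichmueller_eqI)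
  show "pcong 1 (x * y) (teichmueller p x * teichmueller p y)"
    using assms teichmueller[OF assms(1)] teichmueller[OF assms(2)]
    by (intro pcong_mult) (auto simp: Up_iff)
  show "(teichmueller p x * teichmueller p y) ^ (p - 1) = 1"
    unfolding power_mult_distrib by (simp only: teichmueller_power assms mult_1)
qed (use assms in \<open>auto simp: teichmueller_Up\<close>)

lemma teichmueller_pcong: "x \<in> Up \<Longrightarrow> y \<in> Up \<Longrightarrow> pcong 1 x y \<Longrightarrow> teichmueller p x = teichmueller p y"
  using teichmueller[of y] pcong_trans by (intro teichmueller_eqI) auto

lemma unit_part_pcong: "x \<in> Up \<Longrightarrow> pcong 1 (unit_part p x) 1"
proof -
  assume x: "x \<in> Up"
  note t = teichmueller[OF x]
  have "pcong 1 (teichmueller p x * unit_part p x) (teichmueller p x * 1)"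
    using t Up_nonzero[OF t(1)] by (simp add: unit_part_def)
  then show ?thesis using t(1) by (simp only: pcong_unit_mult_iff)
qed

lemma unit_part_mult: "x \<in> Up \<Longrightarrow> y \<in> Up \<Longrightarrow> unit_part p (x * y) = unit_part p x * unit_part p y"
  by (simp add: unit_part_def teichmueller_mult)

section \<open>Powers with p-adic exponents\<close>

lemma ucont_gbinomial: "ucont Zp (\<lambda>x. x gchoose k)"
proof -
  have "ucont Zp (\<lambda>x. (\<Prod>i = 0..<k. x + - of_nat i) * (1 / fact k))"
    by (intro ucont_mult ucont_prod ucont_add ucont_id ucont_const pdom_Zp)
  then show ?thesis by (simp add: gbinomial_prod_rev)
qed

text \<open>
  For natural \<open>s\<close> the binomial coefficient is an integer; natural numbers are dense.
\<close>

lemma absv_gbinomial: "s \<in> Zp \<Longrightarrow> absv (s gchoose k) \<le> 1"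
proof -
  assume s: "s \<in> Zp"
  obtain n where n: "\<forall>x\<in>Zp. \<forall>y\<in>Zp. pcong n x y \<longrightarrow> absv ((x gchoose k) - (y gchoose k)) < 1"
    using ucont_gbinomial[of k, unfolded ucont_def, rule_format, OF zero_less_one] by blast
  have "absv ((s gchoose k) - (of_nat (res n s) gchoose k)) \<le> 1"
    using n s of_nat_Zp pcong_res[OF s, of n] by (intro less_imp_le) blast
  moreover have "absv (of_nat (res n s) gchoose k :: 'k) \<le> 1"
    by (simp flip: binomial_gbinomial)
  ultimately show ?thesis
    using absv_add_le[of "(s gchoose k) - (of_nat (res n s) gchoose k)" 1 "of_nat (res n s) gchoose k"] by simp
qed

text \<open>
  A series with terms bounded by \<open>p\<^sup>-\<^sup>k\<close> converges, and its tails satisfy the same bound.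
\<close>

lemma absv_suminf:
  assumes a: "\<And>k. absv (a k :: 'k) \<le> 1 / real p ^ k"
  shows "absv (suminf a - (\<Sum>k<J. a k)) \<le> 1 / real p ^ J"
proof -
  have tail: "absv ((\<Sum>k<m. a k) - (\<Sum>k<n. a k)) \<le> 1 / real p ^ n" if "n \<le> m" for m n
  proof -
    have "(\<Sum>k<m. a k) - (\<Sum>k<n. a k) = (\<Sum>k\<in>{n..<m}. a k)"
      using that sum_diff_nat_ivl[of 0 n m a] by (simp add: atLeast0LessThan)
    also have "absv \<dots> \<le> 1 / real p ^ n"
      using a p_power_mono by (intro absv_sum_le) (auto intro: order_trans)
    finally show ?thesis .
  qed
  have "Cauchy (\<lambda>n. \<Sum>k<n. a k)"
  proof (rule metric_CauchyI)
    fix e :: real assume "e > 0"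
    then obtain N where N: "1 / real p ^ N < e" using small_p_power by blast
    have "dist (\<Sum>k<m. a k) (\<Sum>k<n. a k) < e" if "m \<ge> N" "n \<ge> N" for m n
    proof -
      have "absv ((\<Sum>k<m. a k) - (\<Sum>k<n. a k)) \<le> 1 / real p ^ N"
        using tail[OF that(1)] tail[OF that(2)] by (metis absv_minus_commute absv_trans_le)
      then show ?thesis using N by (simp add: dist_absv)
    qed
    then show "\<exists>M. \<forall>m\<ge>M. \<forall>n\<ge>M. dist (\<Sum>k<m. a k) (\<Sum>k<n. a k) < e" by blast
  qed
  then obtain L where L: "(\<lambda>n. \<Sum>k<n. a k) \<longlonglongrightarrow> L" using Cauchy_convergent convergent_def by blast
  then have "suminf a = L"
    by (intro sums_unique[symmetric]) (simp add: sums_def)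
  moreover have "(\<lambda>n. (\<Sum>k<n. a k) + - (\<Sum>k<J. a k)) \<longlonglongrightarrow> L + - (\<Sum>k<J. a k)"
    by (intro tendsto_add_absv L tendsto_const)
  then have "absv (L + - (\<Sum>k<J. a k)) \<le> 1 / real p ^ J"
    by (rule tendsto_absv_le[of _ _ J]) (use tail in auto)
  ultimately show ?thesis by simp
qed

lemma padic_power_term:
  assumes "pcong 1 u 1" "s \<in> Zp"
  shows "absv ((s gchoose k) * (u - 1) ^ k) \<le> 1 / real p ^ k"
proof -
  have "absv (s gchoose k) * absv ((u - 1) ^ k) \<le> 1 * (1 / real p) ^ k"
    unfolding absv_power using assms absv_gbinomial by (intro mult_mono power_mono) (auto simp: pcong_def)
  then show ?thesis by (simp add: absv_mult power_one_over)
qed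

lemma padic_power_of_nat: "padic_power u (of_nat n :: 'k) = u ^ n"
proof -
  have "(\<lambda>k. (of_nat n gchoose k) * (u - 1) ^ k) sums (\<Sum>k\<le>n. (of_nat n gchoose k) * (u - 1) ^ k)"
    by (rule sums_finite) (auto simp: not_le simp flip: binomial_gbinomial)
  then have "padic_power u (of_nat n) = (\<Sum>k\<le>n. (of_nat n gchoose k) * (u - 1) ^ k)"
    unfolding padic_power_def by (rule sums_unique[symmetric])
  also have "\<dots> = ((u - 1) + 1) ^ n"
    unfolding binomial_ring by (simp flip: binomial_gbinomial)
  finally show ?thesis by simp
qed

text \<open>
  The power with exponent \<open>s\<close> is a limit of powers with natural exponents, uniformly in the
  base. All properties of powers below are transferred from natural exponents by this lemma.
\<close>

lemma padic_power_approx: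
  assumes s: "s \<in> Zp" and e: "e > 0"
  obtains n where "absv (s - of_nat n) < e" "\<And>u. pcong 1 u 1 \<Longrightarrow> absv (padic_power u s - u ^ n) < e"
proof -
  obtain J where J: "1 / real p ^ J < e" using small_p_power e by blast
  have "\<exists>n. \<forall>x\<in>Zp. \<forall>y\<in>Zp. pcong n x y \<longrightarrow> absv ((x gchoose k) - (y gchoose k)) < e" for k
    using ucont_gbinomial e unfolding ucont_def by blast
  then obtain N where N: "\<And>k x y. x \<in> Zp \<Longrightarrow> y \<in> Zp \<Longrightarrow> pcong (N k) x y \<Longrightarrow> absv ((x gchoose k) - (y gchoose k)) < e"
    by metis
  define M where "M = Max (insert J (N ` {..<J}))"
  \<comment> \<open>level \<open>M\<close> controls both \<open>s\<close> and the first \<open>J\<close> binomial coefficients; the other terms are small\<close>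
  define n where "n = res M s"
  have M: "J \<le> M" "\<And>k. k < J \<Longrightarrow> N k \<le> M" unfolding M_def by auto
  have sn: "pcong M s (of_nat n)" unfolding n_def by (rule pcong_res[OF s])
  show ?thesis
  proof (rule that[of n])
    show "absv (s - of_nat n) < e" using pcong_mono[OF M(1) sn] J by (simp add: pcong_def)
    fix u assume u: "pcong 1 u 1"
    define a where "a t k = (t gchoose k) * (u - 1) ^ k" for t :: 'k and k
    have u1: "absv ((u - 1) ^ k) \<le> 1" for k
      using pcong_mono[OF _ u, of 0] by (intro absv_power_le_1) (simp add: pcong_def)
    have 1: "absv (padic_power u t - (\<Sum>k<J. a t k)) < e" if "t \<in> Zp" for t
      using absv_suminf[of "a t" J] padic_power_term[OF u that] J
      unfolding a_def padic_power_def by fastforce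
    have 2: "absv ((\<Sum>k<J. a s k) - (\<Sum>k<J. a (of_nat n) k)) < e"
    proof (cases "J = 0")
      case False
      define D where "D = Max ((\<lambda>k. absv (a s k - a (of_nat n) k)) ` {..<J})"
      have t: "absv (a s k - a (of_nat n) k) < e" if "k < J" for k
      proof -
        have "absv (a s k - a (of_nat n) k) = absv ((s gchoose k) - (of_nat n gchoose k)) * absv ((u - 1) ^ k)"
          unfolding a_def by (simp add: left_diff_distrib flip: absv_mult)
        also have "\<dots> \<le> absv ((s gchoose k) - (of_nat n gchoose k))"
          using u1 by (intro mult_left_le) auto
        also have "\<dots> < e" using N[OF s of_nat_Zp pcong_mono[OF M(2)[OF that] sn]] .
        finally show ?thesis .
      qed
      have "D \<in> (\<lambda>k. absv (a s k - a (of_nat n) k)) ` {..<J}"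
        unfolding D_def using False by (intro Max_in) auto
      then have "D < e" "D \<ge> 0" using t by auto
      moreover have "absv (\<Sum>k<J. a s k - a (of_nat n) k) \<le> D"
        using \<open>D \<ge> 0\<close> unfolding D_def by (intro absv_sum_le) auto
      ultimately show ?thesis by (simp add: sum_subtractf)
    qed (use e in simp)
    have "absv (padic_power u s - (\<Sum>k<J. a (of_nat n) k)) < e"
      using absv_trans_less[OF 1[OF s] 2] .
    moreover have "absv ((\<Sum>k<J. a (of_nat n) k) - padic_power u (of_nat n)) < e"
      using 1[of "of_nat n"] by (simp add: absv_minus_commute)
    ultimately have "absv (padic_power u s - padic_power u (of_nat n)) < e" by (rule absv_trans_less)
    then show "absv (padic_power u s - u ^ n) < e" by (simp add: padic_power_of_nat)
  qed
qed

lemma absv_le_if_close: "(\<And>e. e > 0 \<Longrightarrow> absv (x::'k) \<le> max e C) \<Longrightarrow> absv x \<le> max 0 C"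
proof (rule ccontr)
  assume *: "\<And>e. e > 0 \<Longrightarrow> absv x \<le> max e C" and n: "\<not> absv x \<le> max 0 C"
  then have "absv x / 2 > 0" by auto
  from *[OF this] n show False by auto
qed

lemma eq_if_close: "(\<And>e. e > 0 \<Longrightarrow> absv (x - y ::'k) < e) \<Longrightarrow> x = y"
  by (metis absv_pos_iff eq_iff_diff_eq_0 less_irrefl)

lemma absv_padic_power:
  assumes "pcong 1 u 1" "s \<in> Zp"
  shows "absv (padic_power u s) = 1"
proof -
  obtain n where "absv (padic_power u s - u ^ n) < 1"
    using padic_power_approx[OF assms(2) zero_less_one] assms(1) by metis
  moreover have "absv (u ^ n) = 1" by (simp add: absv_power pcong_1_absv[OF assms(1)])
  ultimately show ?thesis using absv_eqI[of "padic_power u s" "u ^ n"] by simp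
qed

lemma padic_power_1:
  assumes "s \<in> Zp"
  shows "padic_power 1 s = (1::'k)"
proof (rule eq_if_close)
  fix e :: real assume "e > 0"
  then obtain n where n: "\<And>u. pcong 1 u 1 \<Longrightarrow> absv (padic_power u s - u ^ n) < e"
    using padic_power_approx[OF assms] by metis
  show "absv (padic_power 1 s - 1) < e" using n[of 1] by simp
qed

lemma padic_power_mult:
  assumes "pcong 1 u 1" "pcong 1 v 1" "s \<in> Zp"
  shows "padic_power (u * v) s = padic_power u s * padic_power v s"
proof (rule eq_if_close)
  fix e :: real assume "e > 0"
  then obtain n where n: "\<And>u. pcong 1 u 1 \<Longrightarrow> absv (padic_power u s - u ^ n) < e"
    using padic_power_approx[OF assms(3)] by metis
  have uv: "pcong 1 (u * v) 1"
    using pcong_mult[of v 1 1 u 1] pcong_1_absv assms by simp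
  have "absv ((padic_power u s - u ^ n) * padic_power v s) < e"
    using n[OF assms(1)] absv_padic_power[OF assms(2,3)] by (simp add: absv_mult)
  moreover have "absv (u ^ n * (padic_power v s - v ^ n)) < e"
    using n[OF assms(2)] pcong_1_absv[OF assms(1)] by (simp add: absv_mult absv_power)
  ultimately have "absv ((padic_power u s - u ^ n) * padic_power v s + u ^ n * (padic_power v s - v ^ n)) < e"
    by (rule absv_add_less)
  then have "absv (padic_power u s * padic_power v s - (u * v) ^ n) < e"
    by (simp add: algebra_simps power_mult_distrib)
  then have "absv ((u * v) ^ n - padic_power u s * padic_power v s) < e"
    by (simp add: absv_minus_commute)
  then show "absv (padic_power (u * v) s - padic_power u s * padic_power v s) < e"
    using absv_trans_less[OF n[OF uv]] by blast
qed

lemma padic_power_lipschitz: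
  assumes "pcong 1 u 1" "pcong 1 v 1" "s \<in> Zp"
  shows "absv (padic_power u s - padic_power v s) \<le> absv (u - v)"
proof -
  have "absv (padic_power u s - padic_power v s) \<le> max 0 (absv (u - v))"
  proof (rule absv_le_if_close)
    fix e :: real assume "e > 0"
    then obtain n where n: "\<And>u. pcong 1 u 1 \<Longrightarrow> absv (padic_power u s - u ^ n) < e"
      using padic_power_approx[OF assms(3)] by metis
    have "absv (u ^ n - v ^ n) \<le> absv (u - v)"
      using assms pcong_1_absv by (intro absv_power_diff_le) auto
    then have 1: "absv (padic_power u s - v ^ n) \<le> max e (absv (u - v))"
      using n[OF assms(1)] by (intro absv_trans_le[of "padic_power u s" "u ^ n" _ "v ^ n"]) auto
    have "absv (v ^ n - padic_power v s) \<le> max e (absv (u - v))"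
      using n[OF assms(2)] by (simp add: absv_minus_commute)
    with 1 show "absv (padic_power u s - padic_power v s) \<le> max e (absv (u - v))"
      by (rule absv_trans_le)
  qed
  then show ?thesis by simp
qed

section \<open>Mellin branches\<close>

text \<open>
  The character \<open>\<omega>(x)\<^sup>j \<langle>x\<rangle>\<^sup>s\<close> that is integrated by the Mellin branch.
\<close>

definition mellin_char :: "int \<Rightarrow> 'k \<Rightarrow> 'k \<Rightarrow> 'k" where
  "mellin_char j s x = teichmueller p x powi j * padic_power (unit_part p x) s"

lemma mellin_eq: "mellin p \<rho> j s = padic_integral p Up \<rho> (mellin_char j s)"
  by (simp add: mellin_def mellin_char_def[abs_def])

lemma mellin_char_mult: "s \<in> Zp \<Longrightarrow> x \<in> Up \<Longrightarrow> y \<in> Up \<Longrightarrow> mellin_char j s (x * y) = mellin_char j s x * mellin_char j s y"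
  using padic_power_mult[OF unit_part_pcong unit_part_pcong, of x y s]
  by (simp add: mellin_char_def teichmueller_mult unit_part_mult power_int_mult_distrib)

lemma absv_powi: "absv w = 1 \<Longrightarrow> absv (w powi j :: 'k) = 1"
  by (simp add: power_int_def absv_power absv_inverse)

lemma mellin_char_1: "s \<in> Zp \<Longrightarrow> mellin_char j s 1 = 1"
proof -
  assume s: "s \<in> Zp"
  have "teichmueller p 1 = (1::'k)" by (rule teichmueller_eqI) auto
  then show ?thesis using s by (simp add: mellin_char_def unit_part_def padic_power_1)
qed

lemma mellin_char_lipschitz:
  assumes "s \<in> Zp" "x \<in> Up" "y \<in> Up" "pcong 1 x y"
  shows "absv (mellin_char j s x - mellin_char j s y) \<le> absv (x - y)"
proof -
  define w where "w = teichmueller p x"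
  have w: "w = teichmueller p y" "w \<in> Up"
    unfolding w_def using teichmueller_pcong[OF assms(2-4)] teichmueller_Up[OF assms(2)] by auto
  then have aw: "absv w = 1" by (simp add: Up_iff)
  have "mellin_char j s x - mellin_char j s y = w powi j * (padic_power (x / w) s - padic_power (y / w) s)"
    unfolding mellin_char_def unit_part_def w_def[symmetric] w(1)[symmetric] by (simp add: right_diff_distrib)
  then have "absv (mellin_char j s x - mellin_char j s y) = absv (padic_power (x / w) s - padic_power (y / w) s)"
    using aw by (simp add: absv_mult absv_powi)
  also have "\<dots> \<le> absv (x / w - y / w)"
    using unit_part_pcong[OF assms(2)] unit_part_pcong[OF assms(3)] assms(1)
    unfolding unit_part_def w_def[symmetric] w(1)[symmetric] by (intro padic_power_lipschitz)
  also have "\<dots> = absv (x - y)"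
    using aw by (simp add: absv_divide flip: diff_divide_distrib)
  finally show ?thesis .
qed

lemma ucont_mellin_char: "s \<in> Zp \<Longrightarrow> ucont Up (mellin_char j s)"
  by (rule ucont_lipschitz[of 1]) (auto simp: mellin_char_lipschitz)

lemma tendsto_mult_absv:
  assumes "f \<longlonglongrightarrow> (a::'k)" "g \<longlonglongrightarrow> b"
  shows "(\<lambda>n. f n * g n) \<longlonglongrightarrow> a * b"
  unfolding tendsto_absv_iff
proof (intro allI impI)
  fix e :: real assume e: "e > 0"
  define A where "A = max 1 (absv a)"
  define B where "B = max 1 (absv b)"
  have AB: "A \<ge> 1" "B \<ge> 1" "absv a \<le> A" "absv b \<le> B" by (auto simp: A_def B_def)
  have "min 1 (e / B) > 0" "e / A > 0" using e AB by auto
  then obtain N M where *: "\<And>n. n \<ge> N \<Longrightarrow> absv (g n - b) < min 1 (e / A)"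
    "\<And>n. n \<ge> M \<Longrightarrow> absv (f n - a) < e / B"
    using assms AB unfolding tendsto_absv_iff by (metis min_less_iff_conj zero_less_one)
  have "absv (f n * g n - a * b) < e" if n: "n \<ge> max N M" for n
  proof -
    have "absv (g n) \<le> B"
      using absv_add_le[of "g n - b" B b] *(1)[of n] n AB by simp
    then have "absv (f n - a) * absv (g n) \<le> absv (f n - a) * B"
      by (intro mult_left_mono) auto
    also have "\<dots> < e / B * B" using *(2)[of n] n AB by (intro mult_strict_right_mono) auto
    finally have 1: "absv ((f n - a) * g n) < e" using AB by (simp add: absv_mult)
    have "absv a * absv (g n - b) \<le> A * absv (g n - b)"
      using AB by (intro mult_right_mono) auto
    also have "\<dots> < A * (e / A)" using *(1)[of n] n AB by (intro mult_strict_left_mono) auto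
    finally have 2: "absv (a * (g n - b)) < e" using AB by (simp add: absv_mult)
    show ?thesis using absv_add_less[OF 1 2] by (simp add: algebra_simps)
  qed
  then show "\<exists>N. \<forall>n\<ge>N. absv (f n * g n - a * b) < e" by blast
qed

text \<open>
  The Riemann sum of the convolution has \<open>f\<close> at the residue of \<open>a b\<close> where the product of the
  Riemann sums has \<open>f a * f b = f (a b)\<close>; the difference tends to \<open>0\<close> by uniform continuity.
\<close>

lemma integral_conv_character:
  assumes "bounded_measure Up \<mu>" "bounded_measure Up \<nu>" "ucont Up f"
    and f: "\<And>x y. x \<in> Up \<Longrightarrow> y \<in> Up \<Longrightarrow> f (x * y) = f x * f y"
  shows "padic_integral p Up (\<mu> \<star> \<nu>) f = padic_integral p Up \<mu> f * padic_integral p Up \<nu> f"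
proof (rule padic_integralI[OF pdom_Up])
  obtain B where B: "B > 0" "\<And>U. absv (\<mu> U) \<le> B" using bm_bound[OF assms(1)] by blast
  obtain C where C: "C > 0" "\<And>U. absv (\<nu> U) \<le> C" using bm_bound[OF assms(2)] by blast
  have lim: "(\<lambda>n. riemann Up n \<mu> f * riemann Up n \<nu> f) \<longlonglongrightarrow> padic_integral p Up \<mu> f * padic_integral p Up \<nu> f"
    by (intro tendsto_mult_absv integral_tendsto assms pdom_Up)
  show "(\<lambda>n. riemann Up n (\<mu> \<star> \<nu>) f) \<longlonglongrightarrow>
    padic_integral p Up \<mu> f * padic_integral p Up \<nu> f"
  proof (rule tendsto_absv_transform[OF lim])
    fix e :: real assume e: "e > 0"
    define d where "d = e / (2 * (B * C))"
    have "d > 0" using e B C by (simp add: d_def)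
    then obtain m where m: "m \<ge> 1" "\<And>x y. x \<in> Up \<Longrightarrow> y \<in> Up \<Longrightarrow> pcong m x y \<Longrightarrow> absv (f x - f y) < d"
      by (rule ucontE[OF assms(3)]) blast
    have "absv (riemann Up n (\<mu> \<star> \<nu>) f - riemann Up n \<mu> f * riemann Up n \<nu> f) < e"
      if "n \<ge> m" for n
    proof -
      have n: "n \<ge> 1" using that m by simp
      have "riemann Up n \<mu> f * riemann Up n \<nu> f = (\<Sum>a\<in>reps Up n. \<Sum>b\<in>reps Up n.
        f (of_nat a * of_nat b) * (\<mu> (pball n (of_nat a)) * \<nu> (pball n (of_nat b))))"
        unfolding riemann_def sum_product using reps_mem by (intro sum.cong refl) (simp add: f)
      then have "riemann Up n (\<mu> \<star> \<nu>) f - riemann Up n \<mu> f * riemann Up n \<nu> f =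
        (\<Sum>a\<in>reps Up n. \<Sum>b\<in>reps Up n. (f (of_nat (res n (of_nat a * of_nat b))) - f (of_nat a * of_nat b))
          * (\<mu> (pball n (of_nat a)) * \<nu> (pball n (of_nat b))))"
        by (simp add: conv_riemann[OF assms(1,2) n] sum_subtractf left_diff_distrib)
      also have "absv \<dots> \<le> d * (B * C)"
      proof (intro absv_sum_le)
        fix a b assume ab: "a \<in> reps Up n" "b \<in> reps Up n"
        then have U: "of_nat a * of_nat b \<in> Up" using reps_mem by simp
        then have Z: "of_nat a * of_nat b \<in> Zp" using Up_subset by blast
        have "pcong m (of_nat (res n (of_nat a * of_nat b))) (of_nat a * of_nat b)"
          using pcong_mono[OF that pcong_res[OF Z]] pcong_sym by blast
        then have "absv (f (of_nat (res n (of_nat a * of_nat b))) - f (of_nat a * of_nat b)) \<le> d"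
          using m(2)[OF pdom_res[OF pdom_Up U n] U] by simp
        moreover have "absv (\<mu> (pball n (of_nat a)) * \<nu> (pball n (of_nat b))) \<le> B * C"
          unfolding absv_mult using B C by (intro mult_mono) auto
        ultimately show "absv ((f (of_nat (res n (of_nat a * of_nat b))) - f (of_nat a * of_nat b))
          * (\<mu> (pball n (of_nat a)) * \<nu> (pball n (of_nat b)))) \<le> d * (B * C)"
          unfolding absv_mult[of "_ - _"] using \<open>d > 0\<close> by (intro mult_mono) auto
      qed (use \<open>d > 0\<close> B C in auto)
      also have "\<dots> < e" using e B C by (simp add: d_def)
      finally show ?thesis .
    qed
    then show "\<exists>N. \<forall>n\<ge>N. absv (riemann Up n (\<mu> \<star> \<nu>) f -
      riemann Up n \<mu> f * riemann Up n \<nu> f) < e" by blast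
  qed
qed

lemma mellin_conv:
  "bounded_measure Up \<mu> \<Longrightarrow> bounded_measure Up \<nu> \<Longrightarrow> s \<in> Zp \<Longrightarrow>
    mellin p (\<mu> \<star> \<nu>) j s = mellin p \<mu> j s * mellin p \<nu> j s"
  unfolding mellin_eq by (rule integral_conv_character) (auto intro: ucont_mellin_char mellin_char_mult)

lemma mellin_regulariser:
  "of_nat c \<in> Up \<Longrightarrow> s \<in> Zp \<Longrightarrow> mellin p (regulariser c) j s = 1 - of_nat c * mellin_char j s (of_nat c)"
  unfolding mellin_eq by (simp add: integral_regulariser ucont_mellin_char mellin_char_1)

lemma sum_below_p:
  obtains k where "p = 2 * k + 1" "(\<Sum>i<p. i) = p * k"
proof -
  obtain q where q: "p = Suc q" using p_pos(1) by (cases p) auto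
  then have "even q" using odd_p by simp
  then obtain k where k: "q = 2 * k" by (rule evenE)
  have "(\<Sum>i<p. i) = \<Sum>{0..q}"
    unfolding q lessThan_Suc_atMost atMost_atLeast0 ..
  also have "\<dots> = p * k"
    unfolding gauss_sum_nat by (simp add: q k)
  finally show ?thesis using that[of k] q k by simp
qed

text \<open>
  Modulo \<open>p\<^sup>2\<close> the power \<open>u\<^sup>i\<close> is \<open>1 + i t\<close> with \<open>t = u - 1\<close>. The sum is then \<open>p + t p (p - 1) /
  2\<close>, which is congruent to \<open>p\<close> because \<open>p\<close> is odd.
\<close>

lemma absv_geometric_sum_p:
  assumes "pcong 1 u 1"
  shows "absv (\<Sum>i<p. u ^ i) = 1 / real p"
proof -
  define t where "t = u - 1"
  have t: "absv t \<le> 1 / real p" using assms by (simp add: t_def pcong_def)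
  have tt: "absv (t * t) \<le> 1 / real p ^ 2"
    using mult_mono[OF t t] by (simp add: absv_mult power2_eq_square)
  have u1: "absv u \<le> 1" using pcong_1_absv[OF assms] by simp
  have i: "pcong 2 (u ^ i) (1 + of_nat i * t)" for i
  proof (induction i)
    case (Suc i)
    have "pcong 2 (u * u ^ i) (u * (1 + of_nat i * t))" using u1 Suc by (rule pcong_scale)
    moreover have "pcong 2 (u * (1 + of_nat i * t)) (1 + of_nat (Suc i) * t)"
    proof -
      have "u * (1 + of_nat i * t) - (1 + of_nat (Suc i) * t) = of_nat i * (t * t)"
        by (simp add: t_def algebra_simps)
      moreover have "absv (of_nat i * (t * t)) \<le> 1 * (1 / real p ^ 2)"
        using tt unfolding absv_mult[of "of_nat i"] by (intro mult_mono) auto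
      ultimately show ?thesis by (simp add: pcong_def)
    qed
    ultimately show ?case using pcong_trans by auto
  qed simp
  obtain k where k: "p = 2 * k + 1" "(\<Sum>i<p. i) = p * k" by (rule sum_below_p)
  have s: "(\<Sum>i<p. 1 + of_nat i * t) = of_nat p + of_nat p * (of_nat k * t)"
    using k(2) by (simp add: sum.distrib flip: sum_distrib_right of_nat_sum)
  have "absv (of_nat k * t) \<le> 1 * (1 / real p)"
    unfolding absv_mult using t by (intro mult_mono) auto
  then have "absv (of_nat p * (of_nat k * t)) \<le> 1 / real p * (1 / real p)"
    unfolding absv_mult[of "of_nat p"] absv_p by (intro mult_left_mono) auto
  then have "pcong 2 (\<Sum>i<p. 1 + of_nat i * t) (of_nat p)"
    unfolding s by (simp add: pcong_def power2_eq_square)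
  then have "pcong 2 (\<Sum>i<p. u ^ i) (of_nat p)"
    using pcong_sum[of "{..<p}" 2 "\<lambda>i. u ^ i" "\<lambda>i. 1 + of_nat i * t", OF i] pcong_trans by blast
  then have "absv ((\<Sum>i<p. u ^ i) - of_nat p) \<le> 1 / real p ^ 2" by (simp add: pcong_def)
  also have "\<dots> < absv (of_nat p :: 'k)" using p_gt_2 by (simp add: absv_p power2_eq_square divide_simps)
  finally show ?thesis using absv_eqI absv_p by metis
qed

text \<open>
  The power \<open>u\<^sup>m - 1\<close> is \<open>u - 1\<close> times a geometric sum, which is a unit if \<open>m\<close> is prime to \<open>p\<close>
  and has absolute value \<open>1 / p\<close> if \<open>m = p\<close>; the general case follows by splitting off factors
  \<open>p\<close>.
\<close>

lemma lifting_the_exponent: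
  assumes "pcong 1 u 1"
  shows "absv (u ^ m - 1) = absv (u - 1) * absv (of_nat m :: 'k)"
proof (induction m rule: less_induct)
  case (less m)
  show ?case
  proof (cases "p dvd m")
    case True
    then obtain k where k: "m = p * k" by blast
    show ?thesis
    proof (cases "m = 0")
      case False
      then have "k < m" "k > 0" using k p_gt_2 by auto
      define v where "v = u ^ k"
      have v: "pcong 1 v 1" unfolding v_def using pcong_power[of u 1 1 k] assms pcong_1_absv[OF assms] by simp
      have "u ^ m - 1 = (v - 1) * (\<Sum>i<p. v ^ i)"
        unfolding v_def k power_diff_1_eq[symmetric] by (simp add: mult.commute flip: power_mult)
      then have "absv (u ^ m - 1) = absv (u - 1) * absv (of_nat k :: 'k) * (1 / real p)"
        using less[OF \<open>k < m\<close>] absv_geometric_sum_p[OF v] by (simp add: absv_mult v_def)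
      then show ?thesis by (simp add: k absv_mult absv_p)
    qed simp
  next
    case False
    then have "coprime m p" using prime_imp_coprime[OF prime_p, of m] coprime_commute by blast
    then show ?thesis
      using geometric_sum_coprime[OF assms, of m] absv_of_nat_coprime[of m]
      by (simp add: power_diff_1_eq absv_mult)
  qed
qed

lemma padic_power_minus_1:
  assumes "pcong 1 u 1"
  shows "u * padic_power u (-1) = 1"
proof (rule eq_if_close)
  fix e :: real assume e: "e > 0"
  have "(-1::'k) \<in> Zp" by simp
  then obtain n where n: "absv (- 1 - of_nat n :: 'k) < e" "absv (padic_power u (-1) - u ^ n) < e"
    using padic_power_approx[OF _ e] assms by metis
  have u: "absv u = 1" by (rule pcong_1_absv[OF assms])
  have "absv (u * padic_power u (-1) - u ^ Suc n) = absv (u * (padic_power u (-1) - u ^ n))"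
    by (simp add: algebra_simps)
  also have "\<dots> < e" using n(2) u by (simp add: absv_mult)
  finally have 1: "absv (u * padic_power u (-1) - u ^ Suc n) < e" .
  have "- 1 - of_nat n = - (of_nat (Suc n) :: 'k)" by simp
  then have "absv (of_nat (Suc n) :: 'k) < e" using n(1) by (metis absv_minus)
  moreover have "absv (u - 1) \<le> 1"
    using absv_diff_le[of u 1 1] u by simp
  then have "absv (u - 1) * absv (of_nat (Suc n) :: 'k) \<le> absv (of_nat (Suc n) :: 'k)"
    by (intro mult_left_le_one_le) auto
  ultimately have "absv (u ^ Suc n - 1) < e"
    unfolding lifting_the_exponent[OF assms] by linarith
  then show "absv (u * padic_power u (-1) - 1) < e" using 1 absv_trans_less by blast
qed

text \<open>
  For \<open>c = 1 + 2p\<close> the root of unity \<open>\<omega>(c)\<close> is \<open>1\<close>, and \<open>c\<^sup>s\<^sup>+\<^sup>1 - 1\<close> has absolute value \<open>|s +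
  1| / p\<close>, by approximating \<open>s\<close> by natural numbers.
\<close>

lemma mellin_regulariser_nonzero_generic:
  assumes s: "s \<in> Zp" "s \<noteq> -1"
  shows "\<exists>c. admissible p c \<and> mellin p (regulariser c) j s \<noteq> (0::'k)"
proof -
  define c where "c = 2 * p + 1"
  define u where "u = (of_nat c :: 'k)"
  have adm: "admissible p c"
  proof -
    have "coprime c p"
      unfolding c_def by (rule coprimeI) (metis dvd_add_right_iff dvd_mult)
    then show ?thesis using p_gt_2 by (simp add: admissible_def c_def)
  qed
  have cU: "u \<in> Up" unfolding u_def by (rule admissible_Up[OF adm])
  have c1: "pcong 1 u 1"
    unfolding u_def c_def pcong_def using absv_p absv_of_nat_coprime[of 2] odd_p by (simp add: absv_mult)
  have a1: "absv (u - 1) = 1 / real p"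
    unfolding u_def c_def using absv_p absv_of_nat_coprime[of 2] odd_p by (simp add: absv_mult)
  have "teichmueller p u = 1" by (rule teichmueller_eqI[OF cU]) (use c1 in auto)
  then have mellin_char: "mellin_char j s u = padic_power u s" by (simp add: mellin_char_def unit_part_def)
  define d where "d = absv (s + 1) / real p"
  have "s + 1 \<noteq> 0" using s(2) by (simp add: add_eq_0_iff2)
  then have d: "d > 0" unfolding d_def by simp
  obtain n where n: "absv (s - of_nat n) < d" "absv (padic_power u s - u ^ n) < d"
    using padic_power_approx[OF s(1) d] c1 by metis
  have "d < absv (s + 1)" using \<open>s + 1 \<noteq> 0\<close> p_gt_2 by (simp add: d_def divide_simps)
  then have "absv (of_nat (Suc n) - (s + 1)) < absv (s + 1)"
    using n(1) by (simp add: absv_minus_commute)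
  then have "absv (of_nat (Suc n) :: 'k) = absv (s + 1)" by (rule absv_eqI)
  then have d': "absv (u ^ Suc n - 1) = d"
    unfolding lifting_the_exponent[OF c1] a1 d_def by simp
  have "absv (u * padic_power u s - u ^ Suc n) = absv (u * (padic_power u s - u ^ n))"
    by (simp add: algebra_simps)
  also have "\<dots> < d" using n(2) pcong_1_absv[OF c1] by (simp add: absv_mult)
  finally have "absv ((u * padic_power u s - 1) - (u ^ Suc n - 1)) < absv (u ^ Suc n - 1)"
    unfolding d' by simp
  then have "absv (u * padic_power u s - 1) = d" using absv_eqI d' by blast
  then have "1 - u * padic_power u s \<noteq> 0" using d by auto
  then have "mellin p (regulariser c) j s \<noteq> (0::'k)"
    using mellin_regulariser[OF _ s(1), of c] cU mellin_char by (simp add: u_def)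
  then show ?thesis using adm by blast
qed

text \<open>
  At \<open>s = -1\<close> the value is \<open>1 - \<omega>(c)\<^sup>j\<^sup>+\<^sup>1\<close>, and \<open>\<omega>(c)\<close> has exact order \<open>p - 1\<close> if \<open>c\<close> is a
  primitive root.
\<close>

lemma mellin_regulariser_nonzero_at_minus_1:
  assumes "j mod (int p - 1) \<noteq> (- 1) mod (int p - 1)"
  shows "\<exists>c. admissible p c \<and> mellin p (regulariser c) j (- 1) \<noteq> (0::'k)"
proof -
  obtain g where "residue_primroot p g" 
    using prime_primitive_root_exists[OF _ prime_p] p_gt_2 by auto
  then have g: "coprime p g" "ord p g = p - 1"
    using prime_p by (auto simp: residue_primroot_def totient_prime)
  \<comment> \<open>the summand makes \<open>c\<close> odd and greater than \<open>1\<close>\<close>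
  define c where "c = (if odd g then g + 2 * p else g + p)"
  have cg': "[c = g] (mod p)" by (auto simp: c_def cong_def)
  have "coprime c p" using g(1) cg' by (metis cong_imp_coprime cong_sym coprime_commute)
  then have adm: "admissible p c" using p_gt_2 odd_p by (auto simp: admissible_def c_def)
  have ord: "ord p c = p - 1" using ord_cong[OF cg'] g by simp
  define u where "u = (of_nat c :: 'k)"
  have cU: "u \<in> Up" unfolding u_def by (rule admissible_Up[OF adm])
  define w where "w = teichmueller p u"
  have w: "w \<in> Up" "w ^ (p - 1) = 1" "pcong 1 u w" unfolding w_def by (rule teichmueller[OF cU])+
  have w0: "w \<noteq> 0" using Up_nonzero[OF w(1)] .
  have "unit_part p u * padic_power (unit_part p u) (-1) = 1"
    by (rule padic_power_minus_1[OF unit_part_pcong[OF cU]])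
  then have "u * padic_power (unit_part p u) (-1) = w"
    unfolding unit_part_def w_def[symmetric] using w0 by (simp add: field_simps)
  then have "u * mellin_char j (-1) u = w powi j * w" unfolding mellin_char_def w_def[symmetric]
    by (simp add: mult.left_commute)
  also have "\<dots> = w powi (j + 1)" using w0 by (simp add: power_int_add_1)
  finally have mellin_char: "u * mellin_char j (-1) u = w powi (j + 1)" .
  \<comment> \<open>\<open>\<omega>(c)\<close> has order \<open>p - 1\<close>, so the exponent may be reduced to a natural number\<close>
  define m where "m = nat ((j + 1) mod (int p - 1))"
  have m: "int m = (j + 1) mod (int p - 1)" unfolding m_def using p_gt_2 by simp
  have "(j + 1) mod (int p - 1) \<noteq> 0"
  proof
    assume "(j + 1) mod (int p - 1) = 0"
    then have "(int p - 1) dvd (j - (-1))" by (simp add: mod_eq_0_iff_dvd)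
    then show False using assms by (simp add: mod_eq_dvd_iff)
  qed
  then have m0: "m > 0" using m by simp
  have mp: "m < p - 1"
    using m pos_mod_bound[of "int p - 1" "j + 1"] p_gt_2 by linarith
  have "j + 1 = (int p - 1) * ((j + 1) div (int p - 1)) + int m" using m by simp
  then have "w powi (j + 1) = w powi ((int p - 1) * ((j + 1) div (int p - 1))) * w powi (int m)"
    using power_int_add[of w] w0 by metis
  moreover have "w powi ((int p - 1) * k) = 1" for k
  proof -
    have "w powi (int (p - 1)) = 1" using w(2) by (simp only: power_int_of_nat)
    moreover have "int p - 1 = int (p - 1)" using p_gt_2 by simp
    ultimately show ?thesis by (simp only: power_int_mult power_int_1_left)
  qed
  ultimately have wm: "w powi (j + 1) = w ^ m" by simp
  have "w ^ m \<noteq> 1"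
  proof
    assume "w ^ m = 1"
    then have "pcong 1 (u ^ m) 1"
      using pcong_power[of u w 1 m] w cU by (simp add: Up_iff)
    then have "[c ^ m = 1] (mod p)" using pcong_of_nat[of 1 "c ^ m" 1] by (simp add: u_def)
    then have "p - 1 dvd m" using ord ord_divides by metis
    then show False using m0 mp by (auto dest: dvd_imp_le)
  qed
  then have "mellin p (regulariser c) j (- 1) \<noteq> (0::'k)"
    using mellin_regulariser[of c "-1" j] cU mellin_char wm by (simp add: u_def)
  then show ?thesis using adm by blast
qed

lemma mellin_regulariser_nonzero:
  assumes "s \<in> Zp" "\<not> (j mod (int p - 1) = (- 1) mod (int p - 1) \<and> s = - 1)"
  shows "\<exists>c. admissible p c \<and> mellin p (regulariser c) j s \<noteq> (0::'k)"
  using assms mellin_regulariser_nonzero_generic mellin_regulariser_nonzero_at_minus_1 by metis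

text \<open>
  Two representatives satisfy \<open>A t = B r\<close>, and the Mellin branch is multiplicative, so all
  quotients with nonzero denominator agree. The auxiliary factor of the localization has to be
  cancelled before this step, because its Mellin branch may vanish at \<open>s\<close>.
\<close>

lemma mellin_loc_frac:
  assumes A: "bounded_measure Up A" and r: "r \<in> reg_set p" and s: "s \<in> Zp" and nz: "mellin p r j s \<noteq> 0"
  shows "mellin_loc p (iwasawa_frac p A r) j s = mellin p A j s / mellin p r j s"
  unfolding mellin_loc_def
proof (rule the_equality)
  interpret ring_mult_monoid IW by (intro ring_mult_monoid.intro comm_monoid_IW)
  have mem: "(B, t) \<in> iwasawa_frac p A r \<longleftrightarrow>
    A \<in> carrier IW \<and> r \<in> reg_set p \<and> B \<in> carrier IW \<and> t \<in> reg_set p \<and> A \<otimes>\<^bsub>IW\<^esub> t = B \<otimes>\<^bsub>IW\<^esub> r" for B t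
    unfolding iwasawa_frac_def loc_frac_def by (simp add: iwasawa_rel_iff)
  show "\<exists>B t. (B, t) \<in> iwasawa_frac p A r \<and> mellin p t j s \<noteq> 0 \<and>
    mellin p A j s / mellin p r j s = mellin p B j s / mellin p t j s"
    using A r nz by (intro exI[of _ A] exI[of _ r]) (simp add: mem)
  fix v assume "\<exists>B t. (B, t) \<in> iwasawa_frac p A r \<and> mellin p t j s \<noteq> 0 \<and>
    v = mellin p B j s / mellin p t j s"
  then obtain B t where *: "bounded_measure Up B" "t \<in> reg_set p" "A \<otimes>\<^bsub>IW\<^esub> t = B \<otimes>\<^bsub>IW\<^esub> r"
    "mellin p t j s \<noteq> 0" "v = mellin p B j s / mellin p t j s"
    unfolding mem by auto
  have "bounded_measure Up r" "bounded_measure Up t" using r *(2) reg_set_carrier by auto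
  then have "mellin p A j s * mellin p t j s = mellin p B j s * mellin p r j s"
    using *(3) by (simp add: mult_IW mellin_conv[symmetric] A * s)
  then show "v = mellin p A j s / mellin p r j s" unfolding *(5) using *(4) nz by (simp add: frac_eq_eq)
qed

section \<open>Measures from masses of balls\<close>

lemma level_Zp_pball: "x \<in> Zp \<Longrightarrow> level Zp n (pball n x)"
  unfolding level_def pball_def using pcong_sym pcong_trans by blast

text \<open>
  The mass of a union of residue classes modulo \<open>p\<^sup>n\<close> is the sum of the masses of these classes;
  compatibility makes this independent of \<open>n\<close>.
\<close>

lemma measure_from_balls:
  fixes m :: "nat \<Rightarrow> 'k \<Rightarrow> 'k"
  assumes m_cong: "\<And>n x y. x \<in> Zp \<Longrightarrow> y \<in> Zp \<Longrightarrow> pcong n x y \<Longrightarrow> m n x = m n y"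
    and compat: "\<And>n x. x \<in> Zp \<Longrightarrow>
      (\<Sum>b | b < p ^ Suc n \<and> pcong n (of_nat b) x. m (Suc n) (of_nat b)) = m n x"
  shows "\<exists>\<mu>. fin_add Zp \<mu> \<and> (\<forall>U. \<not> clopen_in Zp U \<longrightarrow> \<mu> U = 0) \<and>
    (\<forall>n. \<forall>x\<in>Zp. \<mu> (pball n x) = m n x)"
proof -
  define S where "S n U = (\<Sum>a | a < p ^ n \<and> of_nat a \<in> U. m n (of_nat a))" for n and U :: "'k set"
  define \<mu> where "\<mu> U = (if clopen_in Zp U then S (LEAST n. level Zp n U) U else 0)" for U
  have step: "S (Suc n) U = S n U" if l: "level Zp n U" for n U
  proof -
    have "S n U = (\<Sum>a | a < p ^ n \<and> of_nat a \<in> U.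
        \<Sum>b | b \<in> {b. b < p ^ Suc n \<and> of_nat b \<in> U} \<and> res n (of_nat b) = a. m (Suc n) (of_nat b))"
      unfolding S_def
    proof (rule sum.cong[OF refl])
      fix a assume a: "a \<in> {a. a < p ^ n \<and> of_nat a \<in> U}"
      have iff: "pcong n (of_nat b) (of_nat a) \<longleftrightarrow> of_nat b \<in> U \<and> res n (of_nat b) = a" for b
        using a l res_of_nat[of a n] res_eq_iff[of "of_nat b" "of_nat a" n] pcong_sym
        unfolding level_def by auto
      have "m n (of_nat a) = (\<Sum>b | b < p ^ Suc n \<and> pcong n (of_nat b) (of_nat a). m (Suc n) (of_nat b))"
        by (rule compat[symmetric]) simp
      then show "m n (of_nat a) = (\<Sum>b | b \<in> {b. b < p ^ Suc n \<and> of_nat b \<in> U} \<and> res n (of_nat b) = a.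
          m (Suc n) (of_nat b))"
        unfolding iff by (simp add: conj_assoc)
    qed
    also have "\<dots> = (\<Sum>b | b < p ^ Suc n \<and> of_nat b \<in> U. m (Suc n) (of_nat b))"
    proof (rule sum.group)
      show "(\<lambda>b. res n (of_nat b)) ` {b. b < p ^ Suc n \<and> of_nat b \<in> U} \<subseteq> {a. a < p ^ n \<and> of_nat a \<in> U}"
        using l pcong_res[of _ n] res_less[of _ n] unfolding level_def by auto
    qed auto
    finally show ?thesis unfolding S_def by simp
  qed
  have S_eq: "S (n + k) U = S n U" if "level Zp n U" for n k U
  proof (induction k)
    case (Suc k)
    then show ?case using step[OF level_mono[OF that, of "n + k"]] by simp
  qed simp
  have \<mu>_eq: "\<mu> U = S n U" if l: "level Zp n U" for n U
  proof -
    define k where "k = (LEAST n. level Zp n U)"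
    have "level Zp k U" "k \<le> n" unfolding k_def using LeastI[of "\<lambda>n. level Zp n U", OF l] Least_le[of "\<lambda>n. level Zp n U", OF l] by auto
    then have "S n U = S k U" using S_eq[of k U "n - k"] by simp
    then show ?thesis unfolding \<mu>_def k_def[symmetric] using level_clopen[OF pdom_Zp l] by simp
  qed
  show ?thesis
  proof (intro exI[of _ \<mu>] conjI allI impI ballI)
    show "fin_add Zp \<mu>"
      unfolding fin_add_def
    proof (intro allI impI)
      fix U V assume UV: "clopen_in Zp U \<and> clopen_in Zp V \<and> U \<inter> V = {}"
      then obtain n k where "level Zp n U" "level Zp k V" by (auto simp: clopen_iff)
      then have l: "level Zp (max n k) U" "level Zp (max n k) V"
        using level_mono[of Zp n U "max n k"] level_mono[of Zp k V "max n k"] by auto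
      then have l': "level Zp (max n k) (U \<union> V)" unfolding level_def by blast
      have "{a. a < p ^ max n k \<and> of_nat a \<in> U \<union> V} =
        {a. a < p ^ max n k \<and> of_nat a \<in> U} \<union> {a. a < p ^ max n k \<and> of_nat a \<in> V}" by auto
      then have "S (max n k) (U \<union> V) = S (max n k) U + S (max n k) V"
        using UV unfolding S_def by (auto intro!: sum.union_disjoint)
      then show "\<mu> (U \<union> V) = \<mu> U + \<mu> V" using \<mu>_eq[OF l(1)] \<mu>_eq[OF l(2)] \<mu>_eq[OF l'] by simp
    qed
    show "\<mu> U = 0" if "\<not> clopen_in Zp U" for U using that by (simp add: \<mu>_def)
    show "\<mu> (pball n x) = m n x" if x: "x \<in> Zp" for n x
    proof -
      have "{a. a < p ^ n \<and> of_nat a \<in> pball n x} = {res n x}"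
        using pcong_sym[OF pcong_res[OF x, of n]] res_less[OF x] res_eqI[OF x] pcong_sym by (auto simp: pball_def)
      then have "\<mu> (pball n x) = m n (of_nat (res n x))"
        using \<mu>_eq[OF level_Zp_pball[OF x, of n]] unfolding S_def by simp
      also have "\<dots> = m n x" using m_cong[OF x of_nat_Zp pcong_res[OF x]] by simp
      finally show ?thesis .
    qed
  qed
qed

text \<open>
  The residues modulo \<open>p\<^sup>n\<^sup>+\<^sup>1\<close> above \<open>x\<close> are \<open>r + i p\<^sup>n\<close> with \<open>i < p\<close>.
\<close>

lemma sum_lifts:
  assumes x: "x \<in> Zp"
  shows "(\<Sum>b | b < p ^ Suc n \<and> pcong n (of_nat b) x. F b) = (\<Sum>i<p. F (res n x + i * p ^ n))"
proof -
  define r where "r = res n x"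
  have r: "r < p ^ n" "pcong n x (of_nat r)" unfolding r_def using res_less pcong_res x by auto
  have bij: "bij_betw (\<lambda>i. r + i * p ^ n) {..<p} {b. b < p ^ Suc n \<and> pcong n (of_nat b) x}"
  proof (rule bij_betw_byWitness[where f' = "\<lambda>b. b div p ^ n"])
    show "\<forall>i\<in>{..<p}. (r + i * p ^ n) div p ^ n = i" using r by auto
    have m: "b mod p ^ n = r" if "pcong n (of_nat b) x" for b
    proof -
      have "pcong n (of_nat b) (of_nat r)" using that r pcong_trans by blast
      then show ?thesis using r(1) by (simp add: pcong_of_nat cong_def)
    qed
    show "\<forall>b\<in>{b. b < p ^ Suc n \<and> pcong n (of_nat b) x}. r + b div p ^ n * p ^ n = b"
      using m by (metis (no_types, lifting) mem_Collect_eq mod_mult_div_eq add.commute mult.commute)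
    show "(\<lambda>i. r + i * p ^ n) ` {..<p} \<subseteq> {b. b < p ^ Suc n \<and> pcong n (of_nat b) x}"
    proof (safe)
      fix i assume i: "i < p"
      have "r + i * p ^ n < Suc i * p ^ n" using r(1) by simp
      also have "\<dots> \<le> p * p ^ n" using i by (intro mult_right_mono) auto
      finally show "r + i * p ^ n < p ^ Suc n" by simp
      have "pcong n (of_nat (r + i * p ^ n)) (of_nat r)" unfolding pcong_of_nat by (simp add: cong_def)
      then show "pcong n (of_nat (r + i * p ^ n)) x" using r(2) pcong_sym pcong_trans by blast
    qed
    show "(\<lambda>b. b div p ^ n) ` {b. b < p ^ Suc n \<and> pcong n (of_nat b) x} \<subseteq> {..<p}"
      by (auto simp: less_mult_imp_div_less)
  qed
  show ?thesis
    unfolding r_def[symmetric] by (rule sum.reindex_bij_betw[OF bij, symmetric])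
qed

lemma bounded_measure_ball_eqI:
  assumes "bounded_measure Zp \<mu>" "bounded_measure Zp \<nu>"
    "\<And>n a. a < p ^ n \<Longrightarrow> \<mu> (padic_ball p a n) = \<nu> (padic_ball p a n)"
  shows "\<mu> = \<nu>"
proof (rule bounded_measure_eqI[OF pdom_Zp assms(1,2)])
  fix n x assume "x \<in> Zp"
  then show "\<mu> (pball n x) = \<nu> (pball n x)"
    using assms(3)[OF res_less, of x n] by (simp add: padic_ball_pball pball_res)
qed

text \<open>
  Compatibility of the masses \<open>z\<^sup>a / (1 - z\<^bsup>p^n\<^esup>)\<close> is the sum of a geometric progression with
  ratio \<open>z\<^bsup>p^n\<^esup>\<close>.
\<close>

lemma mu_root:
  assumes z: "\<And>n. z ^ (p ^ n) \<noteq> (1::'k)" and z1: "absv z = 1"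
    and B: "\<And>n. absv (1 / (1 - z ^ (p ^ n))) \<le> B"
  shows "bounded_measure Zp (mu_root p z)"
proof -
  define m where "m n x = z ^ res n x / (1 - z ^ (p ^ n))" for n x
  have "\<exists>\<mu>. fin_add Zp \<mu> \<and> (\<forall>U. \<not> clopen_in Zp U \<longrightarrow> \<mu> U = 0) \<and> (\<forall>n. \<forall>x\<in>Zp. \<mu> (pball n x) = m n x)"
  proof (rule measure_from_balls)
    show "m n x = m n y" if "x \<in> Zp" "y \<in> Zp" "pcong n x y" for n x y
      using that res_eq_iff[of x y n] by (simp add: m_def)
    fix n x assume x: "x \<in> Zp"
    define r where "r = res n x"
    define w where "w = z ^ (p ^ n)"
    have w: "w \<noteq> 1" "w ^ p \<noteq> 1" "z ^ (p ^ Suc n) = w ^ p"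
      unfolding w_def using z[of n] z[of "Suc n"] by (simp_all add: mult.commute flip: power_mult)
    have "(\<Sum>b | b < p ^ Suc n \<and> pcong n (of_nat b) x. m (Suc n) (of_nat b)) =
      (\<Sum>b | b < p ^ Suc n \<and> pcong n (of_nat b) x. z ^ b / (1 - w ^ p))"
      unfolding w(3)[symmetric] by (intro sum.cong refl) (simp add: m_def res_of_nat)
    also have "\<dots> = (\<Sum>i<p. z ^ (r + i * p ^ n) / (1 - w ^ p))"
      unfolding r_def by (rule sum_lifts[OF x])
    also have "\<dots> = z ^ r * (\<Sum>i<p. w ^ i) / (1 - w ^ p)"
      by (simp add: power_add w_def sum_divide_distrib sum_distrib_left mult.commute flip: power_mult)
    also have "(1 - w) * (\<Sum>i<p. w ^ i) = 1 - w ^ p"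
      by (simp add: one_diff_power_eq)
    then have "(\<Sum>i<p. w ^ i) = (1 - w ^ p) / (1 - w)"
      using w by (simp add: field_simps)
    also have "z ^ r * ((1 - w ^ p) / (1 - w)) / (1 - w ^ p) = z ^ r / (1 - w)"
      using w by simp
    finally show "(\<Sum>b | b < p ^ Suc n \<and> pcong n (of_nat b) x. m (Suc n) (of_nat b)) = m n x"
      by (simp add: m_def r_def w_def)
  qed
  then obtain \<mu> where \<mu>: "fin_add Zp \<mu>" "\<And>U. \<not> clopen_in Zp U \<Longrightarrow> \<mu> U = 0"
    "\<And>n x. x \<in> Zp \<Longrightarrow> \<mu> (pball n x) = m n x" by blast
  have bm: "bounded_measure Zp \<mu>"
    using \<mu>(1,2)
  proof (rule bounded_measureI[OF pdom_Zp])
    show "absv (\<mu> (pball n x)) \<le> B" if "x \<in> Zp" for n x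
      using B[of n] z1 that by (simp add: \<mu>(3) m_def absv_divide absv_power)
  qed
  define P where "P \<nu> \<longleftrightarrow> bounded_measure Zp \<nu> \<and>
     (\<forall>m. \<forall>a<p ^ m. \<nu> (padic_ball p a m) = z ^ a / (1 - z ^ (p ^ m)))" for \<nu>
  have "P (THE \<nu>. P \<nu>)"
  proof (rule theI[of P])
    show "P \<mu>" unfolding P_def using bm by (simp add: padic_ball_pball \<mu>(3) m_def res_of_nat)
    show "\<nu> = \<mu>" if "P \<nu>" for \<nu>
      using that \<open>P \<mu>\<close> unfolding P_def by (intro bounded_measure_ball_eqI) auto
  qed
  then show ?thesis unfolding mu_root_def P_def by blast
qed

lemma clopen_Up_Zp: "clopen_in Up U \<Longrightarrow> clopen_in Zp U"
proof -
  assume "clopen_in Up U"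
  then obtain n where n: "n \<ge> 1" "level Up n U" by (auto simp: clopen_iff)
  then have "level Zp n U"
    unfolding level_def using Up_subset pcong_Up by (meson subset_iff)
  then show ?thesis by (rule level_clopen[OF pdom_Zp])
qed

lemma bounded_measure_restrict:
  assumes "bounded_measure Zp \<mu>"
  shows "bounded_measure Up (restrict_measure Up \<mu>)"
proof -
  obtain B where B: "B > 0" "\<And>U. absv (\<mu> U) \<le> B" using bm_bound[OF assms] by blast
  have "fin_add Up (restrict_measure Up \<mu>)"
    unfolding fin_add_def
  proof (intro allI impI)
    fix U V assume UV: "clopen_in Up U \<and> clopen_in Up V \<and> U \<inter> V = {}"
    then have "\<mu> (U \<union> V) = \<mu> U + \<mu> V"
      using bm_fin_add[OF assms] clopen_Up_Zp unfolding fin_add_def by blast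
    then show "restrict_measure Up \<mu> (U \<union> V) = restrict_measure Up \<mu> U + restrict_measure Up \<mu> V"
      using UV clopen_Un[of Up U V] by (simp add: restrict_measure_def)
  qed
  then show ?thesis
    using B by (intro bounded_measureI[of _ _ B]) (auto simp: restrict_measure_def)
qed

lemma ucont_indicator: "clopen_in Up U \<Longrightarrow> ucont Up (indicator U)"
  using indicator_level ucont_locconst[of Up _ "indicator U"] by (metis clopen_iff pdom_Up)

lemma bounded_measure_density:
  assumes "bounded_measure Up \<mu>" "ucont Up f"
  shows "bounded_measure Up (density_measure p Up f \<mu>)"
proof -
  obtain B where B: "B > 0" "\<And>U. absv (\<mu> U) \<le> B" using bm_bound[OF assms(1)] by blast
  obtain C where C: "C > 0" "\<And>x. x \<in> Up \<Longrightarrow> absv (f x) \<le> C" using ucont_bounded[OF pdom_Up assms(2)] by blast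
  have uc: "ucont Up (\<lambda>x. indicator U x * f x)" if "clopen_in Up U" for U
    using ucont_mult[OF pdom_Up ucont_indicator[OF that] assms(2)] .
  show ?thesis
  proof (rule bounded_measureI[OF pdom_Up])
    show "fin_add Up (density_measure p Up f \<mu>)"
      unfolding fin_add_def
    proof (intro allI impI)
      fix U V assume UV: "clopen_in Up U \<and> clopen_in Up V \<and> U \<inter> V = {}"
      then have "padic_integral p Up \<mu> (\<lambda>x. indicator (U \<union> V) x * f x) =
        padic_integral p Up \<mu> (\<lambda>x. indicator U x * f x + indicator V x * f x)"
        by (intro integral_cong) (auto simp: indicator_def)
      then show "density_measure p Up f \<mu> (U \<union> V) = density_measure p Up f \<mu> U + density_measure p Up f \<mu> V"
        using UV clopen_Un[of Up U V] uc by (simp add: density_measure_def integral_add assms)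
    qed
    show "density_measure p Up f \<mu> U = 0" if "\<not> clopen_in Up U" for U
      using that by (simp add: density_measure_def)
    show "absv (density_measure p Up f \<mu> (pball n x)) \<le> C * B" if "n \<ge> 1" "x \<in> Up" for n x
    proof -
      have cl: "clopen_in Up (pball n x)" using level_clopen[OF pdom_Up level_pball[OF pdom_Up that(2,1)]] .
      have "absv (padic_integral p Up \<mu> (\<lambda>x'. indicator (pball n x) x' * f x')) \<le> C * B"
        by (rule integral_bound[OF pdom_Up assms(1) uc[OF cl] B(2)])
          (use C in \<open>auto simp: indicator_def less_imp_le\<close>)
      then show ?thesis using cl by (simp add: density_measure_def)
    qed
  qed
qed

lemma ucont_inverse: "ucont Up inverse"
proof (rule ucont_lipschitz[of 1])
  fix x y assume xy: "x \<in> Up" "y \<in> Up"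
  then have "inverse x - inverse y = (y - x) * (inverse x * inverse y)"
    using Up_nonzero by (simp add: field_simps)
  then show "absv (inverse x - inverse y) \<le> absv (x - y)"
    using xy by (simp add: absv_mult absv_inverse Up_iff absv_minus_commute)
qed simp

lemma bounded_measure_nu_root:
  "bounded_measure Zp (mu_root p z) \<Longrightarrow> bounded_measure Up (nu_root p z)"
  unfolding nu_root_def by (intro bounded_measure_density bounded_measure_restrict ucont_inverse)

section \<open>A measure is determined by its power series\<close>

lemma ucont_poly: "ucont Zp (poly q)"
proof (induction q)
  case (pCons a q)
  then show ?case
    by (simp add: ucont_add ucont_mult ucont_id)
qed simp

lemma unit_if_not_pcong_0: "x \<in> Zp \<Longrightarrow> \<not> pcong 1 x 0 \<Longrightarrow> x \<in> Up"
proof -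
  assume x: "x \<in> Zp" "\<not> pcong 1 x 0"
  define a where "a = res 1 x"
  have a: "pcong 1 x (of_nat a)" "a < p" unfolding a_def using pcong_res[OF x(1), of 1] res_less[OF x(1), of 1] by auto
  then have "a \<noteq> 0" using x(2) by (metis of_nat_0)
  then have "\<not> p dvd a" using a(2) by (meson nat_dvd_not_less not_gr_zero)
  then have "coprime a p" using prime_imp_coprime[OF prime_p] coprime_commute by blast
  then have "of_nat a \<in> Up" by (rule of_nat_Up)
  then show ?thesis using pcong_Up[of "of_nat a" x 1] pcong_sym[OF a(1)] x by simp
qed

text \<open>
  On the units \<open>x\<^sup>p\<^sup>-\<^sup>1 \<equiv> 1\<close>, and on \<open>p\<int>\<^sub>p\<close> it is \<open>\<equiv> 0\<close>. So the polynomial \<open>1 - X\<^sup>p\<^sup>-\<^sup>1\<close>, raised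
  to a high power of \<open>p\<close>, is close to \<open>0\<close> on the former and to \<open>1\<close> on the latter.
\<close>

lemma poly_approx_ball_1:
  assumes "e > 0"
  shows "\<exists>q::'k poly. \<forall>x\<in>Zp. absv (poly q x - indicator (pball 1 0) x) < e"
proof -
  obtain k where k: "1 / real p ^ k < e" using small_p_power assms by blast
  have "absv (poly ((1 - [:0, 1:] ^ (p - 1)) ^ (p ^ k)) x - indicator (pball 1 0) x) < e" if x: "x \<in> Zp" for x :: 'k
  proof -
    define y where "y = 1 - x ^ (p - 1)"
    have py: "poly ((1 - [:0, 1:] ^ (p - 1)) ^ (p ^ k)) x = y ^ (p ^ k)"
      by (simp add: y_def poly_power)
    show ?thesis
    proof (cases "pcong 1 x 0")
      case True
      then have "pcong 1 (x ^ (p - 1)) (0 ^ (p - 1))" using x absv_Zp by (intro pcong_power) auto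
      then have "pcong 1 (x ^ (p - 1)) 0" using p_gt_2 by (simp add: power_0_left)
      then have "pcong 1 (1 - x ^ (p - 1)) (1 - 0)" by (intro pcong_diff pcong_refl)
      then have "pcong 1 y 1" by (simp add: y_def)
      moreover have "absv y \<le> 1" unfolding y_def using x by (intro absv_Zp) auto
      ultimately have "pcong (Suc k) (y ^ (p ^ k)) 1" by (intro pcong_frobenius_iter)
      then have "pcong k (y ^ (p ^ k)) 1" using pcong_mono[of k "Suc k"] by simp
      then show ?thesis using True x k unfolding py by (simp add: pball_def pcong_def)
    next
      case False
      then have "x \<in> Up" by (rule unit_if_not_pcong_0[OF x])
      then have "pcong 1 1 (x ^ (p - 1))" by (intro pcong_sym[OF pcong_fermat])
      then have "absv y \<le> 1 / real p" by (simp add: y_def pcong_def)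
      then have "absv y ^ (p ^ k) \<le> (1 / real p) ^ (p ^ k)" by (intro power_mono) auto
      also have "\<dots> \<le> (1 / real p) ^ k"
        using p_gt_2 less_exp[of k] power_less_imp_less_exp
        by (intro power_decreasing) (auto intro: less_imp_le power_gt_expt)
      finally have "absv (y ^ (p ^ k)) < e" using k by (simp add: absv_power power_one_over)
      then show ?thesis using False unfolding py by (simp add: pball_def)
    qed
  qed
  then show ?thesis by blast
qed

text \<open>
  The indicator of \<open>p\<^sup>n\<^sup>+\<^sup>1\<int>\<^sub>p\<close> at \<open>x\<close> is that of \<open>p\<^sup>n\<int>\<^sub>p\<close> times that of \<open>p\<int>\<^sub>p\<close> at \<open>x / p\<^sup>n\<close>.
  The polynomial \<open>h\<close> that approximates the second factor may be large outside \<open>p\<^sup>n\<int>\<^sub>p\<close>, but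
  bounded; so the first factor is approximated well enough to absorb its bound.
\<close>

lemma poly_approx_ball_0:
  "e > 0 \<Longrightarrow> \<exists>q::'k poly. \<forall>x\<in>Zp. absv (poly q x - indicator (pball n 0) x) < e"
proof (induction n arbitrary: e)
  case 0
  have "indicator (pball 0 0) x = (1::'k)" if "x \<in> Zp" for x
    using that absv_Zp by (simp add: pball_def pcong_def)
  then show ?case using 0 by (intro exI[of _ 1]) auto
next
  case (Suc n)
  obtain g :: "'k poly" where g: "\<And>x. x \<in> Zp \<Longrightarrow> absv (poly g x - indicator (pball 1 0) x) < e"
    using poly_approx_ball_1[OF Suc.prems] by blast
  define h where "h = pcompose g [:0, 1 / of_nat p ^ n:]"
  have h: "poly h x = poly g (x / of_nat p ^ n)" for x by (simp add: h_def poly_pcompose)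
  obtain C where C: "C > 0" "\<And>x. x \<in> Zp \<Longrightarrow> absv (poly h x) \<le> C"
    using ucont_bounded[OF pdom_Zp ucont_poly[of h]] by blast
  have "e / C > 0" using Suc.prems C by simp
  then obtain q :: "'k poly" where q: "\<And>x. x \<in> Zp \<Longrightarrow> absv (poly q x - indicator (pball n 0) x) < e / C"
    using Suc.IH by blast
  have "absv (poly (q * h) x - indicator (pball (Suc n) 0) x) < e" if x: "x \<in> Zp" for x
  proof -
    define i where "i = (indicator (pball n 0) x :: 'k)"
    have "absv (poly q x - i) * absv (poly h x) \<le> absv (poly q x - i) * C"
      using C x by (intro mult_left_mono) auto
    also have "\<dots> < e / C * C" using q[OF x] C unfolding i_def by (intro mult_strict_right_mono)
    finally have 1: "absv ((poly q x - i) * poly h x) < e" using C by (simp add: absv_mult)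
    have 2: "absv (i * poly h x - indicator (pball (Suc n) 0) x) < e"
    proof (cases "pcong n x 0")
      case True
      then have Z: "x / of_nat p ^ n \<in> Zp" using x by (intro Zp_div_p_power) (auto simp: pcong_def)
      have "indicator (pball (Suc n) 0) x = (indicator (pball 1 0) (x / of_nat p ^ n) :: 'k)"
        using x Z by (auto simp: indicator_def pball_def pcong_def absv_divide absv_p_power field_simps)
      then show ?thesis using g[OF Z] True x by (simp add: i_def h pball_def)
    next
      case False
      then have "\<not> pcong (Suc n) x 0" using pcong_mono[of n "Suc n"] by auto
      then show ?thesis using False Suc.prems by (simp add: i_def pball_def)
    qed
    have "absv ((poly q x - i) * poly h x + (i * poly h x - indicator (pball (Suc n) 0) x)) < e"
      using 1 2 by (rule absv_add_less)
    then show ?thesis by (simp add: algebra_simps)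
  qed
  then show ?case by blast
qed

lemma poly_approx_ball:
  assumes "e > 0" "a \<in> Zp"
  shows "\<exists>q::'k poly. \<forall>x\<in>Zp. absv (poly q x - indicator (pball n a) x) < e"
proof -
  obtain g :: "'k poly" where g: "\<And>x. x \<in> Zp \<Longrightarrow> absv (poly g x - indicator (pball n 0) x) < e"
    using poly_approx_ball_0[OF assms(1)] by blast
  have "absv (poly (pcompose g [:- a, 1:]) x - indicator (pball n a) x) < e" if "x \<in> Zp" for x
    using g[of "x - a"] that assms(2) by (simp add: poly_pcompose pball_def indicator_def pcong_def)
  then show ?thesis by blast
qed

text \<open>
  Multiplication by \<open>x\<close> sends the binomial polynomial of degree \<open>k\<close> to a combination of those of
  degrees \<open>k\<close> and \<open>k + 1\<close>, so the functions with vanishing integral against all binomial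
  polynomials are stable under multiplication by polynomials.
\<close>

lemma integral_poly_eq_0:
  assumes bm: "bounded_measure Zp \<mu>" and 0: "\<And>k. padic_integral p Zp \<mu> (\<lambda>x. x gchoose k) = 0"
  shows "padic_integral p Zp \<mu> (\<lambda>x. poly q x * (x gchoose k)) = 0"
proof (induction q arbitrary: k)
  case 0
  show ?case using integral_cmult[OF pdom_Zp bm ucont_const[of Zp 0], of 0] by simp
next
  case (pCons a q)
  have uc: "ucont Zp (\<lambda>x. poly q x * (x gchoose k))" for k
    by (intro ucont_mult ucont_poly ucont_gbinomial pdom_Zp)
  have uc': "ucont Zp (\<lambda>x. c * (poly q x * (x gchoose k)))" for k and c :: 'k
    by (rule ucont_mult[OF pdom_Zp ucont_const uc])
  have uc0: "ucont Zp (\<lambda>x. a * (x gchoose k))"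
    by (intro ucont_mult ucont_const ucont_gbinomial pdom_Zp)
  have "poly (pCons a q) x * (x gchoose k) = a * (x gchoose k) +
      (of_nat k * (poly q x * (x gchoose k)) + of_nat (Suc k) * (poly q x * (x gchoose Suc k)))" for x
  proof -
    have "poly (pCons a q) x * (x gchoose k) = a * (x gchoose k) + poly q x * (x * (x gchoose k))"
      by (simp add: algebra_simps)
    then show ?thesis unfolding gbinomial_mult_1 by (simp add: algebra_simps)
  qed
  then have "padic_integral p Zp \<mu> (\<lambda>x. poly (pCons a q) x * (x gchoose k)) =
    padic_integral p Zp \<mu> (\<lambda>x. a * (x gchoose k)) +
    (padic_integral p Zp \<mu> (\<lambda>x. of_nat k * (poly q x * (x gchoose k))) +
     padic_integral p Zp \<mu> (\<lambda>x. of_nat (Suc k) * (poly q x * (x gchoose Suc k))))"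
    by (simp only: integral_add[OF pdom_Zp bm uc0 ucont_add[OF uc' uc']] integral_add[OF pdom_Zp bm uc' uc'])
  also have "\<dots> = 0"
    by (simp only: integral_cmult[OF pdom_Zp bm uc] integral_cmult[OF pdom_Zp bm ucont_gbinomial] pCons.IH 0
        mult_zero_right add_0_right)
  finally show ?case .
qed

lemma measure_eq_0_if_moments:
  assumes bm: "bounded_measure Zp \<mu>" and 0: "\<And>k. padic_integral p Zp \<mu> (\<lambda>x. x gchoose k) = 0"
    and n: "n \<ge> 1" "a \<in> Zp"
  shows "\<mu> (pball n a) = 0"
proof (rule eq_if_close)
  fix e :: real assume e: "e > 0"
  obtain B where B: "B > 0" "\<And>U. absv (\<mu> U) \<le> B" using bm_bound[OF bm] by blast
  have "e / (2 * B) > 0" using e B by simp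
  from poly_approx_ball[OF this n(2), of n] obtain q :: "'k poly"
    where q: "\<And>x. x \<in> Zp \<Longrightarrow> absv (poly q x - indicator (pball n a) x) < e / (2 * B)" by blast
  have q0: "padic_integral p Zp \<mu> (poly q) = 0"
    using integral_poly_eq_0[OF bm 0, of q 0] by simp
  have l: "level Zp n (pball n a)" by (rule level_Zp_pball[OF n(2)])
  have ui: "ucont Zp (indicator (pball n a))"
    by (rule ucont_locconst[of _ n]) (use l pcong_sym in \<open>auto simp: indicator_def level_def\<close>)
  have uc: "ucont Zp (\<lambda>x. poly q x - indicator (pball n a) x)"
    using ucont_add[OF ucont_poly[of q] ucont_mult[OF pdom_Zp ucont_const[of _ "-1"] ui]] by simp
  have "absv (padic_integral p Zp \<mu> (\<lambda>x. poly q x - indicator (pball n a) x)) \<le> e / (2 * B) * B"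
    by (rule integral_bound[OF pdom_Zp bm uc B(2)]) (use q less_imp_le in blast)
  also have "padic_integral p Zp \<mu> (\<lambda>x. poly q x - indicator (pball n a) x) = - \<mu> (pball n a)"
    using integral_diff[OF pdom_Zp bm ucont_poly ui] integral_indicator[OF pdom_Zp n(1) l bm_fin_add[OF bm]] q0 by simp
  finally show "absv (\<mu> (pball n a) - 0) < e" using e B by simp
qed

lemma amice_transform_inj:
  assumes "bounded_measure Zp \<mu>" "bounded_measure Zp \<nu>" "amice_transform p \<mu> = amice_transform p \<nu>"
  shows "\<mu> = \<nu>"
proof (rule bounded_measure_eqI[OF pdom_Zp assms(1,2)])
  fix n :: nat and x :: 'k assume n: "n \<ge> 1" "x \<in> Zp"
  have *: "padic_integral p Zp (\<lambda>U. \<mu> U - 1 * \<nu> U) (\<lambda>x. x gchoose k) = 0" for k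
  proof -
    have "padic_integral p Zp \<mu> (\<lambda>x. x gchoose k) = padic_integral p Zp \<nu> (\<lambda>x. x gchoose k)"
      using arg_cong[OF assms(3), of "\<lambda>f. fps_nth f k"] by (simp add: amice_transform_def)
    then show ?thesis by (simp only: integral_measure_diff[OF pdom_Zp assms(1,2) ucont_gbinomial]) simp
  qed
  show "\<mu> (pball n x) = \<nu> (pball n x)"
    using measure_eq_0_if_moments[OF bounded_measure_diff[OF pdom_Zp assms(1,2), of 1] * n] by simp
qed

section \<open>The regularised half-shift measure\<close>

text \<open>
  The first Bernoulli distribution \<open>B\<^sub>1((r + 1/2) / p\<^sup>n)\<close>, where \<open>r < p\<^sup>n\<close> is the residue of
  \<open>x\<close>. Formally it gives the ball around \<open>x + 1/2\<close> the mass of \<open>(1 + T)\<^sup>1\<^sup>/\<^sup>2 / T = - \<Sum> (1 +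
  T)\<^sup>n\<^sup>+\<^sup>1\<^sup>/\<^sup>2\<close>.
\<close>

definition bern :: "nat \<Rightarrow> 'k \<Rightarrow> 'k" where
  "bern n x = (of_nat (res n x) + 1 / 2) / of_nat p ^ n - 1 / 2"

lemma bern_cong: "x \<in> Zp \<Longrightarrow> y \<in> Zp \<Longrightarrow> pcong n x y \<Longrightarrow> bern n x = bern n y"
  using res_eq_iff[of x y n] by (simp add: bern_def)

lemma of_nat_p_nonzero [simp]: "(of_nat p :: 'k) \<noteq> 0"
  using p_pos(1) by simp

lemma bern_distribution:
  assumes x: "x \<in> Zp"
  shows "(\<Sum>b | b < p ^ Suc n \<and> pcong n (of_nat b) x. bern (Suc n) (of_nat b)) = bern n x"
proof -
  define r where "r = res n x"
  define P where "P = (of_nat p :: 'k)"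
  have P: "P \<noteq> 0" unfolding P_def by simp
  obtain k where k: "p = 2 * k + 1" "(\<Sum>i<p. i) = p * k" by (rule sum_below_p)
  have s: "(\<Sum>i<p. of_nat i) = P * (of_nat k :: 'k)"
    using arg_cong[OF k(2), of "of_nat :: nat \<Rightarrow> 'k"] by (simp only: of_nat_sum of_nat_mult P_def)
  have Pk: "P = 2 * of_nat k + 1" unfolding P_def by (subst k(1)) simp
  have "(\<Sum>b | b < p ^ Suc n \<and> pcong n (of_nat b) x. bern (Suc n) (of_nat b)) =
    (\<Sum>b | b < p ^ Suc n \<and> pcong n (of_nat b) x. (of_nat b + 1 / 2) / P ^ Suc n - 1 / 2)"
    by (intro sum.cong refl) (simp add: bern_def res_of_nat P_def)
  also have "\<dots> = (\<Sum>i<p. (of_nat (r + i * p ^ n) + 1 / 2) / P ^ Suc n - 1 / 2)"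
    unfolding r_def by (rule sum_lifts[OF x])
  also have "\<dots> = (\<Sum>i<p. (of_nat r + 1 / 2) / P ^ Suc n - 1 / 2 + of_nat i * (1 / P))"
    using P by (intro sum.cong refl) (simp add: P_def field_simps)
  also have "\<dots> = P * ((of_nat r + 1 / 2) / P ^ Suc n - 1 / 2) + P * of_nat k * (1 / P)"
    unfolding sum.distrib sum_distrib_right[symmetric] s by (simp add: P_def)
  also have "\<dots> = (of_nat r + 1 / 2) / P ^ n - P / 2 + of_nat k"
    using P by (simp add: field_simps)
  also have "\<dots> = (of_nat r + 1 / 2) / P ^ n + (of_nat k - P / 2)" by simp
  also have "of_nat k - P / 2 = - 1 / 2" by (simp add: Pk field_simps)
  also have "(of_nat r + 1 / 2) / P ^ n + - 1 / 2 = bern n x" by (simp add: bern_def r_def P_def)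
  finally show ?thesis .
qed

text \<open>
  The residue drops by \<open>1\<close>, except at \<open>0\<close>, where it jumps to \<open>p\<^sup>n - 1\<close>. This is the relation \<open>T
  F(T) = (1 + T)\<^sup>1\<^sup>/\<^sup>2\<close> up to the uniform distribution, which gives each ball the mass \<open>1 /
  p\<^sup>n\<close>.
\<close>

lemma bern_step:
  assumes x: "x \<in> Zp"
  shows "bern n (x - 1) - bern n x = (if pcong n x 0 then 1 else 0) - 1 / of_nat p ^ n"
proof -
  have pn: "p ^ n > 0" by simp
  have P: "(of_nat p ^ n :: 'k) \<noteq> 0" by simp
  show ?thesis
  proof (cases "pcong n x 0")
    case True
    then have 0: "res n x = 0" using res_eqI[OF x, of 0 n] by simp
    have "pcong n (x - 1) (of_nat (p ^ n) - 1)"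
    proof (rule pcong_diff[OF _ pcong_refl])
      have "pcong n (of_nat 0) (of_nat (p ^ n))" unfolding pcong_of_nat by (simp add: cong_def)
      then show "pcong n x (of_nat (p ^ n))" using True pcong_trans by fastforce
    qed
    moreover have e: "of_nat (p ^ n - 1) = (of_nat (p ^ n) - 1 :: 'k)"
    proof -
      obtain q where "p ^ n = Suc q" using pn gr0_implies_Suc by blast
      then show ?thesis by (simp del: of_nat_power)
    qed
    ultimately have "pcong n (x - 1) (of_nat (p ^ n - 1))" by (simp only: e)
    from res_eqI[OF _ _ this] have "res n (x - 1) = p ^ n - 1" using x pn by simp
    then show ?thesis using True P unfolding bern_def 0 by (simp only: e of_nat_power) (simp add: field_simps)
  next
    case False
    have "res n x \<noteq> 0"
    proof
      assume "res n x = 0"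
      then show False using pcong_res[OF x, of n] False by simp
    qed
    then have r: "res n x \<ge> 1" by simp
    have "pcong n (x - 1) (of_nat (res n x) - 1)" by (intro pcong_diff pcong_res x pcong_refl)
    then have "pcong n (x - 1) (of_nat (res n x - 1))" using r by (simp add: of_nat_diff)
    then have "res n (x - 1) = res n x - 1" using x res_less[OF x, of n] by (intro res_eqI) auto
    then show ?thesis using False r P unfolding bern_def by (simp add: of_nat_diff field_simps)
  qed
qed

lemma bern_telescope:
  assumes x: "x \<in> Zp"
  shows "bern n (x - of_nat c) - bern n x =
    (\<Sum>i<c. if pcong n x (of_nat i) then 1 else 0) - of_nat c * (1 / of_nat p ^ n)"
proof (induction c)
  case (Suc c)
  have Z: "x - of_nat c \<in> Zp" using x by simp
  define t where "t = (1 / of_nat p ^ n :: 'k)"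
  have "pcong n (x - of_nat c) 0 \<longleftrightarrow> pcong n x (of_nat c)" by (simp add: pcong_def)
  then have "bern n (x - of_nat c - 1) - bern n (x - of_nat c) =
    (if pcong n x (of_nat c) then 1 else 0) - 1 / of_nat p ^ n"
    using bern_step[OF Z, of n] by simp
  then have "bern n (x - of_nat (Suc c)) - bern n x = (if pcong n x (of_nat c) then 1 else 0) - 1 / of_nat p ^ n
    + (bern n (x - of_nat c) - bern n x)"
    by (simp add: algebra_simps)
  then show ?case unfolding Suc t_def[symmetric] by (simp add: algebra_simps)
qed simp

text \<open>
  The mass of the ball of radius \<open>p\<^sup>-\<^sup>n\<close> around \<open>x\<close> under \<open>\<lambda>\<^sub>c\<close>, namely \<open>E(U) - c E(c\<^sup>-\<^sup>1 U)\<close>.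
\<close>

definition lambda_ball :: "nat \<Rightarrow> nat \<Rightarrow> 'k \<Rightarrow> 'k" where
  "lambda_ball c n x = bern n (x - 1 / 2) - of_nat c * bern n (x / of_nat c - 1 / 2)"

text \<open>
  The denominators \<open>p\<^sup>n\<close> of the two Bernoulli terms cancel, because both residues, shifted by
  \<open>1/2\<close> and the second multiplied by \<open>c\<close>, are congruent to \<open>x\<close>. What remains is integral as \<open>c\<close>
  is odd.
\<close>

lemma absv_lambda_ball:
  assumes c: "odd c" "of_nat c \<in> Up" and x: "x \<in> Zp"
  shows "absv (lambda_ball c n x) \<le> 1"
proof -
  define P where "P = (of_nat p ^ n :: 'k)"
  have P: "P \<noteq> 0" unfolding P_def by simp
  define r s where "r = (of_nat (res n (x - 1 / 2)) :: 'k)" and "s = (of_nat (res n (x / of_nat c - 1 / 2)) :: 'k)"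
  have c0: "(of_nat c :: 'k) \<noteq> 0" using Up_nonzero[OF c(2)] .
  have xc: "x / of_nat c \<in> Zp" by (rule Zp_divide[OF x c(2)])
  have r: "pcong n (x - 1 / 2) r" and s: "pcong n (x / of_nat c - 1 / 2) s"
    unfolding r_def s_def using x xc half_mem_Zp by (auto intro!: pcong_res)
  have "pcong n (of_nat c * (x / of_nat c - 1 / 2)) (of_nat c * s)"
    using s by (intro pcong_scale) auto
  then have "pcong n (x - of_nat c / 2) (of_nat c * s)" using c0 by (simp add: right_diff_distrib)
  from pcong_diff[OF r this] have "absv ((x - 1 / 2) - (x - of_nat c / 2) - (r - of_nat c * s)) \<le> 1 / real p ^ n"
    by (simp add: pcong_def)
  moreover have "(x - 1 / 2) - (x - of_nat c / 2) - (r - of_nat c * s) = - (r - of_nat c * s + (1 - of_nat c) / 2)"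
    by (simp add: field_simps)
  ultimately have X: "absv (r - of_nat c * s + (1 - of_nat c) / 2) \<le> 1 / real p ^ n"
    by (simp only: absv_minus)
  have "absv ((r - of_nat c * s + (1 - of_nat c) / 2) / P) =
      absv (r - of_nat c * s + (1 - of_nat c) / 2) * real p ^ n"
    by (simp only: absv_divide P_def absv_p_power) simp
  also have "\<dots> \<le> 1 / real p ^ n * real p ^ n" using X by (intro mult_right_mono) auto
  finally have "absv ((r - of_nat c * s + (1 - of_nat c) / 2) / P) \<le> 1"
    using p_gt_2 by simp
  moreover have "absv ((of_nat c - 1) / 2 :: 'k) \<le> 1"
  proof -
    obtain k where "c = 2 * k + 1" using c(1) by (rule oddE)
    then have "(of_nat c - 1) / 2 = (of_nat k :: 'k)" by simp
    then show ?thesis by simp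
  qed
  moreover have "lambda_ball c n x = (r - of_nat c * s + (1 - of_nat c) / 2) / P + (of_nat c - 1) / 2"
    using P unfolding lambda_ball_def bern_def r_def[symmetric] s_def[symmetric] P_def[symmetric]
    by (simp add: field_simps)
  ultimately show ?thesis using absv_add_le by metis
qed

text \<open>
  The uniform distributions from both terms cancel, since \<open>c\<close> steps of the first term meet \<open>c\<close>
  times one step of the second.
\<close>

lemma lambda_ball_translate:
  assumes c: "of_nat c \<in> Up" and x: "x \<in> Zp"
  shows "lambda_ball c n (x - of_nat c) - lambda_ball c n x =
    (\<Sum>i<c. if pcong n (1 / 2 + of_nat i) x then 1 else 0) - of_nat c * (if pcong n (of_nat c / 2) x then 1 else 0)"
proof -
  have c0: "(of_nat c :: 'k) \<noteq> 0" using Up_nonzero[OF c] .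
  have xc: "x / of_nat c \<in> Zp" by (rule Zp_divide[OF x c])
  have 1: "pcong n (x - 1 / 2) (of_nat i) \<longleftrightarrow> pcong n (1 / 2 + of_nat i) x" for i
    using absv_minus_commute[of "x - 1 / 2" "of_nat i"] by (simp add: pcong_def algebra_simps)
  have "pcong n (x / of_nat c - 1 / 2) 0 \<longleftrightarrow> pcong n (of_nat c * (x / of_nat c - 1 / 2)) (of_nat c * 0)"
    by (rule pcong_unit_mult_iff[OF c, symmetric])
  also have "\<dots> \<longleftrightarrow> pcong n (x - of_nat c / 2) 0" using c0 by (simp add: right_diff_distrib)
  also have "\<dots> \<longleftrightarrow> pcong n (of_nat c / 2) x" by (simp add: pcong_def absv_minus_commute)
  finally have 2: "pcong n (x / of_nat c - 1 / 2) 0 \<longleftrightarrow> pcong n (of_nat c / 2) x" .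
  have "lambda_ball c n (x - of_nat c) - lambda_ball c n x = (bern n (x - 1 / 2 - of_nat c) - bern n (x - 1 / 2)) -
    of_nat c * (bern n (x / of_nat c - 1 / 2 - 1) - bern n (x / of_nat c - 1 / 2))"
    using c0 unfolding lambda_ball_def by (simp add: diff_divide_distrib algebra_simps)
  also have "\<dots> = (\<Sum>i<c. if pcong n (1 / 2 + of_nat i) x then 1 else 0)
    - of_nat c * (if pcong n (of_nat c / 2) x then 1 else 0)"
    unfolding bern_telescope[OF Zp_diff[OF x half_mem_Zp]] bern_step[OF Zp_diff[OF xc half_mem_Zp]] 1 2
    by (simp add: right_diff_distrib)
  finally show ?thesis .
qed

text \<open>
  Both terms are push-forwards of one distribution on the integers, so their finite additivity
  needs no further computation.
\<close>

lemma lambda_ball_measure: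
  assumes c: "odd c" "of_nat c \<in> Up"
  obtains \<mu> where "bounded_measure Zp \<mu>" "\<And>n x. n \<ge> 1 \<Longrightarrow> x \<in> Zp \<Longrightarrow> \<mu> (pball n x) = lambda_ball c n x"
proof -
  obtain E where E: "fin_add Zp E" "\<And>n x. x \<in> Zp \<Longrightarrow> E (pball n x) = bern n x"
    using measure_from_balls[of bern, OF bern_cong bern_distribution] by blast
  define f g where "f = (\<lambda>y::'k. y + 1 / 2)" and "g = (\<lambda>y::'k. of_nat c * (y + 1 / 2))"
  have fZ: "\<And>x. x \<in> Zp \<Longrightarrow> f x \<in> Zp" and gZ: "\<And>x. x \<in> Zp \<Longrightarrow> g x \<in> Zp"
    unfolding f_def g_def using half_mem_Zp by simp_all
  have fc: "pcong n (f x) (f y) \<longleftrightarrow> pcong n x y" and gc: "pcong n (g x) (g y) \<longleftrightarrow> pcong n x y" for n x y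
    unfolding f_def g_def using pcong_unit_mult_iff[OF c(2)] by (simp_all add: pcong_def)
  define F G where "F = pushforward Zp Zp f E" and "G = pushforward Zp Zp g E"
  have FG: "fin_add Zp F" "fin_add Zp G"
    unfolding F_def G_def using fZ gZ fc gc by (auto intro!: fin_add_pushforward E(1))
  have c0: "(of_nat c :: 'k) \<noteq> 0" using Up_nonzero[OF c(2)] .
  have val: "F (pball n x) - of_nat c * G (pball n x) = lambda_ball c n x" if x: "x \<in> Zp" for n x
  proof -
    have cl: "clopen_in Zp (pball n x)" using level_clopen[OF pdom_Zp level_Zp_pball[OF x]] .
    have xc: "x / of_nat c \<in> Zp" by (rule Zp_divide[OF x c(2)])
    have 1: "f (x - 1 / 2) = x" "g (x / of_nat c - 1 / 2) = x" using c0 by (simp_all add: f_def g_def)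
    have "{y \<in> Zp. f y \<in> pball n x} = pball n (x - 1 / 2)"
      unfolding pball_def using fZ fc[of n _ "x - 1 / 2"] 1 by auto
    moreover have "{y \<in> Zp. g y \<in> pball n x} = pball n (x / of_nat c - 1 / 2)"
      unfolding pball_def using gZ gc[of n _ "x / of_nat c - 1 / 2"] 1 by auto
    ultimately show ?thesis
      using x xc half_mem_Zp by (simp add: F_def G_def pushforward_def cl E(2) lambda_ball_def)
  qed
  show ?thesis
  proof (rule that[of "\<lambda>U. F U - of_nat c * G U"])
    show "bounded_measure Zp (\<lambda>U. F U - of_nat c * G U)"
    proof (rule bounded_measureI[OF pdom_Zp])
      show "fin_add Zp (\<lambda>U. F U - of_nat c * G U)"
        using FG unfolding fin_add_def by (simp add: algebra_simps)
      show "F U - of_nat c * G U = 0" if "\<not> clopen_in Zp U" for U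
        using that by (simp add: F_def G_def pushforward_def)
      show "absv (F (pball n x) - of_nat c * G (pball n x)) \<le> 1" if "x \<in> Zp" for n x
        unfolding val[OF that] by (rule absv_lambda_ball[OF c that])
    qed
  qed (use val in blast)
qed

text \<open>
  Translation of a measure by \<open>c\<close> multiplies its power series by \<open>(1 + T)\<^sup>c\<close>, by the Vandermonde
  identity.
\<close>

lemma amice_translate:
  assumes bm: "bounded_measure Zp \<mu>"
  shows "padic_integral p Zp \<mu> (\<lambda>x. (x + of_nat c) gchoose k) =
    fps_nth (amice_transform p \<mu> * (1 + fps_X) ^ c) k"
proof -
  have "padic_integral p Zp \<mu> (\<lambda>x. (x + of_nat c) gchoose k) =
    padic_integral p Zp \<mu> (\<lambda>x. \<Sum>i=0..k. (of_nat c gchoose (k - i)) * (x gchoose i))"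
  proof (rule integral_cong)
    fix x :: 'k
    have "(x + of_nat c) gchoose k = fps_nth (fps_binomial x * fps_binomial (of_nat c)) k"
      by (simp flip: fps_binomial_add_mult)
    then show "(x + of_nat c) gchoose k = (\<Sum>i=0..k. (of_nat c gchoose (k - i)) * (x gchoose i))"
      by (simp add: fps_mult_nth mult.commute)
  qed
  also have "\<dots> = (\<Sum>i=0..k. (of_nat c gchoose (k - i)) * padic_integral p Zp \<mu> (\<lambda>x. x gchoose i))"
    by (subst integral_sum[OF pdom_Zp bm])
      (auto intro!: ucont_mult ucont_gbinomial sum.cong integral_cmult bm)
  also have "\<dots> = fps_nth (amice_transform p \<mu> * fps_binomial (of_nat c)) k"
    unfolding fps_mult_nth by (intro sum.cong refl) (simp add: amice_transform_def)
  finally show ?thesis by (simp add: fps_binomial_of_nat)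
qed

text \<open>
  The translate of the measure by \<open>c\<close> minus the measure is the sum of the Dirac measures at \<open>1/2
  + i\<close> for \<open>i < c\<close>, minus \<open>c\<close> times the one at \<open>c/2\<close>. This is the identity of power series.
\<close>

lemma amice_lambda_ball:
  assumes c: "of_nat c \<in> Up" and bm: "bounded_measure Zp \<mu>"
    and \<mu>: "\<And>n x. n \<ge> 1 \<Longrightarrow> x \<in> Zp \<Longrightarrow> \<mu> (pball n x) = lambda_ball c n x"
  shows "amice_transform p \<mu> * ((1 + fps_X) ^ c - 1) =
    fps_binomial (1 / 2) * (\<Sum>i<c. (1 + fps_X) ^ i) - of_nat c * fps_binomial (of_nat c / 2)"
proof -
  define \<tau> where "\<tau> = pushforward Zp Zp (\<lambda>y. y + of_nat c) \<mu>"
  define \<delta> where "\<delta> = (\<lambda>i::nat. dirac_measure Zp (1 / 2 + of_nat i :: 'k))"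
  have c2: "of_nat c / 2 \<in> Zp"
    using Zp_mult[OF of_nat_Zp half_mem_Zp, of c] by simp
  have tr: "\<And>x. x \<in> Zp \<Longrightarrow> x + of_nat c \<in> Zp" "\<And>n x y. pcong n (x + of_nat c) (y + of_nat c) \<longleftrightarrow> pcong n x y"
    by (simp_all add: pcong_def)
  have \<tau>: "bounded_measure Zp \<tau>"
    unfolding \<tau>_def by (rule bounded_measure_pushforward) (use tr bm in auto)
  have \<delta>: "bounded_measure Zp (\<delta> i)" for i
    unfolding \<delta>_def by (rule dirac_bounded_measure) (use half_mem_Zp in auto)
  have \<delta>c: "bounded_measure Zp (dirac_measure Zp (of_nat c / 2))"
    by (rule dirac_bounded_measure) (use c2 in auto)
  have \<delta>s: "bounded_measure Zp (\<lambda>U. \<Sum>i<c. 1 * \<delta> i U)"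
    by (rule bounded_measure_lincomb) (use \<delta> in auto)
  have eq: "(\<lambda>U. \<tau> U - 1 * \<mu> U) =
    (\<lambda>U. (\<Sum>i<c. 1 * \<delta> i U) - of_nat c * dirac_measure Zp (of_nat c / 2) U)"
  proof (rule bounded_measure_eqI[OF pdom_Zp])
    fix n :: nat and x :: 'k assume n: "n \<ge> 1" "x \<in> Zp"
    have "{y \<in> Zp. y + of_nat c \<in> pball n x} = pball n (x - of_nat c)"
      unfolding pball_def pcong_def by (auto simp: algebra_simps)
    then have "\<tau> (pball n x) = lambda_ball c n (x - of_nat c)"
      using level_clopen[OF pdom_Zp level_Zp_pball[OF n(2)]] n by (simp add: \<tau>_def pushforward_def \<mu>)
    then show "\<tau> (pball n x) - 1 * \<mu> (pball n x) =
      (\<Sum>i<c. 1 * \<delta> i (pball n x)) - of_nat c * dirac_measure Zp (of_nat c / 2) (pball n x)"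
      using n half_mem_Zp c2 lambda_ball_translate[OF c n(2), of n] by (simp add: \<mu> \<delta>_def dirac_pball)
  qed (intro bounded_measure_diff pdom_Zp \<tau> bm \<delta>s \<delta>c)+
  have coeff: "fps_nth (amice_transform p \<mu> * (1 + fps_X) ^ c) k - fps_nth (amice_transform p \<mu>) k =
    (\<Sum>i<c. (1 / 2 + of_nat i) gchoose k) - of_nat c * ((of_nat c / 2) gchoose k)" for k
  proof -
    have u: "ucont Zp (\<lambda>x. x gchoose k)" by (rule ucont_gbinomial)
    have "padic_integral p Zp \<tau> (\<lambda>x. x gchoose k) = padic_integral p Zp \<mu> (\<lambda>x. (x + of_nat c) gchoose k)"
      unfolding \<tau>_def by (rule integral_pushforward) (use tr bm u in auto)
    then have "fps_nth (amice_transform p \<mu> * (1 + fps_X) ^ c) k - fps_nth (amice_transform p \<mu>) k =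
      padic_integral p Zp \<tau> (\<lambda>x. x gchoose k) - 1 * padic_integral p Zp \<mu> (\<lambda>x. x gchoose k)"
      using amice_translate[OF bm, of c k] by (simp add: amice_transform_def)
    also have "\<dots> = padic_integral p Zp (\<lambda>U. \<tau> U - 1 * \<mu> U) (\<lambda>x. x gchoose k)"
      by (rule integral_measure_diff[OF pdom_Zp \<tau> bm u, symmetric])
    also have "\<dots> = padic_integral p Zp (\<lambda>U. \<Sum>i<c. 1 * \<delta> i U) (\<lambda>x. x gchoose k) -
      of_nat c * padic_integral p Zp (dirac_measure Zp (of_nat c / 2)) (\<lambda>x. x gchoose k)"
      unfolding eq by (rule integral_measure_diff[OF pdom_Zp \<delta>s \<delta>c u])
    also have "padic_integral p Zp (\<lambda>U. \<Sum>i<c. 1 * \<delta> i U) (\<lambda>x. x gchoose k) =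
      (\<Sum>i<c. 1 * padic_integral p Zp (\<delta> i) (\<lambda>x. x gchoose k))"
      by (rule integral_measure_lincomb[OF pdom_Zp \<delta> u])
    also have "\<dots> = (\<Sum>i<c. (1 / 2 + of_nat i) gchoose k)"
      unfolding \<delta>_def using half_mem_Zp by (simp add: integral_dirac[OF pdom_Zp _ u])
    also have "padic_integral p Zp (dirac_measure Zp (of_nat c / 2)) (\<lambda>x. x gchoose k) = (of_nat c / 2) gchoose k"
      by (rule integral_dirac[OF pdom_Zp c2 u])
    finally show ?thesis .
  qed
  have "fps_binomial (1 / 2) * (\<Sum>i<c. (1 + fps_X) ^ i) = (\<Sum>i<c. fps_binomial (1 / 2 + of_nat i :: 'k))"
    by (simp add: sum_distrib_left fps_binomial_add_mult fps_binomial_of_nat)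
  moreover have "fps_nth (of_nat c * f) k = of_nat c * fps_nth f k" for f :: "'k fps" and k
    by (simp flip: fps_of_nat)
  ultimately show ?thesis
    using coeff by (intro fps_ext) (simp add: algebra_simps fps_sum_nth)
qed

lemma amice_lambda_ball_fls:
  assumes c: "of_nat c \<in> Up" and bm: "bounded_measure Zp \<mu>"
    and \<mu>: "\<And>n x. n \<ge> 1 \<Longrightarrow> x \<in> Zp \<Longrightarrow> \<mu> (pball n x) = lambda_ball c n x"
  shows "fps_to_fls (amice_transform p \<mu>) =
       fps_to_fls (fps_binomial (1 / 2)) / fls_X
       - of_nat c * (fps_to_fls (fps_binomial (of_nat c / 2)) /
                     fps_to_fls ((1 + fps_X) ^ c - 1))"
proof -
  define S where "S = (\<Sum>i<c. (1 + fps_X) ^ i :: 'k fps)"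
  define D where "D = ((1 + fps_X) ^ c - 1 :: 'k fps)"
  define b where "b = (fps_binomial (1 / 2) :: 'k fps)"
  define b' where "b' = (fps_binomial (of_nat c / 2) :: 'k fps)"
  \<comment> \<open>dividing \<open>b S - c b'\<close> by \<open>D = X S\<close> separates the two poles\<close>
  have D: "D = fps_X * S" unfolding D_def S_def by (simp add: power_diff_1_eq)
  have "fps_nth S 0 = of_nat c" unfolding S_def by (simp add: fps_sum_nth fps_power_zeroth)
  then have "S \<noteq> 0" using Up_nonzero[OF c] by auto
  then have nz: "fps_to_fls S \<noteq> 0" "(fls_X :: 'k fls) \<noteq> 0" by auto
  have D': "fps_to_fls D = fls_X * fps_to_fls S" by (simp add: D fls_times_fps_to_fls)
  have "fps_to_fls (amice_transform p \<mu> * D) = fps_to_fls (b * S - of_nat c * b')"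
    using amice_lambda_ball[OF c bm \<mu>] unfolding D_def S_def b_def b'_def by simp
  then have *: "fps_to_fls (amice_transform p \<mu>) * (fls_X * fps_to_fls S) =
    fps_to_fls b * fps_to_fls S - of_nat c * fps_to_fls b'"
    by (simp add: fls_times_fps_to_fls D' fps_to_fls_of_nat)
  have "fps_to_fls (amice_transform p \<mu>) =
    fps_to_fls b / fls_X - of_nat c * (fps_to_fls b' / (fls_X * fps_to_fls S))"
  proof -
    have "fps_to_fls (amice_transform p \<mu>) =
      (fps_to_fls b * fps_to_fls S - of_nat c * fps_to_fls b') / (fls_X * fps_to_fls S)"
      using nz by (simp add: eq_divide_eq *)
    also have "\<dots> = fps_to_fls b / fls_X - of_nat c * (fps_to_fls b' / (fls_X * fps_to_fls S))"
      using nz by (simp add: diff_divide_distrib)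
    finally show ?thesis .
  qed
  then show ?thesis unfolding D'[symmetric] b_def b'_def D_def .
qed

lemma lambda_half:
  assumes c: "admissible p c"
  shows bounded_measure_lambda_half: "bounded_measure Zp (lambda_half p c)"
    and lambda_half_pball: "n \<ge> 1 \<Longrightarrow> x \<in> Zp \<Longrightarrow> lambda_half p c (pball n x) = lambda_ball c n x"
proof -
  have cU: "of_nat c \<in> Up" and odd: "odd c" using admissible_Up[OF c] c by (auto simp: admissible_def)
  obtain \<mu> where \<mu>: "bounded_measure Zp \<mu>" "\<And>n x. n \<ge> 1 \<Longrightarrow> x \<in> Zp \<Longrightarrow> \<mu> (pball n x) = lambda_ball c n x"
    using lambda_ball_measure[OF odd cU] by blast
  have "lambda_half p c = \<mu>"
    unfolding lambda_half_def
  proof (rule the_equality)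
    fix \<nu> :: "'k set \<Rightarrow> 'k"
    assume \<nu>: "bounded_measure Zp \<nu> \<and> fps_to_fls (amice_transform p \<nu>) =
       fps_to_fls (fps_binomial (1 / 2)) / fls_X
       - of_nat c * (fps_to_fls (fps_binomial (of_nat c / 2)) / fps_to_fls ((1 + fps_X) ^ c - 1))"
    then have "fps_to_fls (amice_transform p \<nu>) = fps_to_fls (amice_transform p \<mu>)"
      using amice_lambda_ball_fls[OF cU \<mu>] by simp
    then show "\<nu> = \<mu>" using amice_transform_inj[of \<nu> \<mu>] \<nu> \<mu>(1) by simp
  qed (use amice_lambda_ball_fls[OF cU \<mu>] \<mu>(1) in blast)
  then show "bounded_measure Zp (lambda_half p c)"
    "n \<ge> 1 \<Longrightarrow> x \<in> Zp \<Longrightarrow> lambda_half p c (pball n x) = lambda_ball c n x"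
    using \<mu> by auto
qed

lemma bounded_measure_lambda_half_units:
  "admissible p c \<Longrightarrow> bounded_measure Up (lambda_half_units p c)"
  unfolding lambda_half_units_def by (intro bounded_measure_restrict bounded_measure_lambda_half)

lemma lambda_half_units_pball:
  assumes "admissible p c" "n \<ge> 1" "x \<in> Up"
  shows "lambda_half_units p c (pball n x) = lambda_ball c n x"
proof -
  have "x \<in> Zp" using assms Up_subset by blast
  then show ?thesis
    using level_clopen[OF pdom_Up level_pball[OF pdom_Up assms(3,2)]] lambda_half_pball[OF assms(1,2)]
    by (simp add: lambda_half_units_def restrict_measure_def)
qed

text \<open>
  Both sides have, on the ball around \<open>x\<close>, the mass \<open>E(U) - c E(c\<^sup>-\<^sup>1 U) - d E(d\<^sup>-\<^sup>1 U) + c d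
  E((c d)\<^sup>-\<^sup>1 U)\<close>.
\<close>

lemma lambda_half_units_regulariser:
  assumes c: "admissible p c" and d: "admissible p d"
  shows "lambda_half_units p c \<otimes>\<^bsub>IW\<^esub> regulariser d = lambda_half_units p d \<otimes>\<^bsub>IW\<^esub> regulariser c"
proof -
  have bm: "bounded_measure Up (regulariser c)" "bounded_measure Up (regulariser d)"
    "bounded_measure Up (lambda_half_units p c)" "bounded_measure Up (lambda_half_units p d)"
    using bounded_measure_regulariser admissible_Up bounded_measure_lambda_half_units c d by auto
  have val: "(regulariser d \<star> lambda_half_units p c) (pball n x) =
      bern n (x - 1 / 2) - of_nat c * bern n (x / of_nat c - 1 / 2) - of_nat d * bern n (x / of_nat d - 1 / 2)
      + of_nat c * of_nat d * bern n (x / (of_nat c * of_nat d) - 1 / 2)"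
    if c: "admissible p c" and d: "admissible p d" and n: "n \<ge> 1" "x \<in> Up" for n x c d
  proof -
    have cl: "clopen_in Up (pball n x)" using level_clopen[OF pdom_Up level_pball[OF pdom_Up n(2,1)]] .
    have dU: "of_nat d \<in> Up" by (rule admissible_Up[OF d])
    show ?thesis
      unfolding conv_regulariser[OF dU bounded_measure_lambda_half_units[OF c] cl] scale_pball[OF dU n(2,1)]
      using n dU by (simp add: lambda_half_units_pball[OF c] lambda_ball_def algebra_simps)
  qed
  have "(regulariser d \<star> lambda_half_units p c) =
    ((regulariser c \<star> lambda_half_units p d) :: 'k set \<Rightarrow> 'k)"
    by (rule bounded_measure_eqI[OF pdom_Up bounded_measure_conv[OF bm(2,3)] bounded_measure_conv[OF bm(1,4)]])
      (simp add: val c d mult.commute)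
  then show ?thesis
    using conv_commute[OF bm(3,2)] conv_commute[OF bm(4,1)] by (simp add: mult_IW)
qed

section \<open>The factorization\<close>

text \<open>
  As \<open>p\<close> is prime to \<open>N\<close>, the powers \<open>z\<^bsup>p^n\<^esup>\<close> of \<open>z = \<zeta>\<^sup>a\<close> are again primitive \<open>N\<close>-th roots of
  unity. They take finitely many values, all different from \<open>1\<close>, so the masses of balls are
  bounded.
\<close>

lemma bounded_measure_nu_char:
  assumes z: "primitive_unity_root N (\<zeta>::'k)" and N: "1 < N" and pN: "\<not> p dvd N"
  shows "bounded_measure Up (nu_char p N chi \<zeta>)"
  unfolding nu_char_def
proof (rule bounded_measure_lincomb)
  fix a assume a: "a \<in> totatives N"
  define B where "B = Max ((\<lambda>k. absv (1 / (1 - \<zeta> ^ k))) ` {..<N})"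
  have "bounded_measure Zp (mu_root p (\<zeta> ^ a))"
  proof (rule mu_root)
    fix n
    have e: "(\<zeta> ^ a) ^ (p ^ n) = \<zeta> ^ (a * p ^ n)" by (simp add: power_mult)
    have "coprime p N" using prime_imp_coprime[OF prime_p pN] .
    then have co: "coprime N (a * p ^ n)"
      using a by (simp add: totatives_def coprime_commute)
    show "(\<zeta> ^ a) ^ (p ^ n) \<noteq> 1"
    proof
      assume "(\<zeta> ^ a) ^ (p ^ n) = 1"
      then have "N dvd a * p ^ n" using e primitive_unity_root_power_eq_1_iff[OF z] by simp
      then have "is_unit N" using co by (meson coprime_common_divisor dvd_refl)
      then show False using N by simp
    qed
    have "(\<zeta> ^ a) ^ (p ^ n) = \<zeta> ^ ((a * p ^ n) mod N)"
      unfolding e by (rule primitive_unity_root_power_mod[OF z, symmetric])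
    moreover have "(a * p ^ n) mod N < N" using N by simp
    ultimately show "absv (1 / (1 - (\<zeta> ^ a) ^ (p ^ n))) \<le> B" unfolding B_def by (auto intro!: Max_ge)
  next
    have "\<zeta> ^ N = 1" using z by (simp add: primitive_unity_root_def)
    then have "absv \<zeta> = 1" using absv_root_of_unity N by simp
    then show "absv (\<zeta> ^ a) = 1" by (simp add: absv_power)
  qed
  then show "bounded_measure Up (nu_root p (\<zeta> ^ a))" by (rule bounded_measure_nu_root)
qed auto

lemma admissible_exists: "\<exists>c. admissible p c"
  using mellin_regulariser_nonzero_generic[of 0 0] by auto

lemma iwasawa_frac_eqI:
  assumes "A \<in> carrier IW" "r \<in> reg_set p" "B \<in> carrier IW" "t \<in> reg_set p"
    "A \<otimes>\<^bsub>IW\<^esub> t = B \<otimes>\<^bsub>IW\<^esub> r"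
  shows "iwasawa_frac p A r = iwasawa_frac p B t"
proof -
  interpret ring_mult_monoid IW by (intro ring_mult_monoid.intro comm_monoid_IW)
  show ?thesis
    unfolding iwasawa_frac_def using assms
    by (intro loc_frac_eqI reg_set_carrier reg_set_one reg_set_mult) (auto simp: iwasawa_rel_iff)
qed

lemma zeta_half_eq:
  assumes c: "admissible p c"
  shows "zeta_half p = iwasawa_frac p (lambda_half_units p c) (regulariser c :: 'k set \<Rightarrow> 'k)"
  unfolding zeta_half_def
proof (rule the_equality)
  show "\<forall>d. admissible p d \<longrightarrow> iwasawa_frac p (lambda_half_units p c) (regulariser c :: 'k set \<Rightarrow> 'k) =
    iwasawa_frac p (lambda_half_units p d) (regulariser d)"
  proof (intro allI impI)
    fix d assume d: "admissible p d"
    show "iwasawa_frac p (lambda_half_units p c) (regulariser c :: 'k set \<Rightarrow> 'k) =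
      iwasawa_frac p (lambda_half_units p d) (regulariser d)"
      using c d by (intro iwasawa_frac_eqI lambda_half_units_regulariser)
        (simp_all add: regulariser_reg_set bounded_measure_lambda_half_units)
  qed
qed (use c in blast)

lemma char_pseudomeasure_eq:
  assumes \<nu>: "bounded_measure Up (nu_char p N chi \<zeta>)" and c: "admissible p c"
  shows "char_pseudomeasure p N chi \<zeta> =
    iwasawa_frac p (lambda_half_units p c \<otimes>\<^bsub>IW\<^esub> nu_char p N chi \<zeta>) (regulariser c :: 'k set \<Rightarrow> 'k)"
  unfolding char_pseudomeasure_def
proof (rule the_equality)
  interpret comm_monoid IW by (rule comm_monoid_IW)
  define \<nu> where "\<nu> = nu_char p N chi \<zeta>"
  have \<nu>c: "\<nu> \<in> carrier IW" using assms(1) by (simp add: \<nu>_def)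
  show "\<forall>d. admissible p d \<longrightarrow>
    iwasawa_frac p (lambda_half_units p c \<otimes>\<^bsub>IW\<^esub> nu_char p N chi \<zeta>) (regulariser c :: 'k set \<Rightarrow> 'k) =
    iwasawa_frac p (lambda_half_units p d \<otimes>\<^bsub>IW\<^esub> nu_char p N chi \<zeta>) (regulariser d)"
    unfolding \<nu>_def[symmetric]
  proof (intro allI impI)
    fix d assume d: "admissible p d"
    have l: "lambda_half_units p c \<in> carrier IW" "lambda_half_units p d \<in> carrier IW"
      using bounded_measure_lambda_half_units c d by auto
    have r: "regulariser c \<in> (reg_set p :: ('k set \<Rightarrow> 'k) set)" "regulariser d \<in> (reg_set p :: ('k set \<Rightarrow> 'k) set)"
      using regulariser_reg_set c d by auto
    then have r': "regulariser c \<in> carrier IW" "regulariser d \<in> carrier IW" using reg_set_carrier by blast+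
    have "(lambda_half_units p c \<otimes>\<^bsub>IW\<^esub> \<nu>) \<otimes>\<^bsub>IW\<^esub> regulariser d =
      (lambda_half_units p c \<otimes>\<^bsub>IW\<^esub> regulariser d) \<otimes>\<^bsub>IW\<^esub> \<nu>"
      using l r' \<nu>c by (simp only: m_ac m_closed)
    also have "\<dots> = (lambda_half_units p d \<otimes>\<^bsub>IW\<^esub> regulariser c) \<otimes>\<^bsub>IW\<^esub> \<nu>"
      by (simp only: lambda_half_units_regulariser[OF c d])
    also have "\<dots> = (lambda_half_units p d \<otimes>\<^bsub>IW\<^esub> \<nu>) \<otimes>\<^bsub>IW\<^esub> regulariser c"
      using l r' \<nu>c by (simp only: m_ac m_closed)
    finally show "iwasawa_frac p (lambda_half_units p c \<otimes>\<^bsub>IW\<^esub> \<nu>) (regulariser c :: 'k set \<Rightarrow> 'k) =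
      iwasawa_frac p (lambda_half_units p d \<otimes>\<^bsub>IW\<^esub> \<nu>) (regulariser d)"
      using l r \<nu>c by (intro iwasawa_frac_eqI m_closed)
  qed
qed (use c in blast)

lemma char_pseudomeasure_factorization:
  assumes \<nu>: "bounded_measure Up (nu_char p N chi \<zeta>)"
  shows "char_pseudomeasure p N chi \<zeta> =
    zeta_half p \<otimes>\<^bsub>iwasawa_loc p\<^esub> iwasawa_embed p (nu_char p N chi (\<zeta>::'k))"
proof -
  interpret ring_mult_monoid IW by (intro ring_mult_monoid.intro comm_monoid_IW)
  obtain c where c: "admissible p c" using admissible_exists by blast
  have l: "lambda_half_units p c \<in> carrier IW" "nu_char p N chi \<zeta> \<in> carrier IW"
    using bounded_measure_lambda_half_units c \<nu> by auto
  have r: "(regulariser c :: 'k set \<Rightarrow> 'k) \<in> reg_set p" by (rule regulariser_reg_set[OF c])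
  have "zeta_half p \<otimes>\<^bsub>iwasawa_loc p\<^esub> iwasawa_embed p (nu_char p N chi \<zeta>) =
    iwasawa_frac p (lambda_half_units p c \<otimes>\<^bsub>IW\<^esub> nu_char p N chi \<zeta>) (regulariser c \<otimes>\<^bsub>IW\<^esub> \<one>\<^bsub>IW\<^esub>)"
    unfolding zeta_half_eq[OF c] iwasawa_loc_def iwasawa_embed_def iwasawa_frac_def
    by (rule loc_frac_mult[OF reg_set_carrier reg_set_one reg_set_mult l(1) r l(2) reg_set_one])
  also have "regulariser c \<otimes>\<^bsub>IW\<^esub> \<one>\<^bsub>IW\<^esub> = regulariser c"
    using r reg_set_carrier by (intro r_one) blast
  finally show ?thesis using char_pseudomeasure_eq[OF \<nu> c] by simp
qed

lemma mellin_char_pseudomeasure: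
  assumes \<nu>: "bounded_measure Up (nu_char p N chi \<zeta>)" and s: "s \<in> Zp"
    and js: "\<not> (j mod (int p - 1) = (- 1) mod (int p - 1) \<and> s = - 1)"
  shows "mellin_loc p (char_pseudomeasure p N chi \<zeta>) j s =
    zeta_half_branch p j s * mellin p (nu_char p N chi \<zeta>) j s"
proof -
  obtain c where c: "admissible p c" "mellin p (regulariser c) j s \<noteq> 0"
    using mellin_regulariser_nonzero[OF s js] by blast
  have l: "bounded_measure Up (lambda_half_units p c)" by (rule bounded_measure_lambda_half_units[OF c(1)])
  have r: "(regulariser c :: 'k set \<Rightarrow> 'k) \<in> reg_set p" by (rule regulariser_reg_set[OF c(1)])
  have "mellin_loc p (char_pseudomeasure p N chi \<zeta>) j s =
    mellin p (lambda_half_units p c \<otimes>\<^bsub>IW\<^esub> nu_char p N chi \<zeta>) j s / mellin p (regulariser c) j s"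
    unfolding char_pseudomeasure_eq[OF \<nu> c(1)]
    using bounded_measure_conv[OF l \<nu>] by (intro mellin_loc_frac r s c) (simp add: mult_IW)
  also have "\<dots> = mellin p (lambda_half_units p c) j s / mellin p (regulariser c) j s
      * mellin p (nu_char p N chi \<zeta>) j s"
    by (simp add: mult_IW mellin_conv[OF l \<nu> s])
  also have "mellin p (lambda_half_units p c) j s / mellin p (regulariser c) j s = zeta_half_branch p j s"
    unfolding zeta_half_branch_def zeta_half_eq[OF c(1)] by (rule mellin_loc_frac[OF l r s c(2), symmetric])
  finally show ?thesis .
qed

end

theorem theorem4p34:
  fixes p N :: nat and chi :: "int \<Rightarrow> 'k::{field_char_0,complete_space}" and \<zeta> :: 'k
  assumes "padic_finite_extension p TYPE('k)"
    and "odd p"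
    and "\<not> p dvd N"
    and "primitive_char N chi"
    and "odd_char chi"
    and "primitive_unity_root N \<zeta>"
  shows "char_pseudomeasure p N chi \<zeta> =
           zeta_half p \<otimes>\<^bsub>iwasawa_loc p\<^esub> iwasawa_embed p (nu_char p N chi \<zeta>) \<and>
         (\<forall>j::int. \<forall>s\<in>padic_ints. \<not> (j mod (int p - 1) = (- 1) mod (int p - 1) \<and> s = - 1) \<longrightarrow>
            mellin_loc p (char_pseudomeasure p N chi \<zeta>) j s =
              gauss_sum N chi \<zeta> * zeta_half_branch p j s * padic_L_inverse p N chi \<zeta> j s)"
proof -
  interpret odd_padic_extension p "TYPE('k)" using assms(1,2) by unfold_locales
  have "dirichlet_char N chi" "0 < N"
    using assms(4,6) by (simp_all add: primitive_char_def primitive_unity_root_def)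
  then have N: "1 < N" using odd_char_modulus_gt_1 assms(5) by blast
  have \<nu>: "bounded_measure padic_units (nu_char p N chi \<zeta>)"
    by (rule bounded_measure_nu_char[OF assms(6) N assms(3)])
  have "gauss_sum N chi \<zeta> \<noteq> 0" by (rule gauss_sum_nonzero[OF assms(4,6) N])
  then have L: "gauss_sum N chi \<zeta> * zeta_half_branch p j s * padic_L_inverse p N chi \<zeta> j s =
    zeta_half_branch p j s * mellin p (nu_char p N chi \<zeta>) j s" for j s
    by (simp add: padic_L_inverse_def)
  show ?thesis
  proof (intro conjI allI ballI impI)
    show "char_pseudomeasure p N chi \<zeta> =
        zeta_half p \<otimes>\<^bsub>iwasawa_loc p\<^esub> iwasawa_embed p (nu_char p N chi \<zeta>)"
      by (rule char_pseudomeasure_factorization[OF \<nu>])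
    fix j :: int and s :: 'k assume "s \<in> padic_ints" "\<not> (j mod (int p - 1) = (- 1) mod (int p - 1) \<and> s = - 1)"
    then show "mellin_loc p (char_pseudomeasure p N chi \<zeta>) j s =
        gauss_sum N chi \<zeta> * zeta_half_branch p j s * padic_L_inverse p N chi \<zeta> j s"
      unfolding L by (rule mellin_char_pseudomeasure[OF \<nu>])
  qed
qed

end
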